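(* Let $(\alpha,\beta)\in(\mathbb{R}\setminus\{0\})\times\mathbb{R}$ and let $\phi\in A(b,a)$ be absolutely continuous on $[0,b)$ with $\phi(0)=1$. Set $$\Pi^{\alpha,\beta}\phi=\phi\,(\alpha+\beta\tau\phi),\qquad H_t(x)=\left(\frac{\alpha\,\phi(t)}{\Pi^{\alpha,\beta}\phi(t)}\right)^{\frac12}\exp\left(\frac{\beta}{2}\,\frac{x^2}{\phi(t)\,\Pi^{\alpha,\beta}\phi(t)}\right),$$ and let $$\ell=\begin{cases} b&\text{if }\alpha(\alpha+\beta a)>0,\\ \varrho\circ\tau\phi\left(-\frac{\alpha}{\beta}\right)&\text{otherwise.}\end{cases}$$ Then the process $(H_t(X_t))_{0\le t<\ell}$ is a $\mathbb{P}^\phi$-martingale. Furthermore, the absolute-continuity relationship $$d\mathbb{P}^{\Pi^{\alpha,\beta}\phi}_{x}\big|_{\mathcal{F}_t}=\frac{H_t(X_t)}{H_0(x)}\,d\mathbb{P}^{\phi}_{x}\big|_{\mathcal{F}_t}$$ holds for all $x\in\mathbb{R}$ and $t<\ell$. Consequently, for any reals $x$ and $y$, $$\mathbb{P}^{\Pi^{\alpha,\beta}\phi}_x(T_y\in dt)=\frac{H_t(y)}{H_0(x)}\,\mathbb{P}^{\phi}_x(T_y\in dt),\qquad t<\ell.$$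
   Context: $\tau\phi(t)=\int_0^t\phi^{-2}(s)\,ds$. For $a,b>0$, $\phi\in A(b,a)$ means that $\phi$ is continuous on $[0,b)$, that $\phi$ or $-\phi$ takes values in $(0,\infty)$, and that $\tau\phi(b)=a$ (limit at the endpoint). $\varrho\circ\tau\phi$ is the inverse function of $\tau\phi$, with $\varrho\circ\tau\phi(a)=b$. For an absolutely continuous nowhere vanishing function $\psi$ on an interval $[0,c)$, $\mathbb{P}^\psi=(\mathbb{P}^\psi_x)_{x\in\mathbb{R}}$ is the family of laws of the process $X=(X_t)_{0\le t<c}$ which is the unique strong solution of $$dX_t=\frac{\psi'(t)}{\psi(t)}X_t\,dt+dB_t,\qquad X_0=x,$$ where $B$ is a standard Brownian motion. $(\mathcal{F}_t)$ is the filtration of the process $X$. $T_y=\inf\{t>0:\ X_t=y\}$ (within the time interval on which $X$ is defined), with $\inf\emptyset=\infty$. *)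

theory Defs
  imports "HOL-Probability.Probability"
begin

section \<open>Absolutely continuous functions and the class \<open>A(b,a)\<close>\<close>

definition absolutely_continuous_fun_on :: "real \<Rightarrow> real \<Rightarrow> (real \<Rightarrow> real) \<Rightarrow> bool" where
  "absolutely_continuous_fun_on u v f \<longleftrightarrow>
    (\<forall>\<epsilon>>0. \<exists>\<delta>>0. \<forall>(n::nat) l r.
      (\<forall>i<n. u \<le> l i \<and> l i \<le> r i \<and> r i \<le> v) \<longrightarrow>
      disjoint_family_on (\<lambda>i. {l i<..<r i}) {..<n} \<longrightarrow>
      (\<Sum>i<n. r i - l i) < \<delta> \<longrightarrow> (\<Sum>i<n. \<bar>f (r i) - f (l i)\<bar>) < \<epsilon>)"

text \<open>On the half-open interval \<open>[0,c)\<close> absolute continuity is understood locally, i.e. on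
  each compact subinterval, so that the function may be unbounded near \<open>c\<close>.\<close>

definition locally_absolutely_continuous :: "real \<Rightarrow> (real \<Rightarrow> real) \<Rightarrow> bool" where
  "locally_absolutely_continuous c f \<longleftrightarrow> (\<forall>v\<in>{0..<c}. absolutely_continuous_fun_on 0 v f)"

definition tau :: "(real \<Rightarrow> real) \<Rightarrow> real \<Rightarrow> real" where
  "tau \<phi> t = integral {0..t} (\<lambda>s. 1 / (\<phi> s)\<^sup>2)"

definition class_A :: "real \<Rightarrow> real \<Rightarrow> (real \<Rightarrow> real) set" where
  "class_A b a = {\<phi>. 0 < a \<and> 0 < b \<and> continuous_on {0..<b} \<phi> \<and>
     ((\<forall>t\<in>{0..<b}. 0 < \<phi> t) \<or> (\<forall>t\<in>{0..<b}. 0 < - \<phi> t)) \<and>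
     (tau \<phi> \<longlongrightarrow> a) (at_left b)}"

text \<open>The inverse \<open>[0,a] \<rightarrow> [0,b]\<close> of \<open>tau \<phi>\<close>, where \<open>tau \<phi>\<close> takes at \<open>b\<close> its limit \<open>a\<close>.\<close>

definition rho_tau :: "real \<Rightarrow> real \<Rightarrow> (real \<Rightarrow> real) \<Rightarrow> real \<Rightarrow> real" where
  "rho_tau b a \<phi> = the_inv_into {0..b} ((tau \<phi>)(b := a))"

definition Pi_trans :: "real \<Rightarrow> real \<Rightarrow> (real \<Rightarrow> real) \<Rightarrow> real \<Rightarrow> real" where
  "Pi_trans \<alpha> \<beta> \<phi> t = \<phi> t * (\<alpha> + \<beta> * tau \<phi> t)"

definition H_fun :: "real \<Rightarrow> real \<Rightarrow> (real \<Rightarrow> real) \<Rightarrow> real \<Rightarrow> real \<Rightarrow> real" where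
  "H_fun \<alpha> \<beta> \<phi> t x =
     sqrt (\<alpha> * \<phi> t / Pi_trans \<alpha> \<beta> \<phi> t) * exp (\<beta> / 2 * (x\<^sup>2 / (\<phi> t * Pi_trans \<alpha> \<beta> \<phi> t)))"

definition ell :: "real \<Rightarrow> real \<Rightarrow> real \<Rightarrow> real \<Rightarrow> (real \<Rightarrow> real) \<Rightarrow> real" where
  "ell \<alpha> \<beta> b a \<phi> = (if \<alpha> * (\<alpha> + \<beta> * a) > 0 then b else rho_tau b a \<phi> (- (\<alpha> / \<beta>)))"


section \<open>Processes\<close>

definition natural_filtration :: "'w set \<Rightarrow> (real \<Rightarrow> 'w \<Rightarrow> real) \<Rightarrow> real \<Rightarrow> 'w measure" where
  "natural_filtration \<Omega> X t = sigma \<Omega> (\<Union>s\<in>{0..t}. {X s -` A \<inter> \<Omega> | A. A \<in> sets borel})"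

definition augmented_filtration :: "'w measure \<Rightarrow> (real \<Rightarrow> 'w \<Rightarrow> real) \<Rightarrow> real \<Rightarrow> 'w measure" where
  "augmented_filtration M X t =
     sigma (space M) (sets (natural_filtration (space M) X t) \<union> null_sets M)"

definition brownian_motion :: "'w measure \<Rightarrow> (real \<Rightarrow> 'w \<Rightarrow> real) \<Rightarrow> bool" where
  "brownian_motion M B \<longleftrightarrow> prob_space M \<and>
     (\<forall>t\<ge>0. B t \<in> borel_measurable M) \<and>
     (\<forall>\<omega>\<in>space M. continuous_on {0..} (\<lambda>t. B t \<omega>)) \<and>
     (AE \<omega> in M. B 0 \<omega> = 0) \<and>
     (\<forall>s\<ge>0. \<forall>t>s. distributed M lborel (\<lambda>\<omega>. B t \<omega> - B s \<omega>) (normal_density 0 (sqrt (t - s)))) \<and>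
     (\<forall>(n::nat) u. 0 \<le> u 0 \<longrightarrow> (\<forall>i<n. u i \<le> u (Suc i)) \<longrightarrow>
        prob_space.indep_vars M (\<lambda>_. borel) (\<lambda>i \<omega>. B (u (Suc i)) \<omega> - B (u i) \<omega>) {..<n})"

text \<open>Strong solution on \<open>[0,c)\<close> of \<open>dX = (\<psi>'/\<psi>)(t) X dt + dB\<close>, \<open>X\<^sub>0 = x\<close>. The noise is additive, so
  the stochastic integral is just \<open>B\<close>. An absolutely continuous \<open>\<psi>\<close> is differentiable only almost
  everywhere; the values of \<open>deriv \<psi>\<close> elsewhere do not affect the integral.\<close>

definition strong_solution ::
  "'w measure \<Rightarrow> (real \<Rightarrow> 'w \<Rightarrow> real) \<Rightarrow> (real \<Rightarrow> real) \<Rightarrow> real \<Rightarrow> real \<Rightarrow> (real \<Rightarrow> 'w \<Rightarrow> real) \<Rightarrow> bool"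
where
  "strong_solution M B \<psi> c x X \<longleftrightarrow>
     (\<forall>t\<in>{0..<c}. X t \<in> borel_measurable (augmented_filtration M B t)) \<and>
     (\<forall>\<omega>\<in>space M. continuous_on {0..<c} (\<lambda>t. X t \<omega>)) \<and>
     (AE \<omega> in M. \<forall>t\<in>{0..<c}.
        (\<lambda>s. deriv \<psi> s / \<psi> s * X s \<omega>) absolutely_integrable_on {0..t} \<and>
        X t \<omega> = x + integral {0..t} (\<lambda>s. deriv \<psi> s / \<psi> s * X s \<omega>) + B t \<omega>)"


section \<open>Laws on path space\<close>

text \<open>The space \<open>C([0,c))\<close> with the \<open>\<sigma>\<close>-algebra generated by the coordinates. Paths are represented
  by functions that are \<open>undefined\<close> outside \<open>[0,c)\<close>.\<close>

definition path_space :: "real \<Rightarrow> (real \<Rightarrow> real) measure" where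
  "path_space c = restrict_space (Pi\<^sub>M {0..<c} (\<lambda>_. borel)) {\<omega>. continuous_on {0..<c} \<omega>}"

definition path_law :: "'w measure \<Rightarrow> real \<Rightarrow> (real \<Rightarrow> 'w \<Rightarrow> real) \<Rightarrow> (real \<Rightarrow> real) measure" where
  "path_law M c X = distr M (path_space c) (\<lambda>\<omega>. \<lambda>t\<in>{0..<c}. X t \<omega>)"

definition path_filtration :: "real \<Rightarrow> real \<Rightarrow> (real \<Rightarrow> real) measure" where
  "path_filtration c = natural_filtration (space (path_space c)) (\<lambda>t \<omega>. \<omega> t)"

text \<open>The image on \<open>C([0,c))\<close> of a law on a path space with a larger time horizon.\<close>

definition shorten_law :: "real \<Rightarrow> (real \<Rightarrow> real) measure \<Rightarrow> (real \<Rightarrow> real) measure" where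
  "shorten_law c P = distr P (path_space c) (\<lambda>\<omega>. restrict \<omega> {0..<c})"

definition martingale ::
  "'w measure \<Rightarrow> (real \<Rightarrow> 'w measure) \<Rightarrow> real \<Rightarrow> (real \<Rightarrow> 'w \<Rightarrow> real) \<Rightarrow> bool"
where
  "martingale M F c Z \<longleftrightarrow>
     (\<forall>t\<in>{0..<c}. subalgebra M (F t) \<and> Z t \<in> borel_measurable (F t) \<and> integrable M (Z t)) \<and>
     (\<forall>s t. 0 \<le> s \<longrightarrow> s \<le> t \<longrightarrow> t < c \<longrightarrow> (AE \<omega> in M. real_cond_exp M (F s) (Z t) \<omega> = Z s \<omega>))"

text \<open>First hitting time of \<open>y\<close> by a path on \<open>[0,c)\<close>; the infimum of the empty set is \<open>\<infinity>\<close>.\<close>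

definition hitting_time :: "real \<Rightarrow> real \<Rightarrow> (real \<Rightarrow> real) \<Rightarrow> ereal" where
  "hitting_time c y \<omega> = Inf (ereal ` {t. 0 < t \<and> t < c \<and> \<omega> t = y})"

text \<open>The measure \<open>P(T\<^sub>y \<in> dt)\<close> on \<open>0 \<le> t < l\<close>, for a law \<open>P\<close> on \<open>C([0,c))\<close>.\<close>

definition hitting_law ::
  "(real \<Rightarrow> real) measure \<Rightarrow> real \<Rightarrow> real \<Rightarrow> real \<Rightarrow> ereal measure"
where
  "hitting_law P c y l = restrict_space (distr P borel (hitting_time c y)) {0..<ereal l}"

end

theory Submission
  imports Defs
begin

text \<open>Put \<open>\<psi> = \<Pi>\<phi>\<close>. The solution \<open>X\<close> of the equation driven by \<open>\<phi>\<close> satisfies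
  \<open>X\<^sub>t/\<phi>(t) - X\<^sub>s/\<phi>(s) = \<integral> \<phi>\<^sup>-\<^sup>1 dB\<close> over \<open>[s,t]\<close>, so \<open>X/\<phi>\<close> has independent Gaussian increments with
  variance \<open>\<tau>\<phi>(t) - \<tau>\<phi>(s)\<close>, and \<open>X\<close> is a Markov process with explicit Gaussian transition densities.
  Since \<open>\<tau>\<psi> = \<tau>\<phi> / (\<alpha> (\<alpha> + \<beta> \<tau>\<phi>))\<close>, completing the square shows that the transition density for \<open>\<psi>\<close> is the
  one for \<open>\<phi>\<close> times \<open>H\<^sub>t(u) / H\<^sub>s(y)\<close>. This is the absolute continuity relation on cylinder events, hence
  on the filtration, and the martingale property follows from it. The law of the hitting time is
  obtained by applying the relation on a fine partition of \<open>[0,u)\<close>; the passage to the limit is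
  by bounded convergence, because either \<open>H\<close> or \<open>1/H\<close> is bounded on each \<open>[0,t] \<times> \<real>\<close>, according to
  the sign of \<open>\<alpha>\<beta>\<close>.

  The drift contains the almost everywhere derivative of an absolutely continuous function, so the
  fundamental theorem of calculus for such functions is needed as well: a density is obtained from
  the Radon-Nikodym theorem, applied to the positive variation, and is identified with the
  derivative by Lebesgue's differentiation theorem.\<close>

section \<open>Absolutely continuous functions\<close>

text \<open>Two things shape the argument. First, the solutions for \<phi> and for \<psi> may live
  on unrelated probability spaces with unrelated Brownian motions, so no change of measure can be
  made on a common space; everything is read off the finite-dimensional laws. These are explicit
  because the noise is additive and 1/\<phi> is absolutely continuous: the integral of 1/\<phi>
  against B is a limit of sums for each path, by summation by parts, and no stochastic integration
  is involved. Second, the drift contains the actual function \<open>deriv \<phi>\<close>, which is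
  meaningful only almost everywhere, so the product rule and the fundamental theorem have to be
  available in exactly that form. The function tau is the clock of X/\<phi>. Along this clock
  \<alpha> + \<beta> tau is affine, and \<open>l\<close> is the time of its first zero if that
  occurs on the closed clock interval [0,a], and b otherwise; hence \<psi> keeps its sign on [0,l).
  When \<alpha>\<beta> > 0 the function H is unbounded in space; the hitting-time relation is then
  proved with the two laws exchanged and inverted afterwards.\<close>

text \<open>Truncation: by dominated convergence the part of |f| above a level n has integral below
  e/2, and below that level a set E contributes at most n times its measure.\<close>

lemma integrable_uniformly_small:
  fixes f :: "'a \<Rightarrow> real"
  assumes f: "integrable M f" and e: "e > 0"
  shows "\<exists>d>0. \<forall>E\<in>sets M. emeasure M E < ennreal d \<longrightarrow> (LINT x:E|M. \<bar>f x\<bar>) < e"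
proof -
  let ?T = "\<lambda>n::nat. {x \<in> space M. \<bar>f x\<bar> > real n}"
  have [measurable]: "f \<in> borel_measurable M" using f by auto
  have "(\<lambda>n. LINT x|M. indicator (?T n) x * \<bar>f x\<bar>) \<longlonglongrightarrow> (LINT x|M. 0)"
  proof (rule integral_dominated_convergence[where w="\<lambda>x. \<bar>f x\<bar>"])
    show "AE x in M. (\<lambda>n. indicator (?T n) x * \<bar>f x\<bar>) \<longlonglongrightarrow> 0"
    proof (intro AE_I2 tendsto_eventually)
      fix x assume "x \<in> space M"
      obtain m :: nat where m: "\<bar>f x\<bar> < real m" using reals_Archimedean2 by blast
      show "\<forall>\<^sub>F n in sequentially. indicator (?T n) x * \<bar>f x\<bar> = 0"
        using m by (intro eventually_sequentiallyI[of m]) (auto simp: indicator_def)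
    qed
  qed (use f in \<open>auto simp: indicator_def\<close>)
  then have "\<forall>\<^sub>F n in sequentially. (LINT x|M. indicator (?T n) x * \<bar>f x\<bar>) < e / 2"
    using e by (intro order_tendstoD(2)[where y="LINT x|M. (0::real)"]) auto
  then obtain n where n: "(LINT x|M. indicator (?T n) x * \<bar>f x\<bar>) < e / 2"
    by (auto simp: eventually_sequentially)
  show ?thesis
  \<comment> \<open>With this bound n times the measure of E is at most e/2; the summand 1 covers
    the level n = 0.\<close>
  proof (intro exI[of _ "e / (2 * (real n + 1))"] conjI ballI impI)
    show "e / (2 * (real n + 1)) > 0" using e by simp
    fix E assume E [measurable]: "E \<in> sets M" and small: "emeasure M E < ennreal (e / (2 * (real n + 1)))"
    then have fin: "emeasure M E < \<infinity>" by (metis ennreal_less_top infinity_ennreal_def order.strict_trans)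
    have iT: "integrable M (\<lambda>x. indicator (?T n) x * \<bar>f x\<bar>)"
      using integrable_mult_indicator[OF _ integrable_abs[OF f], of "?T n"] by simp
    have iE: "integrable M (\<lambda>x. real n * indicator E x)"
      using fin by (intro integrable_mult_right integrable_real_indicator) auto
    have "measure M E < e / (2 * (real n + 1))"
      using small fin e by (simp add: measure_def enn2real_less_iff)
    then have "real n * measure M E \<le> e / 2"
      using e by (simp add: field_simps) (smt (verit) mult_left_mono measure_nonneg mult_nonneg_nonneg of_nat_0_le_iff)
    moreover have "(LINT x:E|M. \<bar>f x\<bar>) \<le> (LINT x|M. indicator (?T n) x * \<bar>f x\<bar> + real n * indicator E x)"
      unfolding set_lebesgue_integral_def
    proof (rule integral_mono)
      show "integrable M (\<lambda>x. indicator (?T n) x * \<bar>f x\<bar> + real n * indicator E x)" 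
        using iT iE by auto
    qed (use integrable_mult_indicator[OF E integrable_abs[OF f]] in \<open>auto simp: indicator_def\<close>)
    moreover have "\<dots> = (LINT x|M. indicator (?T n) x * \<bar>f x\<bar>) + real n * measure M E"
      using Bochner_Integration.integral_add[OF iT iE] fin
      by simp
    ultimately show "(LINT x:E|M. \<bar>f x\<bar>) < e" using n by linarith
  qed
qed

text \<open>A Vitali family of disjoint intervals W covers almost all of S inside an open set only
  slightly larger than {f \<le> q}. Its averages exceed r, while f is at most q on most of W, so (r
  - q) times the measure of W is small. The intervals contain x without being centred there, as
  one-sided difference quotients require.\<close>

lemma negligible_large_average:
  fixes f :: "real \<Rightarrow> real"
  assumes f: "integrable lebesgue f" and qr: "q < r"
    and S: "\<And>x. x \<in> S \<Longrightarrow> f x \<le> q"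
      "\<And>x d. x \<in> S \<Longrightarrow> d > 0 \<Longrightarrow>
        \<exists>m h. 0 < h \<and> h < d \<and> x \<in> cball m h \<and> (LINT y:cball m h|lebesgue. f y) > r * (2 * h)"
    and bdd: "bounded S"
  shows "negligible S"
  unfolding negligible_outer_le
proof (intro allI impI)
  fix e :: real assume e: "e > 0"
  have [measurable]: "f \<in> borel_measurable lebesgue" using f by auto
  obtain K0 where K0: "\<forall>x\<in>S. norm x \<le> K0" using bdd bounded_iff by blast
  define K where "K = \<bar>K0\<bar> + 1"
  have K: "S \<subseteq> {-K..K}" "K > 0" using K0 by (force simp: K_def abs_le_iff)+
  \<comment> \<open>S need not be measurable; A is a measurable superset on which the bound by q
    persists.\<close>
  define A where "A = {x. f x \<le> q} \<inter> {-K..K}"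
  have "{x \<in> space lebesgue. f x \<le> q} \<in> sets lebesgue" by measurable
  then have A: "A \<in> sets lebesgue" by (auto simp: A_def)
  have SA: "S \<subseteq> A" using S(1) K by (auto simp: A_def)
  \<comment> \<open>Two errors of size e' arise below, and 2 e' = (r - q) e.\<close>
  define e' where "e' = e * (r - q) / 2"
  have e': "e' > 0" using e qr by (simp add: e'_def)
  obtain d where d: "d > 0" "\<And>E. E \<in> sets lebesgue \<Longrightarrow> emeasure lebesgue E < ennreal d \<Longrightarrow> (LINT x:E|lebesgue. \<bar>f x\<bar>) < e'"
    using integrable_uniformly_small[OF f e'] by blast
  \<comment> \<open>The excess U - A is made small for both errors: the integral of |f| over it, and
    |q| times its measure.\<close>
  define d' where "d' = min d (e' / (\<bar>q\<bar> + 1))"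
  have d': "d' > 0" using d e' by (auto simp: d'_def)
  obtain U where U: "open U" "A \<subseteq> U" "U - A \<in> lmeasurable" "emeasure lebesgue (U - A) < ennreal d'"
    using sets_lebesgue_outer_open[OF A d'] .
  have intUA: "(LINT x:U - A|lebesgue. \<bar>f x\<bar>) < e'"
  proof (rule d(2))
    show "U - A \<in> sets lebesgue" using U(3) by (simp add: fmeasurableD)
    have "ennreal d' \<le> ennreal d" by (intro ennreal_leI) (simp add: d'_def)
    then show "emeasure lebesgue (U - A) < ennreal d" using U(4) by (rule order_less_le_trans[rotated])
  qed
  have mUA: "\<bar>q\<bar> * measure lebesgue (U - A) \<le> e'"
  proof -
    have "measure lebesgue (U - A) \<le> d'"
      using U(3,4) d' by (metis emeasure_eq_measure2 ennreal_less_iff less_imp_le measure_nonneg)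
    also have "\<dots> \<le> e' / (\<bar>q\<bar> + 1)" by (simp add: d'_def)
    finally have "measure lebesgue (U - A) * (\<bar>q\<bar> + 1) \<le> e'" by (simp add: field_simps)
    moreover have "measure lebesgue (U - A) * (\<bar>q\<bar> + 1) = \<bar>q\<bar> * measure lebesgue (U - A) + measure lebesgue (U - A)"
      by (simp add: algebra_simps)
    moreover have "0 \<le> measure lebesgue (U - A)" by (rule measure_nonneg)
    ultimately show ?thesis by linarith
  qed
  define I where "I = {(m::real, h). 0 < h \<and> cball m h \<subseteq> U \<and> (LINT y:cball m h|lebesgue. f y) > r * (2 * h)}"
  have cov: "\<exists>i. i \<in> I \<and> x \<in> cball (fst i) (snd i) \<and> snd i < d" if x: "x \<in> S" and d: "d > 0" for x d
  proof -
    obtain k where k: "k > 0" "ball x k \<subseteq> U" using U x SA open_contains_ball by blast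
    obtain m h where mh: "0 < h" "h < min d (k/2)" "x \<in> cball m h" "(LINT y:cball m h|lebesgue. f y) > r * (2 * h)"
      using S(2)[OF x, of "min d (k/2)"] d k by auto
    have "cball m h \<subseteq> ball x k" using mh by (auto simp: dist_real_def)
    then show ?thesis using mh k by (intro exI[of _ "(m,h)"]) (auto simp: I_def)
  qed
  obtain C where C: "countable C" "C \<subseteq> I"
    "pairwise (\<lambda>i j. disjnt (cball (fst i) (snd i)) (cball (fst j) (snd j))) C"
    "negligible (S - (\<Union>i\<in>C. cball (fst i) (snd i)))"
    by (rule Vitali_covering_theorem_cballs[of I snd S fst]) (use cov in \<open>auto simp: I_def\<close>)
  let ?J = "\<lambda>i::real \<times> real. cball (fst i) (snd i)"
  have fin: "measure lebesgue (\<Union>i\<in>D. ?J i) \<le> e" if D: "D \<subseteq> C" "finite D" for D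
  proof -
    define W where "W = (\<Union>i\<in>D. ?J i)"
    have Wm: "W \<in> lmeasurable" unfolding W_def using D(2) by (intro fmeasurable.finite_UN) auto
    have Ws: "W \<in> sets lebesgue" using Wm by (simp add: fmeasurableD)
    have "?J i \<subseteq> U" if "i \<in> D" for i
    proof -
      have "i \<in> I" using that D C(2) by blast
      then show ?thesis by (cases i) (simp add: I_def)
    qed
    then have WU: "W \<subseteq> U" unfolding W_def by blast
    have dis: "disjoint_family_on ?J D"
      using C(3) D(1) unfolding disjoint_family_on_def pairwise_def disjnt_def by blast
    have si: "set_integrable lebesgue E f" if "E \<in> sets lebesgue" for E
      unfolding set_integrable_def using that f by (rule integrable_mult_indicator)
    have siabs: "set_integrable lebesgue E (\<lambda>x. \<bar>f x\<bar>)" if "E \<in> sets lebesgue" for E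
      using si[OF that] by (rule set_integrable_abs)
    have "r * measure lebesgue W = (\<Sum>i\<in>D. r * (2 * snd i))"
    proof -
      have "measure lebesgue W = (\<Sum>i\<in>D. measure lebesgue (?J i))" unfolding W_def
      proof (rule measure_finite_Union[OF D(2) _ dis])
        show "emeasure lebesgue (?J i) \<noteq> \<infinity>" for i
          unfolding infinity_ennreal_def by (rule fmeasurableD2[OF lmeasurable_cball])
      qed auto
      also have "\<dots> = (\<Sum>i\<in>D. 2 * snd i)"
      proof (rule sum.cong)
        fix i assume "i \<in> D"
        then have "snd i > 0" using D C by (auto simp: I_def)
        then show "measure lebesgue (?J i) = 2 * snd i" by (simp add: cball_eq_atLeastAtMost)
      qed simp
      finally show ?thesis by (simp add: sum_distrib_left)
    qed
    also have "\<dots> \<le> (\<Sum>i\<in>D. LINT y:?J i|lebesgue. f y)"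
      using D C(2) by (intro sum_mono) (auto simp: I_def less_imp_le split: prod.splits dest!: subsetD)
    also have "\<dots> = (LINT y:W|lebesgue. f y)" unfolding W_def
      using D(2) dis by (intro set_integral_finite_Union[symmetric] si) auto
    also have "\<dots> = (LINT y:(W \<inter> A) \<union> (W - A)|lebesgue. f y)" by (simp add: Int_Diff_Un)
    also have "\<dots> = (LINT y:W \<inter> A|lebesgue. f y) + (LINT y:W - A|lebesgue. f y)"
      using Ws A by (intro set_integral_Un si) auto
    also have "(LINT y:W \<inter> A|lebesgue. f y) \<le> (LINT y:W \<inter> A|lebesgue. q)"
    proof (rule set_integral_mono)
      show "set_integrable lebesgue (W \<inter> A) (\<lambda>x. q)"
        using fmeasurable_Int_fmeasurable[OF Wm A] 
        by (auto simp: set_integrable_def fmeasurable_def intro!: integrable_mult_left integrable_real_indicator)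
    qed (use Ws A in \<open>auto intro!: si simp: A_def\<close>)
    also have "(LINT y:W \<inter> A|lebesgue. q) = q * measure lebesgue (W \<inter> A)"
      using fmeasurable_Int_fmeasurable[OF Wm A] by (simp add: set_lebesgue_integral_def fmeasurable_def mult.commute)
    also have "(LINT y:W - A|lebesgue. f y) \<le> (LINT y:W - A|lebesgue. \<bar>f y\<bar>)"
      using Ws A by (intro set_integral_mono si siabs) auto
    also have "\<dots> \<le> (LINT y:U - A|lebesgue. \<bar>f y\<bar>)"
      unfolding set_lebesgue_integral_def
    proof (rule integral_mono)
      show "integrable lebesgue (\<lambda>x. indicator (W - A) x *\<^sub>R \<bar>f x\<bar>)"
        using siabs[of "W - A"] Ws A unfolding set_integrable_def by blast
      show "integrable lebesgue (\<lambda>x. indicator (U - A) x *\<^sub>R \<bar>f x\<bar>)"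
        using siabs[of "U - A"] U(3) unfolding set_integrable_def by (blast dest: fmeasurableD)
    qed (use WU in \<open>auto simp: indicator_def\<close>)
    finally have 1: "r * measure lebesgue W \<le> q * measure lebesgue (W \<inter> A) + e'"
      using intUA by simp
    have 2: "measure lebesgue W = measure lebesgue (W \<inter> A) + measure lebesgue (W - A)"
    proof -
      have "W - A \<in> lmeasurable" using Wm A by (simp add: fmeasurable.Diff fmeasurable_Diff)
      then have "measure lebesgue ((W \<inter> A) \<union> (W - A)) = measure lebesgue (W \<inter> A) + measure lebesgue (W - A)"
        using fmeasurable_Int_fmeasurable[OF Wm A] by (intro measure_Un_AE) auto
      then show ?thesis by (simp add: Int_Diff_Un)
    qed
    have 3: "measure lebesgue (W - A) \<le> measure lebesgue (U - A)"
      using WU Ws A U(3) by (intro measure_mono_fmeasurable) auto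
    \<comment> \<open>Passing from q times the measure of \<open>W \<inter> A\<close> to q times
      that of \<open>W\<close> costs a term whose sign is unknown, hence the absolute value of
      q.\<close>
    have "- (q * measure lebesgue (W - A)) \<le> \<bar>q\<bar> * measure lebesgue (W - A)"
      using mult_right_mono[of "-q" "\<bar>q\<bar>" "measure lebesgue (W - A)"] by simp
    also have "\<dots> \<le> \<bar>q\<bar> * measure lebesgue (U - A)" using 3 by (intro mult_left_mono) auto
    also have "\<dots> \<le> e'" by (rule mUA)
    finally have "(r - q) * measure lebesgue W \<le> e' + e'"
      using 1 2 by (simp add: algebra_simps)
    also have "\<dots> = (r - q) * e" by (simp add: e'_def)
    finally show ?thesis unfolding W_def using qr by simp
  qed
  have fin': "measure lebesgue (\<Union>E) \<le> e" if "E \<subseteq> ?J ` C" "finite E" for E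
    using finite_subset_image[OF that(2,1)] fin by auto
  have W: "(\<Union>i\<in>C. ?J i) \<in> lmeasurable" "measure lebesgue (\<Union>i\<in>C. ?J i) \<le> e"
    by (rule fmeasurable_Union_bound[of "?J ` C" lebesgue e] measure_Union_bound[of "?J ` C" lebesgue e];
        use C(1) fin' in auto)+
  show "\<exists>T. S \<subseteq> T \<and> T \<in> lmeasurable \<and> measure lebesgue T \<le> e"
  proof (intro exI[of _ "(S - (\<Union>i\<in>C. ?J i)) \<union> (\<Union>i\<in>C. ?J i)"] conjI)
    have N: "S - (\<Union>i\<in>C. ?J i) \<in> lmeasurable" using C(4) by (rule negligible_imp_measurable)
    show "(S - (\<Union>i\<in>C. ?J i)) \<union> (\<Union>i\<in>C. ?J i) \<in> lmeasurable"
      using N W(1) by (rule fmeasurable.Un)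
    have "measure lebesgue ((S - (\<Union>i\<in>C. ?J i)) \<union> (\<Union>i\<in>C. ?J i))
      \<le> measure lebesgue (S - (\<Union>i\<in>C. ?J i)) + measure lebesgue (\<Union>i\<in>C. ?J i)"
      using N W(1) by (intro measure_Un_le) auto
    then show "measure lebesgue ((S - (\<Union>i\<in>C. ?J i)) \<union> (\<Union>i\<in>C. ?J i)) \<le> e"
      using W(2) negligible_imp_measure0[OF C(4)] by simp
  qed blast
qed

text \<open>F is quantified inside \<open>AE\<close> so that the exceptional null set depends on f
  alone. A point at which averages of f exceed f x by a fixed amount on arbitrarily short intervals
  lies in one of countably many sets \<open>bad\<close> with rational q < r; the same for -f bounds
  the averages from below. A difference quotient of F is an average of f over an interval ending at
  x.\<close>

lemma lebesgue_differentiation: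
  fixes f :: "real \<Rightarrow> real"
  assumes f: "integrable lebesgue f"
  shows "AE x in lebesgue. \<forall>F. (\<forall>u v. a \<le> u \<longrightarrow> u \<le> v \<longrightarrow> v \<le> b \<longrightarrow> F v - F u = (LINT y:{u..v}|lebesgue. f y)) \<longrightarrow>
     a < x \<longrightarrow> x < b \<longrightarrow> (F has_real_derivative f x) (at x)"
proof -
  define bad where "bad g q r n = {x::real. \<bar>x\<bar> \<le> real n \<and> g x \<le> q \<and> (\<forall>d>0. \<exists>m h. 0 < h \<and> h < d \<and> x \<in> cball m h \<and> 
      (LINT y:cball m h|lebesgue. g y) > r * (2 * h))}" for g q r and n :: nat
  have bad: "negligible (bad g q r n)" if "integrable lebesgue g" "q < r" for g q r n
    by (rule negligible_large_average[OF that]) (auto simp: bad_def bounded_iff)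
  define N where "N = (\<Union>n. \<Union>(q,r)\<in>{(q,r). q \<in> \<rat> \<and> r \<in> \<rat> \<and> q < r}. bad f q r n \<union> bad (\<lambda>x. - f x) q r n)"
  have cQ: "countable {(q::real,r). q \<in> \<rat> \<and> r \<in> \<rat> \<and> q < r}"
    by (rule countable_subset[of _ "\<rat> \<times> \<rat>"]) (auto intro: countable_rat)
  have N: "negligible N" unfolding N_def using f cQ
    by (intro negligible_countable_Union countable_image) (auto intro!: bad negligible_Un)
  have key: "\<exists>d>0. \<forall>m h. 0 < h \<longrightarrow> h < d \<longrightarrow> x \<in> cball m h \<longrightarrow> (LINT y:cball m h|lebesgue. g y) \<le> r * (2 * h)"
    if g: "g = f \<or> g = (\<lambda>x. - f x)" and x: "x \<notin> N" and r: "g x < r" for g x r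
  proof -
    obtain q' where q': "q' \<in> \<rat>" "g x < q'" "q' < r" using Rats_dense_in_real[OF r] by blast
    obtain r' where r': "r' \<in> \<rat>" "q' < r'" "r' < r" using Rats_dense_in_real[OF q'(3)] by blast
    obtain n :: nat where n: "\<bar>x\<bar> \<le> real n" using real_arch_simple by blast
    have "x \<notin> bad g q' r' n" using x g q' r' unfolding N_def by auto
    then have "\<not> (\<forall>d>0. \<exists>m h. 0 < h \<and> h < d \<and> x \<in> cball m h \<and> (LINT y:cball m h|lebesgue. g y) > r' * (2 * h))"
      unfolding bad_def using n q' by auto
    then obtain d where d: "d > 0" "\<And>m h. 0 < h \<Longrightarrow> h < d \<Longrightarrow> x \<in> cball m h \<Longrightarrow> (LINT y:cball m h|lebesgue. g y) \<le> r' * (2 * h)"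
      by (meson not_less)
    have "(LINT y:cball m h|lebesgue. g y) \<le> r * (2 * h)" if "0 < h" "h < d" "x \<in> cball m h" for m h
      using d(2)[OF that] mult_right_mono[of r' r "2 * h"] r' that by linarith
    then show ?thesis using d(1) by blast
  qed
  have "(F has_real_derivative f x) (at x)" if x: "x \<notin> N" "a < x" "x < b"
    and F: "\<And>u v. a \<le> u \<Longrightarrow> u \<le> v \<Longrightarrow> v \<le> b \<Longrightarrow> F v - F u = (LINT y:{u..v}|lebesgue. f y)" for x F
  proof -
    have "\<exists>d>0. \<forall>y. y \<noteq> x \<longrightarrow> \<bar>y - x\<bar> < d \<longrightarrow> \<bar>(F y - F x) / (y - x) - f x\<bar> < e" if e: "e > 0" for e
    proof -
      obtain d1 where d1: "d1 > 0" "\<And>m h. 0 < h \<Longrightarrow> h < d1 \<Longrightarrow> x \<in> cball m h \<Longrightarrow> (LINT y:cball m h|lebesgue. f y) \<le> (f x + e/2) * (2 * h)"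
        using key[of f x "f x + e/2"] x e by auto
      obtain d2 where d2: "d2 > 0" "\<And>m h. 0 < h \<Longrightarrow> h < d2 \<Longrightarrow> x \<in> cball m h \<Longrightarrow> (LINT y:cball m h|lebesgue. - f y) \<le> (- f x + e/2) * (2 * h)"
        using key[of "\<lambda>x. - f x" x "- f x + e/2"] x e by auto
      define d where "d = Min {d1, d2, x - a, b - x}"
      have d: "d > 0" "d \<le> d1" "d \<le> d2" "d \<le> x - a" "d \<le> b - x" using d1 d2 x by (auto simp: d_def)
      have main: "\<bar>(F v - F u) / (v - u) - f x\<bar> < e" if uv: "u < v" "u \<le> x" "x \<le> v" "v - u < d" for u v
      proof -
        have c: "cball ((u+v)/2) ((v-u)/2) = {u..v}" unfolding cball_eq_atLeastAtMost by (simp add: field_simps)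
        have hh: "2 * ((v - u) / 2) = v - u" by simp
        have xc: "x \<in> cball ((u+v)/2) ((v-u)/2)" unfolding c using uv by auto
        have "F v - F u = (LINT y:{u..v}|lebesgue. f y)" using uv d by (intro F) auto
        moreover have "(LINT y:{u..v}|lebesgue. f y) \<le> (f x + e/2) * (v - u)"
          unfolding c[symmetric] using d1(2)[OF _ _ xc] uv d unfolding hh by simp
        moreover have "(LINT y:{u..v}|lebesgue. - f y) \<le> (- f x + e/2) * (v - u)"
          unfolding c[symmetric] using d2(2)[OF _ _ xc] uv d unfolding hh by simp
        moreover have "(LINT y:{u..v}|lebesgue. - f y) = - (LINT y:{u..v}|lebesgue. f y)"
          using f by (simp add: set_lebesgue_integral_def)
        ultimately have "F v - F u \<le> (f x + e/2) * (v - u)" "F v - F u \<ge> (f x - e/2) * (v - u)"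
          by (auto simp: algebra_simps)
        then have "(F v - F u) / (v - u) \<le> f x + e/2" "(F v - F u) / (v - u) \<ge> f x - e/2"
          using uv by (auto simp: field_simps)
        then show ?thesis using e by linarith
      qed
      show ?thesis
      proof (intro exI[of _ d] conjI allI impI d(1))
        fix y assume y: "y \<noteq> x" "\<bar>y - x\<bar> < d"
        show "\<bar>(F y - F x) / (y - x) - f x\<bar> < e"
        proof (cases "x < y")
          case True then show ?thesis using main[of x y] y by auto
        next
          case False
          then have "(F y - F x) / (y - x) = (F x - F y) / (x - y)" using y by (simp add: field_simps)
          then show ?thesis using main[of y x] y False by auto
        qed
      qed
    qed
    then show ?thesis unfolding has_field_derivative_iff LIM_eq real_norm_def by blast
  qed
  then have "{x. \<not> (\<forall>F. (\<forall>u v. a \<le> u \<longrightarrow> u \<le> v \<longrightarrow> v \<le> b \<longrightarrow> F v - F u = (LINT y:{u..v}|lebesgue. f y)) \<longrightarrow>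
     a < x \<longrightarrow> x < b \<longrightarrow> (F has_real_derivative f x) (at x))} \<subseteq> N" by blast
  moreover have "N \<in> null_sets lebesgue" using N negligible_iff_null_sets by blast
  ultimately show ?thesis by (intro AE_I'[of N]) auto
qed

section \<open>Positive variation and absolute continuity\<close>

text \<open>Members may touch but must have positive length. This makes families over two sets with
  finite intersection disjoint as sets of pairs, so that their sums add up. A is an arbitrary set
  because variations over finite unions of intervals are compared later.\<close>

definition interval_families :: "real set \<Rightarrow> (real \<times> real) set set" where
  "interval_families A = {D. finite D \<and> (\<forall>l r. (l, r) \<in> D \<longrightarrow> l < r \<and> {l..r} \<subseteq> A) \<and>
     (\<forall>l r l' r'. (l, r) \<in> D \<longrightarrow> (l', r') \<in> D \<longrightarrow> (l, r) \<noteq> (l', r') \<longrightarrow> r \<le> l' \<or> r' \<le> l)}"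

text \<open>The sums are signed, yet the supremum is the positive variation: intervals on which F
  decreases can be left out of the family.\<close>

definition positive_variation :: "(real \<Rightarrow> real) \<Rightarrow> real set \<Rightarrow> real" where
  "positive_variation F A = (SUP D\<in>interval_families A. \<Sum>(l, r)\<in>D. F r - F l)"

lemma interval_familiesI:
  assumes "finite D" "\<And>l r. (l, r) \<in> D \<Longrightarrow> l < r \<and> {l..r} \<subseteq> A"
    "\<And>l r l' r'. (l, r) \<in> D \<Longrightarrow> (l', r') \<in> D \<Longrightarrow> (l, r) \<noteq> (l', r') \<Longrightarrow> r \<le> l' \<or> r' \<le> l"
  shows "D \<in> interval_families A"
  using assms unfolding interval_families_def by blast

lemma interval_familiesD:
  assumes "D \<in> interval_families A"
  shows "finite D" "(l, r) \<in> D \<Longrightarrow> l < r" "(l, r) \<in> D \<Longrightarrow> {l..r} \<subseteq> A"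
    "(l, r) \<in> D \<Longrightarrow> (l', r') \<in> D \<Longrightarrow> (l, r) \<noteq> (l', r') \<Longrightarrow> r \<le> l' \<or> r' \<le> l"
  using assms unfolding interval_families_def by blast+

lemma interval_families_disjoint:
  assumes "D \<in> interval_families A"
  shows "disjoint_family_on (\<lambda>p. {fst p<..<snd p}) D"
  unfolding disjoint_family_on_def
proof (intro ballI impI)
  fix p q assume "p \<in> D" "q \<in> D" "p \<noteq> q"
  then have "snd p \<le> fst q \<or> snd q \<le> fst p"
    using interval_familiesD(4)[OF assms, of "fst p" "snd p" "fst q" "snd q"] by (simp add: prod_eq_iff)
  then show "{fst p<..<snd p} \<inter> {fst q<..<snd q} = {}" by auto
qed

lemma empty_interval_family [simp]: "{} \<in> interval_families A"
  by (simp add: interval_families_def)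

lemma interval_families_mono: "A \<subseteq> B \<Longrightarrow> D \<in> interval_families A \<Longrightarrow> D \<in> interval_families B"
  unfolding interval_families_def by blast

text \<open>Two overlapping members, one from each family, would share a whole open interval, which
  is infinite and lies in \<open>A \<inter> B\<close>.\<close>

lemma interval_families_Un:
  assumes D: "D \<in> interval_families A" and E: "E \<in> interval_families B" and fin: "finite (A \<inter> B)"
  shows "D \<union> E \<in> interval_families (A \<union> B)" "D \<inter> E = {}"
proof -
  have *: "r \<le> l' \<or> r' \<le> l" if "(l, r) \<in> D" "(l', r') \<in> E" for l r l' r'
  proof (rule ccontr)
    assume "\<not> (r \<le> l' \<or> r' \<le> l)"
    then have "max l l' < min r r'"
      using interval_familiesD(2)[OF D that(1)] interval_familiesD(2)[OF E that(2)] by auto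
    then have "infinite {max l l'<..<min r r'}" by (rule infinite_Ioo)
    moreover have "{max l l'<..<min r r'} \<subseteq> {l..r} \<inter> {l'..r'}" by auto
    ultimately show False
      using interval_familiesD(3)[OF D that(1)] interval_familiesD(3)[OF E that(2)] fin
      by (meson finite_subset inf_mono)
  qed
  show "D \<inter> E = {}"
  proof (rule ccontr)
    assume "D \<inter> E \<noteq> {}"
    then obtain l r where lr: "(l, r) \<in> D" "(l, r) \<in> E" by auto
    then show False using *[of l r l r] interval_familiesD(2)[OF D lr(1)] by auto
  qed
  show "D \<union> E \<in> interval_families (A \<union> B)"
  proof (rule interval_familiesI)
    show "finite (D \<union> E)" using interval_familiesD(1) D E by blast
    show "l < r \<and> {l..r} \<subseteq> A \<union> B" if "(l, r) \<in> D \<union> E" for l r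
      using that interval_familiesD(2,3)[OF D] interval_familiesD(2,3)[OF E] by (meson UnE le_supI1 le_supI2)
    show "r \<le> l' \<or> r' \<le> l" if "(l, r) \<in> D \<union> E" "(l', r') \<in> D \<union> E" "(l, r) \<noteq> (l', r')" for l r l' r'
      using that *[of l r l' r'] *[of l' r' l r] interval_familiesD(4)[OF D, of l r l' r']
        interval_familiesD(4)[OF E, of l r l' r'] by (elim UnE) auto
  qed
qed

lemma interval_families_length:
  assumes D: "D \<in> interval_families A" and A: "A \<in> lmeasurable"
  shows "(\<Sum>(l, r)\<in>D. r - l) \<le> measure lebesgue A"
proof -
  have sub: "{fst p<..<snd p} \<subseteq> A" and le: "fst p \<le> snd p" if "p \<in> D" for p
    using interval_familiesD(2,3)[OF D, of "fst p" "snd p"] that by (auto intro!: subset_trans[OF greaterThanLessThan_subseteq_atLeastAtMost_iff[THEN iffD2]])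
  have "(\<Sum>(l, r)\<in>D. r - l) = (\<Sum>p\<in>D. measure lebesgue {fst p<..<snd p})"
    using le by (intro sum.cong) auto
  also have "\<dots> = measure lebesgue (\<Union>p\<in>D. {fst p<..<snd p})"
    using interval_familiesD(1)[OF D] interval_families_disjoint[OF D] le
    by (intro measure_finite_Union[symmetric]) auto
  also have "\<dots> \<le> measure lebesgue A"
    using A sub interval_familiesD(1)[OF D] by (intro measure_mono_fmeasurable sets.finite_UN) auto
  finally show ?thesis .
qed

text \<open>Families are sets of pairs instead of indexed sequences, so that they can be split and
  merged by set operations.\<close>

definition abs_cont :: "real \<Rightarrow> real \<Rightarrow> (real \<Rightarrow> real) \<Rightarrow> bool" where
  "abs_cont u v F \<longleftrightarrow> (\<forall>e>0. \<exists>d>0. \<forall>D\<in>interval_families {u..v}.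
     (\<Sum>(l, r)\<in>D. r - l) < d \<longrightarrow> (\<Sum>(l, r)\<in>D. \<bar>F r - F l\<bar>) < e)"

lemma abs_contD:
  assumes "abs_cont u v F" "e > 0"
  shows "\<exists>d>0. \<forall>D\<in>interval_families {u..v}. (\<Sum>(l, r)\<in>D. r - l) < d \<longrightarrow> (\<Sum>(l, r)\<in>D. \<bar>F r - F l\<bar>) < e"
  using assms unfolding abs_cont_def by blast

lemma absolutely_continuous_fun_on_imp_abs_cont:
  assumes "absolutely_continuous_fun_on u v F"
  shows "abs_cont u v F"
  unfolding abs_cont_def
proof (intro allI impI)
  fix e :: real assume e: "e > 0"
  obtain d where d: "d > 0" and *: "\<forall>(n::nat) l r. (\<forall>i<n. u \<le> l i \<and> l i \<le> r i \<and> r i \<le> v) \<longrightarrow>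
      disjoint_family_on (\<lambda>i. {l i<..<r i}) {..<n} \<longrightarrow>
      (\<Sum>i<n. r i - l i) < d \<longrightarrow> (\<Sum>i<n. \<bar>F (r i) - F (l i)\<bar>) < e"
    using assms[unfolded absolutely_continuous_fun_on_def, THEN spec, THEN mp, OF e] by (elim exE conjE)
  have "(\<Sum>(l, r)\<in>D. \<bar>F r - F l\<bar>) < e" if D: "D \<in> interval_families {u..v}" and s: "(\<Sum>(l, r)\<in>D. r - l) < d" for D
  proof -
    obtain h where h: "bij_betw h {..<card D} D"
      using ex_bij_betw_nat_finite[OF interval_familiesD(1)[OF D]] by (auto simp: atLeast0LessThan)
    have hD: "(fst (h i), snd (h i)) \<in> D" if "i < card D" for i
      using h that by (auto simp: bij_betw_def)
    have "(\<Sum>i<card D. \<bar>F (snd (h i)) - F (fst (h i))\<bar>) < e"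
    proof (rule *[THEN spec, THEN spec, THEN spec, THEN mp, THEN mp, THEN mp])
      show "\<forall>i<card D. u \<le> fst (h i) \<and> fst (h i) \<le> snd (h i) \<and> snd (h i) \<le> v"
        using interval_familiesD(2,3)[OF D hD] by (auto simp: less_imp_le)
      show "disjoint_family_on (\<lambda>i. {fst (h i)<..<snd (h i)}) {..<card D}"
        unfolding disjoint_family_on_def
      proof (intro ballI impI)
        fix i j assume ij: "i \<in> {..<card D}" "j \<in> {..<card D}" "i \<noteq> j"
        then have "h i \<noteq> h j" "h i \<in> D" "h j \<in> D" using h by (auto simp: bij_betw_def inj_on_def)
        then show "{fst (h i)<..<snd (h i)} \<inter> {fst (h j)<..<snd (h j)} = {}"
          using interval_families_disjoint[OF D] unfolding disjoint_family_on_def by blast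
      qed
      show "(\<Sum>i<card D. snd (h i) - fst (h i)) < d"
        using s sum.reindex_bij_betw[OF h, of "\<lambda>(l, r). r - l"] by (simp add: case_prod_beta)
    qed
    then show ?thesis
      using sum.reindex_bij_betw[OF h, of "\<lambda>(l, r). \<bar>F r - F l\<bar>"] by (simp add: case_prod_beta)
  qed
  then show "\<exists>d>0. \<forall>D\<in>interval_families {u..v}. (\<Sum>(l, r)\<in>D. r - l) < d \<longrightarrow> (\<Sum>(l, r)\<in>D. \<bar>F r - F l\<bar>) < e"
    using d by blast
qed

lemma abs_cont_imp_continuous:
  assumes "abs_cont u v F"
  shows "continuous_on {u..v} F"
  unfolding continuous_on_iff
proof (intro ballI allI impI)
  fix x e :: real assume x: "x \<in> {u..v}" and e: "e > 0"
  obtain d where d: "d > 0"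
    "\<And>D. D \<in> interval_families {u..v} \<Longrightarrow> (\<Sum>(l, r)\<in>D. r - l) < d \<Longrightarrow> (\<Sum>(l, r)\<in>D. \<bar>F r - F l\<bar>) < e"
    using abs_contD[OF assms e] by blast
  have "dist (F y) (F x) < e" if y: "y \<in> {u..v}" "dist y x < d" for y
  proof (cases "y = x")
    case False
    have "{(min x y, max x y)} \<in> interval_families {u..v}"
      using False x y by (auto simp: interval_families_def)
    with d(2) have "max x y - min x y < d \<longrightarrow> \<bar>F (max x y) - F (min x y)\<bar> < e" by fastforce
    then show ?thesis using y by (cases x y rule: linorder_cases) (auto simp: dist_real_def)
  qed (use e in simp)
  then show "\<exists>d>0. \<forall>y\<in>{u..v}. dist y x < d \<longrightarrow> dist (F y) (F x) < e" using d(1) by blast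
qed

text \<open>Bisection: on a piece shorter than d absolute continuity bounds all sums by 1, and
  joining two adjacent pieces adds at most the one interval that straddles the common point, whose
  increment is at most twice the bound of |F|.\<close>

lemma bdd_above_positive_variation:
  assumes ac: "abs_cont u v F" and A: "A \<subseteq> {u..v}"
  shows "bdd_above ((\<lambda>D. \<Sum>(l, r)\<in>D. F r - F l) ` interval_families A)"
proof -
  obtain d where d: "d > 0"
    "\<And>D. D \<in> interval_families {u..v} \<Longrightarrow> (\<Sum>(l, r)\<in>D. r - l) < d \<Longrightarrow> (\<Sum>(l, r)\<in>D. \<bar>F r - F l\<bar>) < 1"
    using abs_contD[OF ac, of 1] zero_less_one by blast
  have "compact (F ` {u..v})"
    using abs_cont_imp_continuous[OF ac] by (intro compact_continuous_image) auto
  then obtain C where C: "\<And>x. x \<in> {u..v} \<Longrightarrow> \<bar>F x\<bar> \<le> C"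
    using compact_imp_bounded bounded_iff by (metis imageI real_norm_def)
  \<comment> \<open>The local step of \<open>Bolzano\<close> speaks of all short intervals around a
    point, including those that leave [u,v]; hence the intersection.\<close>
  define P where "P s t \<longleftrightarrow> (\<exists>K. \<forall>D\<in>interval_families ({s..t} \<inter> {u..v}). (\<Sum>(l, r)\<in>D. F r - F l) \<le> K)" for s t
  have "P u v" if "u \<le> v" using that
  proof (induction rule: Bolzano)
    case (trans s t w)
    obtain K1 where K1: "\<And>D. D\<in>interval_families ({s..t} \<inter> {u..v}) \<Longrightarrow> (\<Sum>(l, r)\<in>D. F r - F l) \<le> K1"
      using trans by (auto simp: P_def)
    obtain K2 where K2: "\<And>D. D\<in>interval_families ({t..w} \<inter> {u..v}) \<Longrightarrow> (\<Sum>(l, r)\<in>D. F r - F l) \<le> K2"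
      using trans by (auto simp: P_def)
    have "(\<Sum>(l, r)\<in>D. F r - F l) \<le> K1 + K2 + (2 * \<bar>C\<bar>)" if D: "D\<in>interval_families ({s..w} \<inter> {u..v})" for D
    proof -
      note fin = interval_familiesD(1)[OF D] and dis = interval_familiesD(4)[OF D]
      have lr: "l < r" "s \<le> l" "r \<le> w" "u \<le> l" "r \<le> v" if "(l, r) \<in> D" for l r
        using interval_familiesD(2,3)[OF D that] by auto
      \<comment> \<open>\<open>?D3\<close> collects the intervals with t in their interior; by
        disjointness it has at most one member.\<close>
      let ?D1 = "{p\<in>D. snd p \<le> t}" and ?D2 = "{p\<in>D. t \<le> fst p}" and ?D3 = "{p\<in>D. fst p < t \<and> t < snd p}"
      have 1: "(\<Sum>(l, r)\<in>?D1. F r - F l) \<le> K1"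
      proof (intro K1 interval_familiesI)
        fix l r l' r' assume "(l, r) \<in> ?D1" "(l', r') \<in> ?D1" "(l, r) \<noteq> (l', r')"
        then show "r \<le> l' \<or> r' \<le> l" using dis[of l r l' r'] by simp
      qed (use fin lr in \<open>auto intro: order_trans\<close>)
      have 2: "(\<Sum>(l, r)\<in>?D2. F r - F l) \<le> K2"
      proof (intro K2 interval_familiesI)
        fix l r l' r' assume "(l, r) \<in> ?D2" "(l', r') \<in> ?D2" "(l, r) \<noteq> (l', r')"
        then show "r \<le> l' \<or> r' \<le> l" using dis[of l r l' r'] by simp
      qed (use fin lr in \<open>auto intro: order_trans\<close>)
      have "card ?D3 \<le> 1"
      proof -
        have "p = q" if "p \<in> ?D3" "q \<in> ?D3" for p q
          using dis[of "fst p" "snd p" "fst q" "snd q"] that by (force simp: prod_eq_iff)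
        then show ?thesis using fin by (intro card_le_Suc0_iff_eq[THEN iffD2, unfolded One_nat_def[symmetric]]) auto
      qed
      then have "real (card ?D3) * (2 * \<bar>C\<bar>) \<le> 1 * (2 * \<bar>C\<bar>)" by (intro mult_right_mono) auto
      moreover have "(\<Sum>(l, r)\<in>?D3. F r - F l) \<le> real (card ?D3) * (2 * \<bar>C\<bar>)"
      proof (rule sum_bounded_above, clarify)
        fix l r assume "(l, r) \<in> D"
        from lr[OF this] have "\<bar>F l\<bar> \<le> C" "\<bar>F r\<bar> \<le> C" by (auto intro!: C)
        then show "F r - F l \<le> 2 * \<bar>C\<bar>" by linarith
      qed
      moreover have "(\<Sum>(l, r)\<in>D. F r - F l) = (\<Sum>(l, r)\<in>?D1 \<union> ?D2. F r - F l) + (\<Sum>(l, r)\<in>?D3. F r - F l)"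
        using fin by (subst sum.union_disjoint[symmetric]) (auto intro!: sum.cong)
      moreover have "(\<Sum>(l, r)\<in>?D1 \<union> ?D2. F r - F l) = (\<Sum>(l, r)\<in>?D1. F r - F l) + (\<Sum>(l, r)\<in>?D2. F r - F l)"
        using fin by (intro sum.union_disjoint) (auto dest!: lr(1))
      ultimately show ?thesis using 1 2 by linarith
    qed
    then show ?case by (auto simp: P_def)
  next
    case (local x)
    have "P s t" if st: "s \<le> x" "x \<le> t" "t - s < d" for s t
      unfolding P_def
    proof (intro exI ballI)
      fix D assume D: "D\<in>interval_families ({s..t} \<inter> {u..v})"
      have "(\<Sum>(l, r)\<in>D. r - l) \<le> measure lebesgue {s..t}"
        by (rule interval_families_length[OF interval_families_mono[OF _ D]]) auto
      also have "\<dots> < d" using st by simp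
      finally have "(\<Sum>(l, r)\<in>D. \<bar>F r - F l\<bar>) < 1" by (intro d(2) interval_families_mono[OF _ D]) auto
      moreover have "(\<Sum>(l, r)\<in>D. F r - F l) \<le> (\<Sum>(l, r)\<in>D. \<bar>F r - F l\<bar>)" by (intro sum_mono) auto
      ultimately show "(\<Sum>(l, r)\<in>D. F r - F l) \<le> 1" by linarith
    qed
    then show ?case using d(1) by blast
  qed
  then show ?thesis
  proof (cases "u \<le> v")
    case True
    then obtain K where "\<And>D. D\<in>interval_families {u..v} \<Longrightarrow> (\<Sum>(l, r)\<in>D. F r - F l) \<le> K"
      using \<open>u \<le> v \<Longrightarrow> P u v\<close> by (auto simp: P_def)
    then show ?thesis using A by (intro bdd_aboveI2[where M=K]) (auto intro: interval_families_mono)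
  next
    case False
    then have "D = {}" if "D \<in> interval_families A" for D
      using A interval_familiesD(2,3)[OF that] by (fastforce simp: subset_iff)
    then have "interval_families A = {{}}" by auto
    then show ?thesis by simp
  qed
qed

context
  fixes u v :: real and F :: "real \<Rightarrow> real"
  assumes ac: "abs_cont u v F"
begin

lemma positive_variation_upper:
  "A \<subseteq> {u..v} \<Longrightarrow> D \<in> interval_families A \<Longrightarrow> (\<Sum>(l, r)\<in>D. F r - F l) \<le> positive_variation F A"
  unfolding positive_variation_def by (rule cSUP_upper[OF _ bdd_above_positive_variation[OF ac]])

lemma positive_variation_least:
  "(\<And>D. D \<in> interval_families A \<Longrightarrow> (\<Sum>(l, r)\<in>D. F r - F l) \<le> K) \<Longrightarrow> positive_variation F A \<le> K"
  unfolding positive_variation_def by (rule cSUP_least) (auto intro: empty_interval_family)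

lemma positive_variation_superadditive:
  assumes A: "A \<subseteq> {u..v}" and B: "B \<subseteq> {u..v}" and fin: "finite (A \<inter> B)"
  shows "positive_variation F A + positive_variation F B \<le> positive_variation F (A \<union> B)"
proof -
  have "positive_variation F A \<le> positive_variation F (A \<union> B) - positive_variation F B"
  proof (rule positive_variation_least)
    fix D assume D: "D \<in> interval_families A"
    have "positive_variation F B \<le> positive_variation F (A \<union> B) - (\<Sum>(l, r)\<in>D. F r - F l)"
    proof (rule positive_variation_least)
      fix E assume E: "E \<in> interval_families B"
      have "(\<Sum>(l, r)\<in>D. F r - F l) + (\<Sum>(l, r)\<in>E. F r - F l) = (\<Sum>(l, r)\<in>D \<union> E. F r - F l)"
        using D E interval_families_Un(2)[OF D E fin]
        by (intro sum.union_disjoint[symmetric]) (auto simp: interval_families_def)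
      also have "\<dots> \<le> positive_variation F (A \<union> B)"
        using A B by (intro positive_variation_upper interval_families_Un[OF D E fin]) auto
      finally show "(\<Sum>(l, r)\<in>E. F r - F l) \<le> positive_variation F (A \<union> B) - (\<Sum>(l, r)\<in>D. F r - F l)" by simp
    qed
    then show "(\<Sum>(l, r)\<in>D. F r - F l) \<le> positive_variation F (A \<union> B) - positive_variation F B" by simp
  qed
  then show ?thesis by simp
qed

text \<open>For the inequality that superadditivity does not give, the interval straddling t, if
  there is one, is cut at t; its increment is the sum of those of its two halves. Additivity makes
  differences of the function t \<mapsto> variation over [u,t] again variations.\<close>

lemma positive_variation_split:
  assumes s: "u \<le> s" "s \<le> t" "t \<le> w" "w \<le> v"
  shows "positive_variation F {s..w} = positive_variation F {s..t} + positive_variation F {t..w}"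
proof (rule antisym)
  show "positive_variation F {s..t} + positive_variation F {t..w} \<le> positive_variation F {s..w}"
    using positive_variation_superadditive[of "{s..t}" "{t..w}"] s by (simp add: ivl_disj_un_two_touch)
  show "positive_variation F {s..w} \<le> positive_variation F {s..t} + positive_variation F {t..w}"
  proof (rule positive_variation_least)
    fix D assume D: "D \<in> interval_families {s..w}"
    note fin = interval_familiesD(1)[OF D] and dis = interval_familiesD(4)[OF D]
    have lr: "l < r" "s \<le> l" "r \<le> w" if "(l, r) \<in> D" for l r
      using interval_familiesD(2,3)[OF D that] by auto
    let ?D1 = "{p\<in>D. snd p \<le> t}" and ?D2 = "{p\<in>D. t \<le> fst p}"
    have D1: "?D1 \<in> interval_families {s..t}"
    proof (rule interval_familiesI)
      fix l r l' r' assume "(l, r) \<in> ?D1" "(l', r') \<in> ?D1" "(l, r) \<noteq> (l', r')"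
      then show "r \<le> l' \<or> r' \<le> l" using dis[of l r l' r'] by simp
    qed (use fin lr in \<open>auto intro: order_trans\<close>)
    have D2: "?D2 \<in> interval_families {t..w}"
    proof (rule interval_familiesI)
      fix l r l' r' assume "(l, r) \<in> ?D2" "(l', r') \<in> ?D2" "(l, r) \<noteq> (l', r')"
      then show "r \<le> l' \<or> r' \<le> l" using dis[of l r l' r'] by simp
    qed (use fin lr in \<open>auto intro: order_trans\<close>)
    have S12: "(\<Sum>(l, r)\<in>?D1 \<union> ?D2. F r - F l) = (\<Sum>(l, r)\<in>?D1. F r - F l) + (\<Sum>(l, r)\<in>?D2. F r - F l)"
      using fin by (intro sum.union_disjoint) (auto dest!: lr(1))
    show "(\<Sum>(l, r)\<in>D. F r - F l) \<le> positive_variation F {s..t} + positive_variation F {t..w}"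
    proof (cases "\<exists>l r. (l, r) \<in> D \<and> l < t \<and> t < r")
      case False
      then have "D = ?D1 \<union> ?D2" by (auto simp: not_less) (metis not_less)
      then show ?thesis using S12 positive_variation_upper[OF _ D1] positive_variation_upper[OF _ D2] s by auto
    next
      case True
      then obtain l0 r0 where lr0: "(l0, r0) \<in> D" "l0 < t" "t < r0" by blast
      have dj: "r \<le> l0 \<or> r0 \<le> l" if "(l, r) \<in> D" "(l, r) \<noteq> (l0, r0)" for l r
        using dis[OF that(1) lr0(1) that(2)] .
      have dj': "r \<le> l0 \<or> r0 \<le> l" if "(l, r) \<in> ?D1 \<or> (l, r) \<in> ?D2" for l r
        using dj[of l r] that lr0 by auto
      have "D = insert (l0, r0) (?D1 \<union> ?D2)" using dj lr0 by force
      moreover have "(l0, r0) \<notin> ?D1 \<union> ?D2" using lr0 by auto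
      ultimately have SD: "(\<Sum>(l, r)\<in>D. F r - F l) = (F r0 - F l0) + (\<Sum>(l, r)\<in>?D1 \<union> ?D2. F r - F l)"
        using fin by (metis (mono_tags, lifting) case_prod_conv finite_insert sum.insert)
      have E1: "insert (l0, t) ?D1 \<in> interval_families {s..t}"
      proof (rule interval_familiesI)
        fix l r l' r' assume *: "(l, r) \<in> insert (l0, t) ?D1" "(l', r') \<in> insert (l0, t) ?D1" "(l, r) \<noteq> (l', r')"
        show "r \<le> l' \<or> r' \<le> l"
          using * dis[of l r l' r'] dj'[of l r] dj'[of l' r'] lr[of l r] lr[of l' r'] lr0 by auto
      qed (use lr lr[OF lr0(1)] lr0 s fin in auto)
      have E2: "insert (t, r0) ?D2 \<in> interval_families {t..w}"
      proof (rule interval_familiesI)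
        fix l r l' r' assume *: "(l, r) \<in> insert (t, r0) ?D2" "(l', r') \<in> insert (t, r0) ?D2" "(l, r) \<noteq> (l', r')"
        show "r \<le> l' \<or> r' \<le> l"
          using * dis[of l r l' r'] dj'[of l r] dj'[of l' r'] lr[of l r] lr[of l' r'] lr0 by auto
      qed (use lr lr[OF lr0(1)] lr0 s fin in auto)
      have "(l0, t) \<notin> ?D1" "(t, r0) \<notin> ?D2"
        using dj'[of l0 t] dj'[of t r0] lr0 by auto
      then have "(\<Sum>(l, r)\<in>insert (l0, t) ?D1. F r - F l) = F t - F l0 + (\<Sum>(l, r)\<in>?D1. F r - F l)"
        "(\<Sum>(l, r)\<in>insert (t, r0) ?D2. F r - F l) = F r0 - F t + (\<Sum>(l, r)\<in>?D2. F r - F l)"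
        using fin by (auto intro!: sum.insert[THEN trans])
      then show ?thesis using S12 SD positive_variation_upper[OF _ E1] positive_variation_upper[OF _ E2] s by auto
    qed
  qed
qed

lemma positive_variation_small:
  assumes e: "e > 0"
  shows "\<exists>d>0. \<forall>A. A \<subseteq> {u..v} \<longrightarrow> A \<in> lmeasurable \<longrightarrow> measure lebesgue A < d \<longrightarrow> positive_variation F A \<le> e"
proof -
  obtain d where d: "d > 0"
    "\<And>D. D \<in> interval_families {u..v} \<Longrightarrow> (\<Sum>(l, r)\<in>D. r - l) < d \<Longrightarrow> (\<Sum>(l, r)\<in>D. \<bar>F r - F l\<bar>) < e"
    using abs_contD[OF ac e] by blast
  have "positive_variation F A \<le> e" if A: "A \<subseteq> {u..v}" "A \<in> lmeasurable" "measure lebesgue A < d" for A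
  proof (rule positive_variation_least)
    fix D assume D: "D \<in> interval_families A"
    have "(\<Sum>(l, r)\<in>D. F r - F l) \<le> (\<Sum>(l, r)\<in>D. \<bar>F r - F l\<bar>)" by (intro sum_mono) auto
    also have "\<dots> < e" using interval_families_length[OF D A(2)] A(3) by (intro d(2) interval_families_mono[OF A(1) D]) auto
    finally show "(\<Sum>(l, r)\<in>D. F r - F l) \<le> e" by simp
  qed
  then show ?thesis using d(1) by blast
qed

end

section \<open>Closure properties of absolutely continuous functions\<close>

text \<open>Sums, differences, products and reciprocals all have increments dominated by those of
  one or two given functions, so this comparison serves for each of them.\<close>

lemma abs_cont_compare:
  assumes F1: "abs_cont u v F1" and F2: "abs_cont u v F2" and K: "K \<ge> 0"
    and le: "\<And>l r. u \<le> l \<Longrightarrow> l \<le> r \<Longrightarrow> r \<le> v \<Longrightarrow> \<bar>G r - G l\<bar> \<le> K * (\<bar>F1 r - F1 l\<bar> + \<bar>F2 r - F2 l\<bar>)"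
  shows "abs_cont u v G"
  unfolding abs_cont_def
proof (intro allI impI)
  fix e :: real assume e: "e > 0"
  \<comment> \<open>K + 1 in place of K keeps the quotient meaningful for K = 0.\<close>
  define e' where "e' = e / (2 * (K + 1))"
  have e': "e' > 0" using e K by (simp add: e'_def)
  obtain d1 where d1: "d1 > 0"
    "\<forall>D\<in>interval_families {u..v}. (\<Sum>(l, r)\<in>D. r - l) < d1 \<longrightarrow> (\<Sum>(l, r)\<in>D. \<bar>F1 r - F1 l\<bar>) < e'"
    using abs_contD[OF F1 e'] by blast
  obtain d2 where d2: "d2 > 0"
    "\<forall>D\<in>interval_families {u..v}. (\<Sum>(l, r)\<in>D. r - l) < d2 \<longrightarrow> (\<Sum>(l, r)\<in>D. \<bar>F2 r - F2 l\<bar>) < e'"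
    using abs_contD[OF F2 e'] by blast
  show "\<exists>d>0. \<forall>D\<in>interval_families {u..v}. (\<Sum>(l, r)\<in>D. r - l) < d \<longrightarrow> (\<Sum>(l, r)\<in>D. \<bar>G r - G l\<bar>) < e"
  proof (intro exI[of _ "min d1 d2"] conjI ballI impI)
    fix D assume D: "D \<in> interval_families {u..v}" and s: "(\<Sum>(l, r)\<in>D. r - l) < min d1 d2"
    have "(\<Sum>(l, r)\<in>D. \<bar>G r - G l\<bar>) \<le> (\<Sum>(l, r)\<in>D. K * (\<bar>F1 r - F1 l\<bar> + \<bar>F2 r - F2 l\<bar>))"
    proof (rule sum_mono, clarify)
      fix l r assume "(l, r) \<in> D"
      then show "\<bar>G r - G l\<bar> \<le> K * (\<bar>F1 r - F1 l\<bar> + \<bar>F2 r - F2 l\<bar>)"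
        using interval_familiesD(2,3)[OF D, of l r] by (intro le) auto
    qed
    also have "\<dots> = K * ((\<Sum>(l, r)\<in>D. \<bar>F1 r - F1 l\<bar>) + (\<Sum>(l, r)\<in>D. \<bar>F2 r - F2 l\<bar>))"
      by (simp add: case_prod_beta sum_distrib_left sum.distrib distrib_left)
    also have "\<dots> \<le> K * (e' + e')" using d1(2) d2(2) D s K by (intro mult_left_mono add_mono) (auto simp: less_imp_le)
    also have "\<dots> < (K + 1) * (e' + e')" using e' by (intro mult_strict_right_mono) auto
    also have "\<dots> = e' * (2 * (K + 1))" by (simp add: algebra_simps)
    also have "\<dots> = e" using K by (simp add: e'_def)
    finally show "(\<Sum>(l, r)\<in>D. \<bar>G r - G l\<bar>) < e" .
  qed (use d1 d2 in auto)
qed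

lemma abs_cont_const: "abs_cont u v (\<lambda>_. c)"
  by (auto simp: abs_cont_def intro: exI[of _ 1])

lemma abs_cont_add: "abs_cont u v F \<Longrightarrow> abs_cont u v G \<Longrightarrow> abs_cont u v (\<lambda>x. F x + G x)"
  by (rule abs_cont_compare[of _ _ F G 1]) auto

lemma abs_cont_diff: "abs_cont u v F \<Longrightarrow> abs_cont u v G \<Longrightarrow> abs_cont u v (\<lambda>x. F x - G x)"
  by (rule abs_cont_compare[of _ _ F G 1]) auto

lemma abs_cont_bounded:
  assumes "abs_cont u v F"
  obtains C where "C > 0" "\<And>x. x \<in> {u..v} \<Longrightarrow> \<bar>F x\<bar> \<le> C"
proof -
  have "compact (F ` {u..v})"
    using abs_cont_imp_continuous[OF assms] by (intro compact_continuous_image) auto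
  then show ?thesis using that unfolding compact_eq_bounded_closed bounded_pos by auto
qed

lemma abs_cont_mult:
  assumes F: "abs_cont u v F" and G: "abs_cont u v G"
  shows "abs_cont u v (\<lambda>x. F x * G x)"
proof -
  obtain A where A: "A > 0" "\<And>x. x \<in> {u..v} \<Longrightarrow> \<bar>F x\<bar> \<le> A" using abs_cont_bounded[OF F] by blast
  obtain B where B: "B > 0" "\<And>x. x \<in> {u..v} \<Longrightarrow> \<bar>G x\<bar> \<le> B" using abs_cont_bounded[OF G] by blast
  show ?thesis
  proof (rule abs_cont_compare[OF F G])
    fix l r assume lr: "u \<le> l" "l \<le> r" "r \<le> v"
    have "F r * G r - F l * G l = (F r - F l) * G r + F l * (G r - G l)" by (simp add: algebra_simps)
    then have "\<bar>F r * G r - F l * G l\<bar> \<le> \<bar>F r - F l\<bar> * \<bar>G r\<bar> + \<bar>F l\<bar> * \<bar>G r - G l\<bar>"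
      by (metis abs_mult abs_triangle_ineq)
    also have "\<dots> \<le> \<bar>F r - F l\<bar> * (A + B) + (A + B) * \<bar>G r - G l\<bar>"
      using A(2)[of l] B(2)[of r] A(1) B(1) lr by (intro add_mono mult_mono) auto
    finally show "\<bar>F r * G r - F l * G l\<bar> \<le> (A + B) * (\<bar>F r - F l\<bar> + \<bar>G r - G l\<bar>)"
      by (simp add: algebra_simps)
  qed (use A B in simp)
qed

lemma abs_cont_inverse:
  assumes F: "abs_cont u v F" and nz: "\<And>x. x \<in> {u..v} \<Longrightarrow> F x \<noteq> 0"
  shows "abs_cont u v (\<lambda>x. 1 / F x)"
proof -
  have "compact ((\<lambda>x. 1 / F x) ` {u..v})"
    using abs_cont_imp_continuous[OF F] nz by (intro compact_continuous_image continuous_intros) auto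
  then obtain A where A: "A > 0" "\<And>x. x \<in> {u..v} \<Longrightarrow> \<bar>1 / F x\<bar> \<le> A"
    unfolding compact_eq_bounded_closed bounded_pos by auto
  show ?thesis
  proof (rule abs_cont_compare[OF F F])
    fix l r assume lr: "u \<le> l" "l \<le> r" "r \<le> v"
    have "1 / F r - 1 / F l = - ((1 / F r) * (1 / F l) * (F r - F l))"
      using nz[of l] nz[of r] lr by (simp add: field_simps)
    then have "\<bar>1 / F r - 1 / F l\<bar> = \<bar>1 / F r\<bar> * \<bar>1 / F l\<bar> * \<bar>F r - F l\<bar>"
      by (simp only: abs_minus_cancel abs_mult)
    also have "\<dots> \<le> A * A * \<bar>F r - F l\<bar>"
      using A(2)[of l] A(2)[of r] A(1) lr by (intro mult_right_mono mult_mono) auto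
    also have "\<dots> \<le> A * A * (\<bar>F r - F l\<bar> + \<bar>F r - F l\<bar>)" using A(1) by (intro mult_left_mono) auto
    finally show "\<bar>1 / F r - 1 / F l\<bar> \<le> A * A * (\<bar>F r - F l\<bar> + \<bar>F r - F l\<bar>)" .
  qed (use A in simp)
qed

section \<open>Densities and the fundamental theorem of calculus\<close>

lemma finite_measure_real_density:
  assumes M: "sigma_finite_measure M" and N: "finite_measure N" "sets N = sets M" and abs: "absolutely_continuous M N"
  shows "\<exists>D. integrable M D \<and> (\<forall>x. 0 \<le> D x) \<and> density M (\<lambda>x. ennreal (D x)) = N"
proof -
  define D where "D x = enn2real (RN_deriv M N x)" for x
  have mD: "D \<in> borel_measurable M" unfolding D_def by measurable
  have "AE x in M. RN_deriv M N x \<noteq> \<infinity>"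
    using sigma_finite_measure.RN_deriv_finite[OF M _ abs N(2)] N(1) finite_measure.axioms(1) by blast
  then have eq: "AE x in M. ennreal (D x) = RN_deriv M N x"
    by eventually_elim (simp add: D_def less_top)
  have dens: "density M (\<lambda>x. ennreal (D x)) = N"
  proof -
    have "density M (\<lambda>x. ennreal (D x)) = density M (RN_deriv M N)"
      using mD eq by (intro density_cong) auto
    then show ?thesis using sigma_finite_measure.density_RN_deriv[OF M abs N(2)] by simp
  qed
  have "integrable M D"
  proof (rule integrableI_nn_integral_finite[where x="measure N (space N)"])
    have "(\<integral>\<^sup>+ x. ennreal (D x) \<partial>M) = emeasure (density M (\<lambda>x. ennreal (D x))) (space M)"
      using mD by (subst emeasure_density) (auto intro!: nn_integral_cong)
    also have "\<dots> = ennreal (measure N (space N))"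
      unfolding dens sets_eq_imp_space_eq[OF N(2), symmetric] by (simp add: finite_measure.emeasure_eq_measure[OF N(1)])
    finally show "(\<integral>\<^sup>+ x. ennreal (D x) \<partial>M) = ennreal (measure N (space N))" .
  qed (use mD in \<open>auto simp: D_def\<close>)
  moreover have "\<forall>x. 0 \<le> D x" by (simp add: D_def)
  ultimately show ?thesis using dens by blast
qed

text \<open>A density exists once the Stieltjes measure of G vanishes on Lebesgue null sets. By
  inner regularity only compact null sets need to be tested; compactness gives a finite cover, and
  absolute continuity speaks of finite families.\<close>

lemma abs_cont_mono_has_density:
  fixes G :: "real \<Rightarrow> real"
  assumes uv: "u \<le> v" and ac: "abs_cont u v G"
    and mono: "\<And>s t. u \<le> s \<Longrightarrow> s \<le> t \<Longrightarrow> t \<le> v \<Longrightarrow> G s \<le> G t"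
  shows "\<exists>g. integrable lebesgue g \<and> (\<forall>s t. u \<le> s \<longrightarrow> s \<le> t \<longrightarrow> t \<le> v \<longrightarrow> G t - G s = (LINT y:{s..t}|lebesgue. g y))"
proof -
  \<comment> \<open>Clamping to [u,v] extends G to the whole line by constants, so that its
    Stieltjes measure is finite.\<close>
  define c where "c x = max u (min v x)" for x
  define G' where "G' x = G (c x)" for x
  have c: "u \<le> c x" "c x \<le> v" for x using uv by (auto simp: c_def)
  have cmono: "x \<le> y \<Longrightarrow> c x \<le> c y" for x y by (auto simp: c_def)
  have ceq: "u \<le> x \<Longrightarrow> x \<le> v \<Longrightarrow> c x = x" for x by (auto simp: c_def)
  have mono': "x \<le> y \<Longrightarrow> G' x \<le> G' y" for x y
    unfolding G'_def by (intro mono c cmono)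
  have cont: "continuous_on UNIV G'"
  proof -
    have "continuous_on UNIV c" unfolding c_def by (intro continuous_intros)
    then show ?thesis unfolding G'_def
      by (rule continuous_on_compose2[OF abs_cont_imp_continuous[OF ac]]) (use c in auto)
  qed
  have contr: "continuous (at_right x) G'" for x
    using cont by (simp add: continuous_on_eq_continuous_at continuous_at_imp_continuous_within)
  let ?\<mu> = "interval_measure G'"
  have Ioc: "emeasure ?\<mu> {s<..t} = ennreal (G' t - G' s)" if "s \<le> t" for s t
    using that mono' contr by (rule emeasure_interval_measure_Ioc)
  have Icc: "emeasure ?\<mu> {s..t} = ennreal (G' t - G' s)" if "s \<le> t" for s t
    using that mono' cont by (rule emeasure_interval_measure_Icc)
  have fin: "finite_measure ?\<mu>"
  proof
    have "emeasure ?\<mu> (space ?\<mu>) = (SUP n. emeasure ?\<mu> {- real n .. real n})"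
    proof (subst SUP_emeasure_incseq)
      have "x \<in> (\<Union>n. {- real n..real n})" for x
        using real_arch_simple[of "\<bar>x\<bar>"] by (auto simp: abs_le_iff) (metis minus_le_iff)
      then show "emeasure ?\<mu> (space ?\<mu>) = emeasure ?\<mu> (\<Union>n. {- real n..real n})"
        by (intro arg_cong[where f="emeasure ?\<mu>"]) auto
    qed (auto simp: incseq_def)
    also have "\<dots> \<le> ennreal (G v - G u)"
    proof (rule SUP_least)
      fix n :: nat
      have "G u \<le> G' (- real n)" "G' (real n) \<le> G v"
        using mono[of u "c (- real n)"] mono[of "c (real n)" v] c uv by (auto simp: G'_def)
      then show "emeasure ?\<mu> {- real n .. real n} \<le> ennreal (G v - G u)"
        by (subst Icc) (auto intro!: ennreal_leI)
    qed
    finally show "emeasure ?\<mu> (space ?\<mu>) \<noteq> \<infinity>" by (auto simp: top_unique)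
  qed
  have null: "emeasure ?\<mu> K = 0" if K: "compact K" "K \<in> null_sets lborel" for K
  proof -
    have "emeasure ?\<mu> K \<le> ennreal e" if e: "e > 0" for e
    proof -
      obtain d where d: "d > 0"
        "\<forall>D\<in>interval_families {u..v}. (\<Sum>(l, r)\<in>D. r - l) < d \<longrightarrow> (\<Sum>(l, r)\<in>D. \<bar>G r - G l\<bar>) < e"
        using abs_contD[OF ac e] by blast
      have Kn: "K \<in> null_sets lebesgue" using K(2) by (rule null_sets_completionI)
      obtain U where U: "open U" "K \<subseteq> U" "U - K \<in> lmeasurable" "emeasure lebesgue (U - K) < ennreal d"
        using sets_lebesgue_outer_open[of K d] Kn d(1) by blast
      have "emeasure lebesgue U = emeasure lebesgue (U - K)"
        using U(1) Kn by (subst emeasure_Diff_null_set) auto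
      then have lt: "emeasure lebesgue U < ennreal d" using U(4) by simp
      have Ud: "U \<in> lmeasurable"
        using U(1) order_less_trans[OF lt ennreal_less_top] by (intro fmeasurableI) auto
      have Ud': "measure lebesgue U < d"
        using lt d(1) unfolding emeasure_eq_measure2[OF Ud] by (subst (asm) ennreal_less_iff) auto
      obtain \<epsilon> where \<epsilon>: "\<epsilon> > 0" "(\<Union>x\<in>K. ball x \<epsilon>) \<subseteq> U"
        using compact_subset_open_imp_ball_epsilon_subset[OF K(1) U(1,2)] .
      \<comment> \<open>A closed grid cell of width h that meets K stays within distance \<epsilon>
        of K, hence inside U.\<close>
      define h where "h = \<epsilon> / 2"
      have h: "0 < h" "h < \<epsilon>" using \<epsilon> by (auto simp: h_def)
      \<comment> \<open>Subtracting 1 from the ceiling selects the cell that is open on the left and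
        closed on the right, the shape whose Stieltjes measure is an increment of G'.\<close>
      define S where "S = (\<lambda>x. \<lceil>x / h\<rceil> - 1) ` K"
      have cell: "x \<in> {real_of_int (\<lceil>x / h\<rceil> - 1) * h <.. (real_of_int (\<lceil>x / h\<rceil> - 1) + 1) * h}" for x
      proof -
        have "real_of_int \<lceil>x / h\<rceil> - 1 < x / h" "x / h \<le> real_of_int \<lceil>x / h\<rceil>"
          using ceiling_correct[of "x / h"] by auto
        then have "(real_of_int \<lceil>x / h\<rceil> - 1) * h < x" "x \<le> real_of_int \<lceil>x / h\<rceil> * h"
          using h(1) by (simp_all only: pos_less_divide_eq[symmetric] pos_divide_le_eq[symmetric])
        then show ?thesis by simp
      qed
      have KS: "K \<subseteq> (\<Union>k\<in>S. {real_of_int k * h <.. (real_of_int k + 1) * h})"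
        using cell by (fastforce simp: S_def)
      have finS: "finite S"
      proof -
        obtain R where R: "\<And>x. x \<in> K \<Longrightarrow> \<bar>x\<bar> \<le> R" using compact_imp_bounded[OF K(1)] by (auto simp: bounded_iff)
        have "S \<subseteq> {\<lceil>- R / h\<rceil> - 1 .. \<lceil>R / h\<rceil> - 1}"
        proof
          fix k assume "k \<in> S"
          then obtain x where x: "x \<in> K" "k = \<lceil>x / h\<rceil> - 1" by (auto simp: S_def)
          have "- R / h \<le> x / h" "x / h \<le> R / h"
            using R[OF x(1)] h by (intro divide_right_mono; auto)+
          then have "\<lceil>- R / h\<rceil> \<le> \<lceil>x / h\<rceil>" "\<lceil>x / h\<rceil> \<le> \<lceil>R / h\<rceil>" by (auto intro: ceiling_mono)
          then show "k \<in> {\<lceil>- R / h\<rceil> - 1 .. \<lceil>R / h\<rceil> - 1}" using x(2) by simp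
        qed
        then show ?thesis by (rule finite_subset) simp
      qed
      \<comment> \<open>Cells that clamping collapses to a point carry no increment and are dropped,
        since interval families contain no degenerate intervals.\<close>
      define S' where "S' = {k\<in>S. c (real_of_int k * h) < c ((real_of_int k + 1) * h)}"
      define I where "I k = (c (real_of_int k * h), c ((real_of_int k + 1) * h))" for k
      have subU: "{real_of_int k * h .. (real_of_int k + 1) * h} \<subseteq> U" if kS: "k \<in> S" for k
      proof
        fix y assume y: "y \<in> {real_of_int k * h .. (real_of_int k + 1) * h}"
        obtain x where x: "x \<in> K" "k = \<lceil>x / h\<rceil> - 1" using kS by (auto simp: S_def)
        have "\<bar>x - y\<bar> \<le> h" using y cell[of x] unfolding x(2)[symmetric] by (auto simp: algebra_simps abs_le_iff)
        then have "y \<in> ball x \<epsilon>" using h by (simp add: dist_real_def)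
        then show "y \<in> U" using \<epsilon>(2) x(1) by blast
      qed
      have order: "snd (I k) \<le> fst (I k')" if "k < k'" for k k'
      proof -
        have "(real_of_int k + 1) * h \<le> real_of_int k' * h" using that h by (intro mult_right_mono) auto
        then show ?thesis by (simp add: I_def cmono)
      qed
      have S'lt: "fst (I k) < snd (I k)" if "k \<in> S'" for k using that by (simp add: S'_def I_def)
      have inj: "inj_on I S'"
        by (rule inj_onI) (metis S'lt order linorder_neq_iff not_le)
      have fam: "I ` S' \<in> interval_families ({u..v} \<inter> U)"
      proof (rule interval_familiesI)
        show "finite (I ` S')" using finS by (simp add: S'_def)
        fix l r assume "(l, r) \<in> I ` S'"
        then obtain k where k: "k \<in> S" "l = c (real_of_int k * h)" "r = c ((real_of_int k + 1) * h)" "l < r" by (auto simp: I_def S'_def)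
        have "{l..r} \<subseteq> {real_of_int k * h .. (real_of_int k + 1) * h}"
          using k(4) unfolding k(2,3) by (auto simp: c_def max_def min_def split: if_splits)
        then show "l < r \<and> {l..r} \<subseteq> {u..v} \<inter> U"
          using subU[OF k(1)] k c[of "real_of_int k * h"] c[of "(real_of_int k + 1) * h"] by auto
        fix l' r' assume "(l', r') \<in> I ` S'" "(l, r) \<noteq> (l', r')"
        with \<open>(l, r) \<in> I ` S'\<close> show "r \<le> l' \<or> r' \<le> l"
          using order by (metis fst_conv snd_conv imageE linorder_neq_iff)
      qed
      have "emeasure ?\<mu> K \<le> emeasure ?\<mu> (\<Union>k\<in>S. {real_of_int k * h <.. (real_of_int k + 1) * h})"
        using KS finS by (intro emeasure_mono) auto
      also have "\<dots> \<le> (\<Sum>k\<in>S. emeasure ?\<mu> {real_of_int k * h <.. (real_of_int k + 1) * h})"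
        using finS by (intro emeasure_subadditive_finite) auto
      also have "\<dots> = (\<Sum>k\<in>S. ennreal (G' ((real_of_int k + 1) * h) - G' (real_of_int k * h)))"
        using h by (intro sum.cong Ioc) (auto intro!: mult_right_mono)
      also have "\<dots> = ennreal (\<Sum>k\<in>S. G' ((real_of_int k + 1) * h) - G' (real_of_int k * h))"
        using h by (intro sum_ennreal) (auto intro!: mono' mult_right_mono)
      also have "(\<Sum>k\<in>S. G' ((real_of_int k + 1) * h) - G' (real_of_int k * h)) = (\<Sum>k\<in>S'. G' ((real_of_int k + 1) * h) - G' (real_of_int k * h))"
      proof (rule sum.mono_neutral_right[OF finS])
        show "\<forall>k\<in>S - S'. G' ((real_of_int k + 1) * h) - G' (real_of_int k * h) = 0"
        proof
          fix k assume "k \<in> S - S'"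
          moreover have "c (real_of_int k * h) \<le> c ((real_of_int k + 1) * h)" using h by (intro cmono) (auto intro!: mult_right_mono)
          ultimately show "G' ((real_of_int k + 1) * h) - G' (real_of_int k * h) = 0" by (auto simp: S'_def G'_def)
        qed
      qed (auto simp: S'_def)
      also have "\<dots> = (\<Sum>(l, r)\<in>I ` S'. G r - G l)"
        by (subst sum.reindex[OF inj]) (simp add: I_def G'_def)
      also have "\<dots> \<le> (\<Sum>(l, r)\<in>I ` S'. \<bar>G r - G l\<bar>)" by (intro sum_mono) auto
      also have "\<dots> \<le> e"
      proof -
        have "(\<Sum>(l, r)\<in>I ` S'. r - l) \<le> measure lebesgue ({u..v} \<inter> U)"
          using Ud U(1) by (intro interval_families_length[OF fam] fmeasurable_Int_fmeasurable) auto
        also have "\<dots> \<le> measure lebesgue U" using Ud U(1) by (intro measure_mono_fmeasurable) auto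
        also have "\<dots> < d" by (rule Ud')
        finally show ?thesis using d(2) interval_families_mono[OF _ fam, of "{u..v}"] by (auto simp: less_imp_le)
      qed
      finally show ?thesis by (simp add: ennreal_leI)
    qed
    then have "emeasure ?\<mu> K \<le> 0 + ennreal e" if "0 < e" for e
      using that by simp
    then have "emeasure ?\<mu> K \<le> 0" by (rule ennreal_le_epsilon)
    then show ?thesis by simp
  qed
  have abs: "absolutely_continuous lborel ?\<mu>"
    unfolding absolutely_continuous_def
  proof
    fix Z :: "real set" assume Z: "Z \<in> null_sets lborel"
    have "emeasure ?\<mu> Z = (SUP K\<in>{K. K \<subseteq> Z \<and> compact K}. emeasure ?\<mu> K)"
      using Z finite_measure.emeasure_finite[OF fin] by (intro inner_regular) auto
    also have "\<dots> = (SUP K\<in>{K. K \<subseteq> Z \<and> compact K}. 0)"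
    proof (intro SUP_cong refl null)
      fix K assume "K \<in> {K. K \<subseteq> Z \<and> compact K}"
      then show "compact K" "K \<in> null_sets lborel"
        using null_sets_subset[OF Z, of K] by (auto intro: borel_compact)
    qed
    also have "\<dots> = 0" by (intro SUP_eq_const) auto
    finally show "Z \<in> null_sets ?\<mu>" using Z by (auto intro!: null_setsI)
  qed
  obtain D where D: "integrable lborel D" "\<forall>x. 0 \<le> D x" and dens: "density lborel (\<lambda>x. ennreal (D x)) = ?\<mu>"
    using finite_measure_real_density[OF sigma_finite_lborel fin _ abs] by auto
  note iD = D(1)
  show ?thesis
  proof (intro exI[of _ D] conjI allI impI)
    show "integrable lebesgue D" using iD by (subst integrable_completion) auto
    fix s t assume st: "u \<le> s" "s \<le> t" "t \<le> v"
    have iDs: "integrable lborel (\<lambda>x. D x * indicator {s..t} x)"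
      using integrable_mult_indicator[OF _ iD, of "{s..t}"] by (simp add: mult.commute)
    have "ennreal (G t - G s) = emeasure (density lborel (\<lambda>x. ennreal (D x))) {s..t}"
      unfolding dens using st by (subst Icc) (auto simp: G'_def ceq)
    also have "\<dots> = (\<integral>\<^sup>+ x. ennreal (D x * indicator {s..t} x) \<partial>lborel)"
      using iD by (subst emeasure_density) (auto intro!: nn_integral_cong simp: indicator_def)
    also have "\<dots> = ennreal (LINT x|lborel. D x * indicator {s..t} x)"
      using iDs D(2) by (intro nn_integral_eq_integral) auto
    finally have "G t - G s = (LINT x|lborel. D x * indicator {s..t} x)"
      using mono[OF st] D(2) by (subst (asm) ennreal_inj) auto
    also have "\<dots> = (LINT x|lebesgue. D x * indicator {s..t} x)"
      using iDs by (intro integral_completion[symmetric]) auto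
    finally show "G t - G s = (LINT y:{s..t}|lebesgue. D y)"
      by (simp add: set_lebesgue_integral_def mult.commute)
  qed
qed

text \<open>Jordan decomposition: F is the difference of P and P - F, both nondecreasing and
  absolutely continuous, and the monotone case applies to each.\<close>

lemma abs_cont_has_density:
  assumes uv: "u \<le> v" and ac: "abs_cont u v F"
  shows "\<exists>f. integrable lebesgue f \<and> (\<forall>s t. u \<le> s \<longrightarrow> s \<le> t \<longrightarrow> t \<le> v \<longrightarrow> F t - F s = (LINT y:{s..t}|lebesgue. f y))"
proof -
  define P where "P t = positive_variation F {u..t}" for t
  have Pd: "P t - P s = positive_variation F {s..t}" if "u \<le> s" "s \<le> t" "t \<le> v" for s t
    unfolding P_def using positive_variation_split[OF ac, of u s t] that by simp
  have pv0: "0 \<le> positive_variation F A" if "A \<subseteq> {u..v}" for A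
    using positive_variation_upper[OF ac that, of "{}"] by simp
  have acP: "abs_cont u v P"
    unfolding abs_cont_def
  proof (intro allI impI)
    fix e :: real assume e: "e > 0"
    obtain d where d: "d > 0"
      "\<forall>A. A \<subseteq> {u..v} \<longrightarrow> A \<in> lmeasurable \<longrightarrow> measure lebesgue A < d \<longrightarrow> positive_variation F A \<le> e / 2"
      using positive_variation_small[OF ac, of "e / 2"] e by auto
    show "\<exists>d>0. \<forall>D\<in>interval_families {u..v}. (\<Sum>(l, r)\<in>D. r - l) < d \<longrightarrow> (\<Sum>(l, r)\<in>D. \<bar>P r - P l\<bar>) < e"
    proof (intro exI[of _ d] conjI ballI impI d(1))
      fix D assume D: "D \<in> interval_families {u..v}" and s: "(\<Sum>(l, r)\<in>D. r - l) < d"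
      have fin: "finite D" by (rule interval_familiesD[OF D])
      \<comment> \<open>Increments of P over a family are variations over its members. By
        superadditivity their sum is at most the variation over the union, and that union has small
        measure.\<close>
      have sup: "E \<subseteq> D \<Longrightarrow> (\<Sum>p\<in>E. positive_variation F {fst p..snd p}) \<le> positive_variation F (\<Union>p\<in>E. {fst p..snd p})" if "finite E" for E
        using that
      proof (induction E)
        case (insert q E)
        have sub: "{fst p..snd p} \<subseteq> {u..v}" if "p \<in> D" for p using interval_familiesD(3)[OF D, of "fst p" "snd p"] that by simp
        have "finite ({fst q..snd q} \<inter> (\<Union>p\<in>E. {fst p..snd p}))"
        proof (rule finite_subset)
          show "{fst q..snd q} \<inter> (\<Union>p\<in>E. {fst p..snd p}) \<subseteq> {fst q, snd q}"
          proof
            fix x assume "x \<in> {fst q..snd q} \<inter> (\<Union>p\<in>E. {fst p..snd p})"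
            then obtain p where p: "p \<in> E" "x \<in> {fst p..snd p}" "x \<in> {fst q..snd q}" by auto
            have "p \<in> D" "q \<in> D" "p \<noteq> q" using insert.hyps insert.prems p(1) by auto
            then have "snd q \<le> fst p \<or> snd p \<le> fst q"
              using interval_familiesD(4)[OF D, of "fst q" "snd q" "fst p" "snd p"] by (auto simp: prod_eq_iff)
            then show "x \<in> {fst q, snd q}" using p by auto
          qed
        qed simp
        then have "positive_variation F {fst q..snd q} + positive_variation F (\<Union>p\<in>E. {fst p..snd p})
          \<le> positive_variation F ({fst q..snd q} \<union> (\<Union>p\<in>E. {fst p..snd p}))"
          using insert.prems sub by (intro positive_variation_superadditive[OF ac]) blast+
        then show ?case using insert by simp
      qed (simp add: pv0)
      let ?A = "\<Union>p\<in>D. {fst p..snd p}"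
      have "(\<Sum>(l, r)\<in>D. \<bar>P r - P l\<bar>) = (\<Sum>p\<in>D. positive_variation F {fst p..snd p})"
      proof (rule sum.cong, simp, clarify)
        fix l r assume "(l, r) \<in> D"
        then have "u \<le> l" "l \<le> r" "r \<le> v" using interval_familiesD(2,3)[OF D, of l r] by auto
        then show "\<bar>P r - P l\<bar> = positive_variation F {fst (l, r)..snd (l, r)}" using Pd pv0[of "{l..r}"] by auto
      qed
      also have "\<dots> \<le> positive_variation F ?A" using sup[OF fin] by simp
      also have "\<dots> \<le> e / 2"
      proof (intro d(2)[rule_format])
        show "?A \<subseteq> {u..v}" using interval_familiesD(3)[OF D] by fastforce
        show "?A \<in> lmeasurable" using fin by (intro fmeasurable.finite_UN) auto
        have "measure lebesgue ?A \<le> (\<Sum>p\<in>D. measure lebesgue {fst p..snd p})"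
          using fin by (intro measure_UNION_le) auto
        also have "\<dots> = (\<Sum>(l, r)\<in>D. r - l)"
          using interval_familiesD(2)[OF D] by (intro sum.cong) (auto simp: less_imp_le)
        finally show "measure lebesgue ?A < d" using s by simp
      qed
      finally show "(\<Sum>(l, r)\<in>D. \<bar>P r - P l\<bar>) < e" using e by simp
    qed
  qed
  have monoP: "P s \<le> P t" if "u \<le> s" "s \<le> t" "t \<le> v" for s t
    using Pd[OF that] pv0[of "{s..t}"] that by auto
  have monoN: "P s - F s \<le> P t - F t" if st: "u \<le> s" "s \<le> t" "t \<le> v" for s t
  proof (cases "s = t")
    case False
    have "{(s, t)} \<in> interval_families {s..t}" using False st by (auto simp: interval_families_def)
    from positive_variation_upper[OF ac _ this] have "F t - F s \<le> positive_variation F {s..t}" using st by auto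
    then show ?thesis using Pd[OF st] by simp
  qed simp
  obtain p where p: "integrable lebesgue p" "\<And>s t. u \<le> s \<Longrightarrow> s \<le> t \<Longrightarrow> t \<le> v \<Longrightarrow> P t - P s = (LINT y:{s..t}|lebesgue. p y)"
    using abs_cont_mono_has_density[OF uv acP monoP] by blast
  obtain n where n: "integrable lebesgue n" "\<And>s t. u \<le> s \<Longrightarrow> s \<le> t \<Longrightarrow> t \<le> v \<Longrightarrow> (P t - F t) - (P s - F s) = (LINT y:{s..t}|lebesgue. n y)"
    using abs_cont_mono_has_density[OF uv abs_cont_diff[OF acP ac] monoN] by blast
  show ?thesis
  proof (intro exI[of _ "\<lambda>x. p x - n x"] conjI allI impI)
    show "integrable lebesgue (\<lambda>x. p x - n x)" using p n by auto
    fix s t assume st: "u \<le> s" "s \<le> t" "t \<le> v"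
    have "set_integrable lebesgue {s..t} p" "set_integrable lebesgue {s..t} n"
      unfolding set_integrable_def by (intro integrable_mult_indicator p n, simp)+
    then have "(LINT y:{s..t}|lebesgue. p y - n y) = (LINT y:{s..t}|lebesgue. p y) - (LINT y:{s..t}|lebesgue. n y)"
      by (rule set_integral_diff)
    then show "F t - F s = (LINT y:{s..t}|lebesgue. p y - n y)" using p(2)[OF st] n(2)[OF st] by simp
  qed
qed

lemma abs_cont_indefinite_integral:
  assumes f: "f absolutely_integrable_on {u..v}"
  shows "abs_cont u v (\<lambda>t. integral {u..t} f)"
  unfolding abs_cont_def
proof (intro allI impI)
  fix e :: real assume e: "e > 0"
  define g where "g x = indicator {u..v} x * f x" for x
  have g: "integrable lebesgue g" using f by (simp add: set_integrable_def g_def[abs_def])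
  obtain d where d: "d > 0" "\<forall>E\<in>sets lebesgue. emeasure lebesgue E < ennreal d \<longrightarrow> (LINT x:E|lebesgue. \<bar>g x\<bar>) < e"
    using integrable_uniformly_small[OF g e] by blast
  have si: "set_integrable lebesgue E (\<lambda>x. \<bar>g x\<bar>)" if "E \<in> sets lebesgue" for E
    unfolding set_integrable_def using that by (intro integrable_mult_indicator integrable_abs g)
  show "\<exists>d>0. \<forall>D\<in>interval_families {u..v}. (\<Sum>(l, r)\<in>D. r - l) < d \<longrightarrow> (\<Sum>(l, r)\<in>D. \<bar>integral {u..r} f - integral {u..l} f\<bar>) < e"
  proof (intro exI[of _ d] conjI ballI impI d(1))
    fix D assume D: "D \<in> interval_families {u..v}" and s: "(\<Sum>(l, r)\<in>D. r - l) < d"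
    have fin: "finite D" by (rule interval_familiesD[OF D])
    let ?I = "\<lambda>p. {fst p<..<snd p} :: real set"
    have le: "\<bar>integral {u..r} f - integral {u..l} f\<bar> \<le> (LINT x:{l<..<r}|lebesgue. \<bar>g x\<bar>)" if "(l, r) \<in> D" for l r
    proof -
      have lr: "u \<le> l" "l \<le> r" "r \<le> v" using interval_familiesD(2,3)[OF D that] by auto
      have fu: "f integrable_on {u..r}" and fl: "f absolutely_integrable_on {l..r}"
        using set_lebesgue_integral_eq_integral(1)[OF absolutely_integrable_on_subinterval[OF f]]
          absolutely_integrable_on_subinterval[OF f] lr by auto
      have "integral {u..r} f - integral {u..l} f = integral {l..r} f"
        using Henstock_Kurzweil_Integration.integral_combine[OF lr(1,2) fu] by simp
      also have "\<bar>\<dots>\<bar> \<le> integral {l..r} (\<lambda>x. \<bar>f x\<bar>)"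
        using fl unfolding absolutely_integrable_on_def real_norm_def
        by (metis integral_norm_bound_integral order_refl real_norm_def)
      also have "\<dots> = integral {l<..<r} (\<lambda>x. \<bar>f x\<bar>)" by (simp add: integral_open_interval_real)
      also have "\<dots> = integral {l<..<r} (\<lambda>x. \<bar>g x\<bar>)"
        using lr by (intro Henstock_Kurzweil_Integration.integral_cong) (auto simp: g_def)
      also have "\<dots> = (LINT x:{l<..<r}|lebesgue. \<bar>g x\<bar>)"
        by (intro set_lebesgue_integral_eq_integral(2)[symmetric] si) auto
      finally show ?thesis .
    qed
    have "(\<Sum>(l, r)\<in>D. \<bar>integral {u..r} f - integral {u..l} f\<bar>) \<le> (\<Sum>p\<in>D. (LINT x:?I p|lebesgue. \<bar>g x\<bar>))"
      using le by (intro sum_mono) auto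
    also have "\<dots> = (LINT x:(\<Union>p\<in>D. ?I p)|lebesgue. \<bar>g x\<bar>)"
      by (intro set_integral_finite_Union[symmetric] fin interval_families_disjoint[OF D] si) auto
    also have "\<dots> < e"
    proof (intro d(2)[rule_format])
      show "(\<Union>p\<in>D. ?I p) \<in> sets lebesgue" using fin by auto
      have "(\<Union>p\<in>D. ?I p) \<in> lmeasurable" using fin by (intro fmeasurable.finite_UN) auto
      then have "emeasure lebesgue (\<Union>p\<in>D. ?I p) = ennreal (measure lebesgue (\<Union>p\<in>D. ?I p))"
        by (rule emeasure_eq_measure2)
      also have "measure lebesgue (\<Union>p\<in>D. ?I p) \<le> (\<Sum>p\<in>D. measure lebesgue (?I p))"
        using fin by (intro measure_UNION_le) auto
      also have "(\<Sum>p\<in>D. measure lebesgue (?I p)) = (\<Sum>(l, r)\<in>D. r - l)"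
        using interval_familiesD(2)[OF D] by (intro sum.cong) (auto simp: less_imp_le)
      finally show "emeasure lebesgue (\<Union>p\<in>D. ?I p) < ennreal d" using s d(1)
        by (metis (no_types, lifting) ennreal_leI ennreal_lessI order_le_less_trans)
    qed
    finally show "(\<Sum>(l, r)\<in>D. \<bar>integral {u..r} f - integral {u..l} f\<bar>) < e" .
  qed
qed

lemma indefinite_integral_has_derivative_AE:
  assumes f: "f absolutely_integrable_on {u..v}"
  shows "AE x in lebesgue. x \<in> {u<..<v} \<longrightarrow> ((\<lambda>t. integral {u..t} f) has_real_derivative f x) (at x)"
proof -
  define g where "g x = indicator {u..v} x * f x" for x
  have g: "integrable lebesgue g" using f by (simp add: set_integrable_def g_def[abs_def])
  have "integral {u..t} f - integral {u..s} f = (LINT y:{s..t}|lebesgue. g y)" if st: "u \<le> s" "s \<le> t" "t \<le> v" for s t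
  proof -
    have fu: "f integrable_on {u..t}"
      using set_lebesgue_integral_eq_integral(1)[OF absolutely_integrable_on_subinterval[OF f]] st by auto
    have "integral {u..t} f - integral {u..s} f = integral {s..t} f"
      using Henstock_Kurzweil_Integration.integral_combine[OF st(1,2) fu] by simp
    also have "\<dots> = integral {s..t} g"
      using st by (intro Henstock_Kurzweil_Integration.integral_cong) (auto simp: g_def)
    also have "\<dots> = (LINT y:{s..t}|lebesgue. g y)"
      by (intro set_lebesgue_integral_eq_integral(2)[symmetric]) (simp add: set_integrable_def integrable_mult_indicator[OF _ g, simplified])
    finally show ?thesis .
  qed
  then have inc: "\<forall>s t. u \<le> s \<longrightarrow> s \<le> t \<longrightarrow> t \<le> v \<longrightarrow> integral {u..t} f - integral {u..s} f = (LINT y:{s..t}|lebesgue. g y)" by blast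
  show ?thesis
    using lebesgue_differentiation[OF g, of u v]
  proof eventually_elim
    fix x assume *: "\<forall>F. (\<forall>s t. u \<le> s \<longrightarrow> s \<le> t \<longrightarrow> t \<le> v \<longrightarrow> F t - F s = (LINT y:{s..t}|lebesgue. g y)) \<longrightarrow>
      u < x \<longrightarrow> x < v \<longrightarrow> (F has_real_derivative g x) (at x)"
    from *[THEN spec, THEN mp, OF inc]
    show "x \<in> {u<..<v} \<longrightarrow> ((\<lambda>t. integral {u..t} f) has_real_derivative f x) (at x)"
      by (auto simp: g_def)
  qed
qed

text \<open>The density of F is its derivative almost everywhere, so \<open>deriv F\<close>,
  whatever its values at the remaining points, may replace the density under an integral.\<close>

theorem abs_cont_FTC:
  assumes uv: "u \<le> v" and ac: "abs_cont u v F"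
  shows "AE x in lebesgue. x \<in> {u<..<v} \<longrightarrow> (F has_real_derivative deriv F x) (at x)"
    and "deriv F absolutely_integrable_on {u..v}"
    and "u \<le> s \<Longrightarrow> s \<le> t \<Longrightarrow> t \<le> v \<Longrightarrow> F t - F s = integral {s..t} (deriv F)"
proof -
  obtain f where f: "integrable lebesgue f" "\<And>s t. u \<le> s \<Longrightarrow> s \<le> t \<Longrightarrow> t \<le> v \<Longrightarrow> F t - F s = (LINT y:{s..t}|lebesgue. f y)"
    using abs_cont_has_density[OF uv ac] by blast
  have der: "AE x in lebesgue. x \<in> {u<..<v} \<longrightarrow> (F has_real_derivative f x) (at x)"
    using lebesgue_differentiation[OF f(1), of u v] by eventually_elim (use f(2) in auto)
  then show "AE x in lebesgue. x \<in> {u<..<v} \<longrightarrow> (F has_real_derivative deriv F x) (at x)"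
    by eventually_elim (auto simp: DERIV_imp_deriv)
  have "AE x in lebesgue. x \<in> {u<..<v} \<longrightarrow> deriv F x = f x"
    using der by eventually_elim (auto simp: DERIV_imp_deriv)
  then obtain N where N: "N \<in> null_sets lebesgue" "\<And>x. x \<in> {u<..<v} - N \<Longrightarrow> deriv F x = f x"
    by (auto elim!: AE_E3)
  \<comment> \<open>The end points join the exceptional set because a two-sided derivative is
    identified only in the open interval.\<close>
  have neg: "negligible (N \<union> {u, v})" using N(1) by (intro negligible_Un) (auto simp: negligible_iff_null_sets[symmetric])
  have si: "f absolutely_integrable_on {s..t}" for s t
    unfolding set_integrable_def using f(1) by (intro integrable_mult_indicator) auto
  show "deriv F absolutely_integrable_on {u..v}"
    by (rule absolutely_integrable_spike[OF si neg]) (use N(2) in auto)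
  show "F t - F s = integral {s..t} (deriv F)" if st: "u \<le> s" "s \<le> t" "t \<le> v"
  proof -
    have "integral {s..t} (deriv F) = integral {s..t} f"
      by (rule integral_spike[OF neg]) (use N(2) st in auto)
    then show ?thesis using f(2)[OF st] set_lebesgue_integral_eq_integral(2)[OF si] by simp
  qed
qed

section \<open>Solutions of the linear equation\<close>

lemma integral_combine_sum:
  fixes f :: "real \<Rightarrow> real" and u :: "nat \<Rightarrow> real"
  assumes "f integrable_on {u 0..u n}" "\<And>i. i < n \<Longrightarrow> u i \<le> u (Suc i)"
  shows "integral {u 0..u n} f = (\<Sum>i<n. integral {u i..u (Suc i)} f)"
  using assms
proof (induction n)
  case (Suc n)
  note mono = Suc.prems(2)
  have "j \<le> n \<longrightarrow> u 0 \<le> u j" for j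
  proof (induction j)
    case (Suc j)
    then show ?case using mono[of j] by auto
  qed simp
  then have u: "u 0 \<le> u n" "u n \<le> u (Suc n)" using mono[of n] by auto
  have "f integrable_on {u 0..u n}"
    by (rule integrable_subinterval_real[OF Suc.prems(1)]) (use u in auto)
  then have "integral {u 0..u n} f = (\<Sum>i<n. integral {u i..u (Suc i)} f)"
    by (rule Suc.IH) (use mono in auto)
  then show ?case
    using Henstock_Kurzweil_Integration.integral_combine[OF u Suc.prems(1)] by simp
qed simp

lemma abs_cont_subinterval:
  assumes "abs_cont u v F" "{s..t} \<subseteq> {u..v}"
  shows "abs_cont s t F"
  using assms interval_families_mono[OF assms(2)] unfolding abs_cont_def by meson

lemma sum_by_parts:
  fixes k B :: "nat \<Rightarrow> real"
  shows "(\<Sum>i<n. k i * (B (Suc i) - B i)) = k n * B n - k 0 * B 0 - (\<Sum>i<n. B (Suc i) * (k (Suc i) - k i))"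
  by (induction n) (auto simp: algebra_simps)

text \<open>On a fine grid B differs from its value at the right end of each cell by less than e, so
  the total error is at most e times the integral of |k'|. Right end points are what summation by
  parts produces.\<close>

lemma stieltjes_right_sums_tendsto:
  fixes B k :: "real \<Rightarrow> real"
  assumes st: "s \<le> t" and B: "continuous_on {s..t} B" and k: "abs_cont s t k"
  defines "u \<equiv> \<lambda>m i. s + real i * (t - s) / real m"
  shows "(\<lambda>m. \<Sum>i<m. B (u m (Suc i)) * (k (u m (Suc i)) - k (u m i))) \<longlonglongrightarrow> integral {s..t} (\<lambda>x. B x * deriv k x)"
proof -
  note dk = abs_cont_FTC(2)[OF st k]
  have Bk: "(\<lambda>x. B x * deriv k x) absolutely_integrable_on {s..t}"
  proof -
    have "bounded (B ` {s..t})" using B compact_continuous_image compact_imp_bounded by blast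
    moreover have "B \<in> borel_measurable (lebesgue_on {s..t})"
      using B by (intro continuous_imp_measurable_on_sets_lebesgue) auto
    ultimately show ?thesis using dk by (intro absolutely_integrable_bounded_measurable_product_real) auto
  qed
  then have iBk: "(\<lambda>x. B x * deriv k x) integrable_on {s..t}" by (rule set_lebesgue_integral_eq_integral(1))
  define C where "C = integral {s..t} (\<lambda>x. \<bar>deriv k x\<bar>)"
  have idk: "(\<lambda>x. \<bar>deriv k x\<bar>) integrable_on {s..t}"
    using dk by (simp add: absolutely_integrable_on_def)
  have C0: "0 \<le> C" unfolding C_def using idk by (rule Henstock_Kurzweil_Integration.integral_nonneg) simp
  show ?thesis
  proof (rule LIMSEQ_I)
    fix r :: real assume r: "r > 0"
    \<comment> \<open>C is the total variation of k, expressed by its derivative; C + 1 avoids a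
      division by zero when k is constant.\<close>
    define e where "e = r / (C + 1)"
    have e: "e > 0" using r C0 by (simp add: e_def)
    have "uniformly_continuous_on {s..t} B" using B compact_uniformly_continuous by blast
    then obtain d where d: "d > 0" "\<And>x y. x \<in> {s..t} \<Longrightarrow> y \<in> {s..t} \<Longrightarrow> \<bar>x - y\<bar> < d \<Longrightarrow> \<bar>B x - B y\<bar> < e"
      unfolding uniformly_continuous_on_def dist_real_def using e by metis
    obtain m0 :: nat where m0: "(t - s) / d < real m0" using reals_Archimedean2 by blast
    have "norm ((\<Sum>i<m. B (u m (Suc i)) * (k (u m (Suc i)) - k (u m i))) - integral {s..t} (\<lambda>x. B x * deriv k x)) < r"
      if m: "m \<ge> Suc m0" for m
    proof -
      have mpos: "real m > 0" and mm: "(t - s) / real m < d"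
      proof -
        show "real m > 0" using m by simp
        have "(t - s) / d < real m" using m0 m by linarith
        then show "(t - s) / real m < d" using d(1) \<open>real m > 0\<close> by (simp add: field_simps)
      qed
      have u0: "u m 0 = s" and um: "u m m = t" using mpos by (auto simp: u_def)
      have ustep: "u m (Suc i) - u m i = (t - s) / real m" for i by (simp add: u_def add_divide_distrib distrib_right)
      have umono: "u m i \<le> u m (Suc i)" for i
      proof -
        have "0 \<le> (t - s) / real m" using st mpos by simp
        then show ?thesis using ustep[of i] by linarith
      qed
      have incu: "i \<le> j \<Longrightarrow> u m i \<le> u m j" for i j
        using lift_Suc_mono_le[of "u m" i j] umono by blast
      have ust: "s \<le> u m i" "i \<le> m \<Longrightarrow> u m i \<le> t" for i using incu[of 0 i] incu[of i m] u0 um by auto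
      have sub: "{u m i..u m (Suc i)} \<subseteq> {s..t}" if "i < m" for i using ust(1)[of i] ust(2)[of "Suc i"] that by auto
      have cell: "\<bar>B (u m (Suc i)) * (k (u m (Suc i)) - k (u m i)) - integral {u m i..u m (Suc i)} (\<lambda>x. B x * deriv k x)\<bar>
        \<le> e * integral {u m i..u m (Suc i)} (\<lambda>x. \<bar>deriv k x\<bar>)" if i: "i < m" for i
      proof -
        let ?J = "{u m i..u m (Suc i)}"
        have i1: "deriv k integrable_on ?J" "(\<lambda>x. B x * deriv k x) integrable_on ?J" "(\<lambda>x. \<bar>deriv k x\<bar>) integrable_on ?J"
          using integrable_subinterval_real[OF _ sub[OF i]] iBk idk set_lebesgue_integral_eq_integral(1)[OF dk] by auto
        have i2: "(\<lambda>x. B (u m (Suc i)) * deriv k x) integrable_on ?J" "(\<lambda>x. e * \<bar>deriv k x\<bar>) integrable_on ?J"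
          using integrable_on_cmult_left[OF i1(1), of "B (u m (Suc i))"] integrable_on_cmult_left[OF i1(3), of e] by auto
        have "k (u m (Suc i)) - k (u m i) = integral ?J (deriv k)"
          using umono ust i by (intro abs_cont_FTC(3)[OF st k]) auto
        then have "B (u m (Suc i)) * (k (u m (Suc i)) - k (u m i)) - integral ?J (\<lambda>x. B x * deriv k x)
          = integral ?J (\<lambda>x. B (u m (Suc i)) * deriv k x - B x * deriv k x)"
          using i1 i2 by (simp add: Henstock_Kurzweil_Integration.integral_diff)
        also have "norm \<dots> \<le> integral ?J (\<lambda>x. e * \<bar>deriv k x\<bar>)"
        proof (rule integral_norm_bound_integral)
          fix x assume x: "x \<in> ?J"
          have "\<bar>u m (Suc i) - x\<bar> < d" using x ustep[of i] mm by auto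
          then have "\<bar>B (u m (Suc i)) - B x\<bar> \<le> e" using d(2)[of "u m (Suc i)" x] sub[OF i] x umono[of i] by (auto simp: less_imp_le)
          then have "\<bar>B (u m (Suc i)) - B x\<bar> * \<bar>deriv k x\<bar> \<le> e * \<bar>deriv k x\<bar>" by (rule mult_right_mono) simp
          then show "norm (B (u m (Suc i)) * deriv k x - B x * deriv k x) \<le> e * \<bar>deriv k x\<bar>"
            by (simp add: left_diff_distrib[symmetric] abs_mult)
        qed (use i1 i2 in \<open>auto intro!: integrable_diff\<close>)
        finally show ?thesis by simp
      qed
      have "integral {s..t} (\<lambda>x. B x * deriv k x) = (\<Sum>i<m. integral {u m i..u m (Suc i)} (\<lambda>x. B x * deriv k x))"
        using integral_combine_sum[of "\<lambda>x. B x * deriv k x" "u m" m] iBk umono unfolding u0 um by blast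
      then have "norm ((\<Sum>i<m. B (u m (Suc i)) * (k (u m (Suc i)) - k (u m i))) - integral {s..t} (\<lambda>x. B x * deriv k x))
        \<le> (\<Sum>i<m. \<bar>B (u m (Suc i)) * (k (u m (Suc i)) - k (u m i)) - integral {u m i..u m (Suc i)} (\<lambda>x. B x * deriv k x)\<bar>)"
        by (simp add: sum_subtractf[symmetric])
      also have "\<dots> \<le> (\<Sum>i<m. e * integral {u m i..u m (Suc i)} (\<lambda>x. \<bar>deriv k x\<bar>))"
        using cell by (intro sum_mono) auto
      also have "\<dots> = e * C"
        unfolding C_def sum_distrib_left[symmetric]
        using integral_combine_sum[of "\<lambda>x. \<bar>deriv k x\<bar>" "u m" m] idk umono unfolding u0 um by simp
      also have "\<dots> < e * (C + 1)" using e by simp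
      also have "\<dots> = r" using C0 by (simp add: e_def)
      finally show ?thesis .
    qed
    then show "\<exists>no. \<forall>n\<ge>no. norm ((\<Sum>i<n. B (u n (Suc i)) * (k (u n (Suc i)) - k (u n i))) - integral {s..t} (\<lambda>x. B x * deriv k x)) < r" by blast
  qed
qed

text \<open>With B a Brownian path these left sums approximate the integral of k against B.
  Summation by parts moves the differences onto k, so they converge for each path although B has
  infinite variation.\<close>

lemma stieltjes_sums_tendsto:
  fixes B k :: "real \<Rightarrow> real"
  assumes st: "s \<le> t" and B: "continuous_on {s..t} B" and k: "abs_cont s t k"
  defines "u \<equiv> \<lambda>m i. s + real i * (t - s) / real m"
  shows "(\<lambda>m. \<Sum>i<m. k (u m i) * (B (u m (Suc i)) - B (u m i))) \<longlonglongrightarrow>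
     k t * B t - k s * B s - integral {s..t} (\<lambda>x. B x * deriv k x)"
proof -
  have "(\<lambda>m. \<Sum>i<m. B (u m (Suc i)) * (k (u m (Suc i)) - k (u m i))) \<longlonglongrightarrow> integral {s..t} (\<lambda>x. B x * deriv k x)"
    using stieltjes_right_sums_tendsto[OF st B k] unfolding u_def .
  from tendsto_diff[OF tendsto_const this, of "k t * B t - k s * B s"]
  show ?thesis
  proof (rule Lim_transform_eventually)
    show "\<forall>\<^sub>F m in sequentially. k t * B t - k s * B s - (\<Sum>i<m. B (u m (Suc i)) * (k (u m (Suc i)) - k (u m i)))
       = (\<Sum>i<m. k (u m i) * (B (u m (Suc i)) - B (u m i)))"
    proof (rule eventually_sequentiallyI[of 1])
      fix m :: nat assume "1 \<le> m"
      then have "u m 0 = s" "u m m = t" by (auto simp: u_def)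
      then show "k t * B t - k s * B s - (\<Sum>i<m. B (u m (Suc i)) * (k (u m (Suc i)) - k (u m i)))
       = (\<Sum>i<m. k (u m i) * (B (u m (Suc i)) - B (u m i)))"
        using sum_by_parts[of "\<lambda>i. k (u m i)" "\<lambda>i. B (u m i)" m] by simp
    qed
  qed
qed

lemma abs_cont_ident: "abs_cont u v (\<lambda>x. x)"
  unfolding abs_cont_def
proof (intro allI impI)
  fix e :: real assume "e > 0"
  moreover have "(\<Sum>(l, r)\<in>D. \<bar>r - l\<bar>) = (\<Sum>(l, r)\<in>D. r - l)" if "D \<in> interval_families {u..v}" for D
    using interval_familiesD(2)[OF that] by (intro sum.cong) (auto simp: less_imp_le)
  ultimately show "\<exists>d>0. \<forall>D\<in>interval_families {u..v}. (\<Sum>(l, r)\<in>D. r - l) < d \<longrightarrow> (\<Sum>(l, r)\<in>D. \<bar>r - l\<bar>) < e"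
    by auto
qed

text \<open>Left end points match the variances of the sums in
  \<open>stieltjes_sums_tendsto\<close>. Right and left sums differ by a telescoping term of order
  1/m.\<close>

lemma riemann_sums_tendsto:
  fixes f :: "real \<Rightarrow> real"
  assumes st: "s \<le> t" and f: "continuous_on {s..t} f"
  shows "(\<lambda>m. \<Sum>i<m. f (s + real i * (t - s) / real m) * ((t - s) / real m)) \<longlonglongrightarrow> integral {s..t} f"
proof -
  define u where "u m i = s + real i * (t - s) / real m" for m i :: nat
  have step: "u m (Suc i) - u m i = (t - s) / real m" for m i by (simp add: u_def add_divide_distrib distrib_right)
  have "(\<lambda>m. \<Sum>i<m. f (u m (Suc i)) * (u m (Suc i) - u m i)) \<longlonglongrightarrow> integral {s..t} (\<lambda>x. f x * deriv (\<lambda>x. x) x)"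
    using stieltjes_right_sums_tendsto[OF st f abs_cont_ident] unfolding u_def .
  moreover have "(\<lambda>m. (f t - f s) * (t - s) / real m) \<longlonglongrightarrow> 0" by (rule lim_const_over_n)
  ultimately have "(\<lambda>m. (\<Sum>i<m. f (u m (Suc i)) * (u m (Suc i) - u m i)) - (f t - f s) * (t - s) / real m) \<longlonglongrightarrow> integral {s..t} f - 0"
    by (intro tendsto_diff) auto
  then have "(\<lambda>m. (\<Sum>i<m. f (u m (Suc i)) * (u m (Suc i) - u m i)) - (f t - f s) * (t - s) / real m) \<longlonglongrightarrow> integral {s..t} f"
    by simp
  then show ?thesis
  proof (rule Lim_transform_eventually)
    show "\<forall>\<^sub>F m in sequentially. (\<Sum>i<m. f (u m (Suc i)) * (u m (Suc i) - u m i)) - (f t - f s) * (t - s) / real m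
       = (\<Sum>i<m. f (s + real i * (t - s) / real m) * ((t - s) / real m))"
    proof (rule eventually_sequentiallyI[of 1])
      fix m :: nat assume "1 \<le> m"
      then have u: "u m 0 = s" "u m m = t" by (auto simp: u_def)
      have "(\<Sum>i<m. f (u m (Suc i)) * (u m (Suc i) - u m i)) - (\<Sum>i<m. f (u m i) * ((t - s) / real m))
        = (\<Sum>i<m. f (u m (Suc i)) - f (u m i)) * ((t - s) / real m)"
        unfolding step sum_distrib_right sum_subtractf[symmetric]
        by (simp add: left_diff_distrib diff_divide_distrib)
      also have "(\<Sum>i<m. f (u m (Suc i)) - f (u m i)) = f t - f s"
        using sum_lessThan_telescope[of "\<lambda>i. f (u m i)" m] u by simp
      finally show "(\<Sum>i<m. f (u m (Suc i)) * (u m (Suc i) - u m i)) - (f t - f s) * (t - s) / real m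
       = (\<Sum>i<m. f (s + real i * (t - s) / real m) * ((t - s) / real m))"
        by (simp add: u_def)
    qed
  qed
qed

text \<open>The path x is as rough as w, but V = x - w is absolutely continuous, and so is its
  product with k = 1/\<phi>. The almost everywhere derivative of V k contains no x any more, and
  integrating it solves the equation.\<close>

lemma linear_equation_solution:
  fixes \<phi> w x :: "real \<Rightarrow> real"
  assumes ac: "abs_cont 0 v \<phi>" and nz: "\<And>t. t \<in> {0..v} \<Longrightarrow> \<phi> t \<noteq> 0" and v: "0 \<le> v"
    and h: "(\<lambda>r. deriv \<phi> r / \<phi> r * x r) absolutely_integrable_on {0..v}"
    and eq: "\<And>t. t \<in> {0..v} \<Longrightarrow> x t = a + integral {0..t} (\<lambda>r. deriv \<phi> r / \<phi> r * x r) + w t"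
    and st: "0 \<le> s" "s \<le> t" "t \<le> v"
  shows "x t / \<phi> t - x s / \<phi> s =
    1 / \<phi> t * w t - 1 / \<phi> s * w s - integral {s..t} (\<lambda>r. w r * deriv (\<lambda>r. 1 / \<phi> r) r)"
proof -
  define V where "V t = a + integral {0..t} (\<lambda>r. deriv \<phi> r / \<phi> r * x r)" for t
  define k where "k r = 1 / \<phi> r" for r
  have Vx: "V t = x t - w t" if "t \<in> {0..v}" for t using eq[OF that] by (simp add: V_def)
  have acV: "abs_cont 0 v V" unfolding V_def
    by (intro abs_cont_add abs_cont_const abs_cont_indefinite_integral h)
  have ack: "abs_cont 0 v k" unfolding k_def by (rule abs_cont_inverse[OF ac nz])
  have acVk: "abs_cont 0 v (\<lambda>r. V r * k r)" by (rule abs_cont_mult[OF acV ack])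
  have "AE r in lebesgue. r \<in> {0<..<v} \<longrightarrow> deriv (\<lambda>r. V r * k r) r = - (w r * deriv k r)"
    using abs_cont_FTC(1)[OF v ac] indefinite_integral_has_derivative_AE[OF h]
  proof eventually_elim
    case (elim r)
    show ?case
    proof
      assume r: "r \<in> {0<..<v}"
      have p: "(\<phi> has_real_derivative deriv \<phi> r) (at r)" using elim(1) r by simp
      have V': "(V has_real_derivative deriv \<phi> r / \<phi> r * x r) (at r)"
        unfolding V_def using elim(2) r by (auto intro!: derivative_eq_intros)
      have nzr: "\<phi> r \<noteq> 0" using nz r by auto
      have k': "(k has_real_derivative - (deriv \<phi> r / (\<phi> r)\<^sup>2)) (at r)"
        unfolding k_def using p nzr by (auto intro!: derivative_eq_intros simp: power2_eq_square)
      have "((\<lambda>r. V r * k r) has_real_derivative (deriv \<phi> r / \<phi> r * x r * k r + - (deriv \<phi> r / (\<phi> r)\<^sup>2) * V r)) (at r)"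
        by (rule DERIV_mult[OF V' k'])
      \<comment> \<open>Since x - V = w, what remains is w times \<phi>'/\<phi>^2, and k' = -
        \<phi>'/\<phi>^2.\<close>
      moreover have "deriv \<phi> r / \<phi> r * x r * k r + - (deriv \<phi> r / (\<phi> r)\<^sup>2) * V r = - (w r * - (deriv \<phi> r / (\<phi> r)\<^sup>2))"
      proof -
        have "x r = V r + w r" using Vx[of r] r by simp
        then show ?thesis using nzr by (simp add: k_def field_simps power2_eq_square)
      qed
      ultimately show "deriv (\<lambda>r. V r * k r) r = - (w r * deriv k r)"
        using DERIV_imp_deriv[OF k'] by (simp add: DERIV_imp_deriv)
    qed
  qed
  then obtain N where N: "N \<in> null_sets lebesgue" "\<And>r. r \<in> {0<..<v} - N \<Longrightarrow> deriv (\<lambda>r. V r * k r) r = - (w r * deriv k r)"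
    by (auto elim!: AE_E3)
  have neg: "negligible (N \<union> {0, v})" using N(1) by (intro negligible_Un) (auto simp: negligible_iff_null_sets[symmetric])
  have "V t * k t - V s * k s = integral {s..t} (deriv (\<lambda>r. V r * k r))"
    by (rule abs_cont_FTC(3)[OF v acVk st])
  also have "\<dots> = integral {s..t} (\<lambda>r. - (w r * deriv k r))"
  proof (rule integral_spike[OF neg])
    fix r assume "r \<in> {s..t} - (N \<union> {0, v})"
    then have "r \<in> {0<..<v} - N" using st by auto
    from N(2)[OF this] show "- (w r * deriv k r) = deriv (\<lambda>r. V r * k r) r" by simp
  qed
  also have "\<dots> = - integral {s..t} (\<lambda>r. w r * deriv k r)" by simp
  finally show ?thesis
    using Vx[of t] Vx[of s] st unfolding k_def by (simp add: diff_divide_distrib)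
qed

section \<open>Limits of independent Gaussian variables\<close>

lemma char_normal_density:
  assumes s: "0 < \<sigma>"
  shows "char (density lborel (normal_density 0 \<sigma>)) t = complex_of_real (exp (- ((\<sigma> * t)\<^sup>2) / 2))"
proof -
  let ?N = "density lborel (normal_density 0 \<sigma>)"
  interpret N: prob_space ?N by (rule prob_space_normal_density[OF s])
  have "distributed ?N lborel (\<lambda>x. x) (normal_density 0 \<sigma>)"
    unfolding distributed_def using distr_id[of lborel] by (auto simp: distr_id2)
  then have "distributed ?N lborel (\<lambda>x. (x - 0) / \<sigma>) std_normal_density"
    unfolding N.normal_standard_normal_convert[OF s] .
  then have d: "distr ?N lborel (\<lambda>x. x / \<sigma>) = std_normal_distribution"
    by (simp add: distributed_def)
  have "complex_of_real (exp (- ((\<sigma> * t)\<^sup>2) / 2)) = char (distr ?N lborel (\<lambda>x. x / \<sigma>)) (\<sigma> * t)"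
    unfolding d char_std_normal_distribution by simp
  also have "\<dots> = (CLINT x|?N. iexp ((\<sigma> * t) * (x / \<sigma>)))"
    unfolding char_def by (subst integral_distr) auto
  also have "\<dots> = char ?N t"
    unfolding char_def using s by simp
  finally show ?thesis ..
qed

context prob_space
begin

lemma char_distributed_normal:
  assumes "0 < \<sigma>" "distributed M lborel X (normal_density 0 \<sigma>)"
  shows "(CLINT \<omega>|M. iexp (t * X \<omega>)) = complex_of_real (exp (- ((\<sigma> * t)\<^sup>2) / 2))"
proof -
  have [measurable]: "X \<in> borel_measurable M" using assms(2) by (simp add: distributed_def)
  have "(CLINT \<omega>|M. iexp (t * X \<omega>)) = char (distr M lborel X) t"
    unfolding char_def by (subst integral_distr) auto
  also have "distr M lborel X = density lborel (normal_density 0 \<sigma>)"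
    using assms(2) by (simp add: distributed_def)
  finally show ?thesis by (simp add: char_normal_density[OF assms(1)])
qed

text \<open>Characteristic functions converge by dominated convergence, and their limit determines
  the law. Only indices from N on are considered because a sum over an empty grid has no normal
  density.\<close>

lemma distributed_normal_limit:
  assumes G: "\<And>m. m \<ge> N \<Longrightarrow> distributed M lborel (G m) (normal_density 0 (\<sigma> m))" "\<And>m. m \<ge> N \<Longrightarrow> 0 < \<sigma> m"
    and s: "\<sigma> \<longlonglongrightarrow> s" "0 < s"
    and D [measurable]: "D \<in> borel_measurable M"
    and lim: "AE \<omega> in M. (\<lambda>m. G m \<omega>) \<longlonglongrightarrow> D \<omega>"
  shows "distributed M lborel D (normal_density 0 s)"
proof -
  have mG: "G m \<in> borel_measurable M" if "m \<ge> N" for m using G(1)[OF that] by (simp add: distributed_def)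
  have "char (distr M borel D) t = char (density lborel (normal_density 0 s)) t" for t
  proof -
    have "(\<lambda>m. CLINT \<omega>|M. iexp (t * G (m + N) \<omega>)) \<longlonglongrightarrow> (CLINT \<omega>|M. iexp (t * D \<omega>))"
    proof (rule integral_dominated_convergence[where w="\<lambda>_. 1"])
      show "AE \<omega> in M. (\<lambda>m. iexp (t * G (m + N) \<omega>)) \<longlonglongrightarrow> iexp (t * D \<omega>)"
        using lim
      proof eventually_elim
        case (elim \<omega>)
        then have "(\<lambda>m. G (m + N) \<omega>) \<longlonglongrightarrow> D \<omega>" by (rule LIMSEQ_ignore_initial_segment)
        then show ?case by (intro tendsto_intros)
      qed
      show "(\<lambda>\<omega>. iexp (t * G (m + N) \<omega>)) \<in> borel_measurable M" for m
        using mG[of "m + N"] by measurable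
    qed auto
    then have "(\<lambda>m. complex_of_real (exp (- ((\<sigma> (m + N) * t)\<^sup>2) / 2))) \<longlonglongrightarrow> (CLINT \<omega>|M. iexp (t * D \<omega>))"
      using char_distributed_normal[OF G(2) G(1)] by simp
    moreover have "(\<lambda>m. complex_of_real (exp (- ((\<sigma> (m + N) * t)\<^sup>2) / 2))) \<longlonglongrightarrow> complex_of_real (exp (- ((s * t)\<^sup>2) / 2))"
      using LIMSEQ_ignore_initial_segment[OF s(1)] by (intro tendsto_intros) auto
    ultimately have "(CLINT \<omega>|M. iexp (t * D \<omega>)) = complex_of_real (exp (- ((s * t)\<^sup>2) / 2))"
      by (rule LIMSEQ_unique)
    moreover have "char (distr M borel D) t = (CLINT \<omega>|M. iexp (t * D \<omega>))"
      unfolding char_def by (subst integral_distr) auto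
    ultimately show ?thesis by (simp add: char_normal_density[OF s(2)])
  qed
  moreover have "real_distribution (density lborel (normal_density 0 s))"
    using prob_space_normal_density[OF s(2)] by (auto simp: real_distribution_def real_distribution_axioms_def)
  moreover have "real_distribution (distr M borel D)" by (rule real_distribution_distr) measurable
  ultimately have "distr M borel D = density lborel (normal_density 0 s)" by (intro Levy_uniqueness) auto
  moreover have "distr M lborel D = distr M borel D" by (intro distr_cong) auto
  ultimately show ?thesis unfolding distributed_def by auto
qed

lemma distributed_lborel_no_atom:
  assumes "distributed M lborel D f"
  shows "AE \<omega> in M. D \<omega> \<noteq> (x::real)"
proof -
  have f: "f \<in> borel_measurable lborel" and D: "D \<in> measurable M lborel" and eq: "distr M lborel D = density lborel f"
    using assms by (auto simp: distributed_def)
  have "AE y in density lborel f. y \<noteq> x"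
    unfolding AE_density[OF f] using AE_lborel_singleton[of x] by eventually_elim auto
  then show ?thesis unfolding eq[symmetric] using D by (subst (asm) AE_distr_iff) auto
qed

text \<open>Independence is tested on half lines, which form a generator closed under intersection.
  The indicator of {G \<le> x} converges almost surely exactly because the limit variable avoids the
  value x; this is the purpose of the hypothesis on atoms.\<close>

lemma indep_vars_limit:
  fixes G :: "nat \<Rightarrow> 'i \<Rightarrow> 'a \<Rightarrow> real"
  assumes G: "\<And>m. m \<ge> N \<Longrightarrow> indep_vars (\<lambda>_. borel) (G m) I"
    and D: "\<And>i. i \<in> I \<Longrightarrow> D i \<in> borel_measurable M"
    and lim: "\<And>i. i \<in> I \<Longrightarrow> AE \<omega> in M. (\<lambda>m. G m i \<omega>) \<longlonglongrightarrow> D i \<omega>"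
    and atom: "\<And>i x. i \<in> I \<Longrightarrow> AE \<omega> in M. D i \<omega> \<noteq> x"
  shows "indep_vars (\<lambda>_. borel) D I"
proof -
  define F where "F i = {D i -` A \<inter> space M | A. A \<in> range (\<lambda>x::real. {..x})}" for i
  have gen: "sigma_sets (space M) {D i -` A \<inter> space M | A. A \<in> sets borel} = sigma_sets (space M) (F i)" for i
  proof -
    have "{D i -` A \<inter> space M | A. A \<in> sets borel} = sigma_sets (space M) (F i)"
      unfolding F_def borel_eq_atMost using sigma_sets_vimage_commute[of "D i" "space M" UNIV] by simp
    moreover have "F i \<subseteq> Pow (space M)" by (auto simp: F_def)
    ultimately show ?thesis by (simp only: sigma_sets_sigma_sets_eq)
  qed
  have conv: "(\<lambda>m. prob (\<Inter>j\<in>J. G (m + N) j -` {..x j} \<inter> space M)) \<longlonglongrightarrow> prob (\<Inter>j\<in>J. D j -` {..x j} \<inter> space M)"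
    if J: "J \<noteq> {}" "J \<subseteq> I" "finite J" for J and x :: "'i \<Rightarrow> real"
  proof -
    have mG: "G (m + N) j \<in> borel_measurable M" if "j \<in> J" for m j
      using G[of "m + N"] J that by (auto simp: indep_vars_def)
    have mD: "D j \<in> borel_measurable M" if "j \<in> J" for j using D J that by blast
    have setsG: "(\<Inter>j\<in>J. G (m + N) j -` {..x j} \<inter> space M) \<in> sets M" for m
      using J mG by (intro sets.finite_INT measurable_sets) auto
    have setsD: "(\<Inter>j\<in>J. D j -` {..x j} \<inter> space M) \<in> sets M"
      using J mD by (intro sets.finite_INT measurable_sets) auto
    have "(\<lambda>m. LINT \<omega>|M. indicat_real (\<Inter>j\<in>J. G (m + N) j -` {..x j} \<inter> space M) \<omega>)
       \<longlonglongrightarrow> (LINT \<omega>|M. indicat_real (\<Inter>j\<in>J. D j -` {..x j} \<inter> space M) \<omega>)"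
    proof (rule integral_dominated_convergence[where w="\<lambda>_. 1"])
      have "AE \<omega> in M. \<forall>j\<in>J. (\<lambda>m. G m j \<omega>) \<longlonglongrightarrow> D j \<omega> \<and> D j \<omega> \<noteq> x j"
        using J lim atom by (intro AE_finite_allI) (auto simp: subset_eq)
      then show "AE \<omega> in M. (\<lambda>m. indicat_real (\<Inter>j\<in>J. G (m + N) j -` {..x j} \<inter> space M) \<omega>)
         \<longlonglongrightarrow> indicat_real (\<Inter>j\<in>J. D j -` {..x j} \<inter> space M) \<omega>"
        using AE_space
      proof eventually_elim
        case (elim \<omega>)
        have "\<forall>\<^sub>F m in sequentially. \<forall>j\<in>J. (G m j \<omega> \<le> x j) = (D j \<omega> \<le> x j)"
        proof (intro eventually_ball_finite J ballI)
          fix j assume j: "j \<in> J"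
          show "\<forall>\<^sub>F m in sequentially. (G m j \<omega> \<le> x j) = (D j \<omega> \<le> x j)"
          proof (cases "D j \<omega> < x j")
            case True
            then have "\<forall>\<^sub>F m in sequentially. G m j \<omega> < x j" using elim j by (intro order_tendstoD(2)) auto
            then show ?thesis by eventually_elim (use True in auto)
          next
            case False
            then have gt: "x j < D j \<omega>" using elim j by force
            then have "\<forall>\<^sub>F m in sequentially. x j < G m j \<omega>" using elim j by (intro order_tendstoD(1)) auto
            then show ?thesis by eventually_elim (use gt in auto)
          qed
        qed
        then have "\<forall>\<^sub>F m in sequentially. \<forall>j\<in>J. (G (m + N) j \<omega> \<le> x j) = (D j \<omega> \<le> x j)"
          by (rule eventually_all_ge_at_top[THEN eventually_mono, THEN sequentially_offset]) auto
        then show ?case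
          by (intro tendsto_eventually, elim eventually_mono) (use elim(2) in \<open>auto simp: indicator_def\<close>)
      qed
    qed (use setsG setsD in auto)
    then show ?thesis using setsG setsD by (simp add: sets.Int_space_eq2)
  qed
  have mult: "prob (\<Inter>j\<in>J. D j -` {..x j} \<inter> space M) = (\<Prod>j\<in>J. prob (D j -` {..x j} \<inter> space M))"
    if J: "J \<noteq> {}" "J \<subseteq> I" "finite J" for J x
  proof (rule LIMSEQ_unique)
    show "(\<lambda>m. prob (\<Inter>j\<in>J. G (m + N) j -` {..x j} \<inter> space M)) \<longlonglongrightarrow> prob (\<Inter>j\<in>J. D j -` {..x j} \<inter> space M)"
      by (rule conv[OF J])
    have "prob (\<Inter>j\<in>J. G (m + N) j -` {..x j} \<inter> space M) = (\<Prod>j\<in>J. prob (G (m + N) j -` {..x j} \<inter> space M))" for m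
      using J by (intro indep_varsD[OF G]) auto
    moreover have "(\<lambda>m. \<Prod>j\<in>J. prob (G (m + N) j -` {..x j} \<inter> space M)) \<longlonglongrightarrow> (\<Prod>j\<in>J. prob (D j -` {..x j} \<inter> space M))"
      using conv[of "{_}" x] J by (intro tendsto_prod) auto
    ultimately show "(\<lambda>m. prob (\<Inter>j\<in>J. G (m + N) j -` {..x j} \<inter> space M)) \<longlonglongrightarrow> (\<Prod>j\<in>J. prob (D j -` {..x j} \<inter> space M))"
      by simp
  qed
  show ?thesis unfolding indep_vars_def gen
  proof (intro conjI ballI D indep_sets_sigma indep_setsI)
    fix i assume "i \<in> I"
    then show "F i \<subseteq> events" using D[of i] by (auto simp: F_def intro!: measurable_sets)
  next
    fix A J assume J: "J \<noteq> {}" "J \<subseteq> I" "finite J" and A: "\<forall>j\<in>J. A j \<in> F j"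
    have "\<forall>j\<in>J. \<exists>x. A j = D j -` {..x} \<inter> space M" using A unfolding F_def by blast
    then obtain x where "\<forall>j\<in>J. A j = D j -` {..x j} \<inter> space M" by metis
    then show "prob (\<Inter>j\<in>J. A j) = (\<Prod>j\<in>J. prob (A j))" using mult[OF J, of x] by simp
  next
    fix i assume "i \<in> I"
    show "Int_stable (F i)"
      unfolding Int_stable_def
    proof (intro ballI)
      fix a b assume "a \<in> F i" "b \<in> F i"
      then obtain x y where "a = D i -` {..x} \<inter> space M" "b = D i -` {..y} \<inter> space M"
        unfolding F_def by blast
      then have "a \<inter> b = D i -` {..min x y} \<inter> space M" by auto
      then show "a \<inter> b \<in> F i" unfolding F_def by blast
    qed
  qed
qed

end

section \<open>Increments of the solution on a grid of times\<close>

lemma brownian_motionD: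
  assumes "brownian_motion M B"
  shows "prob_space M" "t \<ge> 0 \<Longrightarrow> B t \<in> borel_measurable M"
    "\<omega> \<in> space M \<Longrightarrow> continuous_on {0..} (\<lambda>t. B t \<omega>)"
    "AE \<omega> in M. B 0 \<omega> = 0"
    "0 \<le> s \<Longrightarrow> s < t \<Longrightarrow> distributed M lborel (\<lambda>\<omega>. B t \<omega> - B s \<omega>) (normal_density 0 (sqrt (t - s)))"
    "0 \<le> u 0 \<Longrightarrow> (\<And>i. i < n \<Longrightarrow> u i \<le> u (Suc i)) \<Longrightarrow>
       prob_space.indep_vars M (\<lambda>_. borel) (\<lambda>i \<omega>. B (u (Suc i)) \<omega> - B (u i) \<omega>) {..<(n::nat)}"
  using assms unfolding brownian_motion_def by blast+

lemma increasing_upto_mono: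
  fixes T :: "nat \<Rightarrow> real"
  assumes "\<And>i. i < n \<Longrightarrow> T i < T (Suc i)" "i \<le> j" "j \<le> n"
  shows "T i \<le> T j"
  using assms(2,3)
proof (induction j)
  case (Suc j)
  then show ?case using assms(1)[of j] by (cases "i = Suc j") auto
qed simp

lemma strong_solution_initial:
  assumes "brownian_motion M B" "strong_solution M B \<psi> c x X" "0 < c"
  shows "AE \<omega> in M. X 0 \<omega> = x"
proof -
  have "AE \<omega> in M. \<forall>t\<in>{0..<c}.
      (\<lambda>s. deriv \<psi> s / \<psi> s * X s \<omega>) absolutely_integrable_on {0..t} \<and>
      X t \<omega> = x + integral {0..t} (\<lambda>s. deriv \<psi> s / \<psi> s * X s \<omega>) + B t \<omega>"
    using assms(2) by (simp add: strong_solution_def)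
  then show ?thesis using brownian_motionD(4)[OF assms(1)]
    by eventually_elim (use assms(3) in auto)
qed

text \<open>The subdivisions of the n blocks are strung together into one increasing sequence w of
  times. The increments of B along w are independent, and each G j uses a block of indices disjoint
  from the others.\<close>

lemma brownian_block_sums:
  fixes T :: "nat \<Rightarrow> real" and k :: "real \<Rightarrow> real"
  assumes BM: "brownian_motion M B" and T0: "0 \<le> T 0" and T: "\<And>i. i < n \<Longrightarrow> T i < T (Suc i)"
    and m: "0 < m" and k: "\<And>j r. j < n \<Longrightarrow> T j \<le> r \<Longrightarrow> r \<le> T (Suc j) \<Longrightarrow> k r \<noteq> 0"
  defines "u \<equiv> \<lambda>j i. T j + real i * (T (Suc j) - T j) / real m"
  defines "G \<equiv> \<lambda>j \<omega>. \<Sum>i<m. k (u j i) * (B (u j (Suc i)) \<omega> - B (u j i) \<omega>)"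
  shows "prob_space.indep_vars M (\<lambda>_. borel) G {..<n}"
    and "\<And>j. j < n \<Longrightarrow> distributed M lborel (G j)
       (normal_density 0 (sqrt (\<Sum>i<m. (k (u j i))\<^sup>2 * ((T (Suc j) - T j) / real m))))"
proof -
  interpret prob_space M by (rule brownian_motionD[OF BM])
  define w where "w l = u (l div m) (l mod m)" for l
  define K where "K j = {j * m..<j * m + m}" for j
  have w: "w (j * m + i) = u j i" if "i < m" for i j using that m by (simp add: w_def)
  \<comment> \<open>At the last index of a block the successor belongs to the next block; both
    descriptions name the time T (j + 1).\<close>
  have wS: "w (Suc (j * m + i)) = u j (Suc i)" if "i < m" for i j
  proof (cases "Suc i < m")
    case True
    then show ?thesis using w[of "Suc i" j] by simp
  next
    case False
    then have "m = Suc i" using that by simp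
    then have "Suc (j * m + i) = Suc j * m + 0" by (simp add: algebra_simps)
    then have "w (Suc (j * m + i)) = w (Suc j * m + 0)" by (rule arg_cong)
    also have "\<dots> = u j (Suc i)" using m w[of 0 "Suc j"] \<open>m = Suc i\<close> by (simp add: u_def)
    finally show ?thesis .
  qed
  have ustep: "u j (Suc i) - u j i = (T (Suc j) - T j) / real m" for i j
    by (simp add: u_def add_divide_distrib distrib_right)
  have Tmono: "0 \<le> T j" if "j \<le> n" for j
    using increasing_upto_mono[of n T 0 j] T T0 that by simp
  have ub: "T j \<le> u j i" "i \<le> m \<Longrightarrow> u j i \<le> T (Suc j)" if "j < n" for i j
  proof -
    show "T j \<le> u j i" using T[OF that] by (simp add: u_def)
    assume "i \<le> m"
    then have "real i / real m * (T (Suc j) - T j) \<le> 1 * (T (Suc j) - T j)"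
      using T[OF that] m by (intro mult_right_mono) auto
    then show "u j i \<le> T (Suc j)" by (simp add: u_def)
  qed
  have in_block: "\<exists>j i. l = j * m + i \<and> i < m \<and> j < n" if "l < n * m" for l
    using that m by (intro exI[of _ "l div m"] exI[of _ "l mod m"]) (auto simp: less_mult_imp_div_less)
  have wpos: "0 \<le> w l" and wstep: "w l < w (Suc l)" if lnm: "l < n * m" for l
  proof -
    obtain j i where l: "l = j * m + i" "i < m" "j < n" using in_block[OF lnm] by blast
    show "0 \<le> w l" using ub(1)[OF l(3), of i] Tmono[OF less_imp_le[OF l(3)]] l by (simp add: w)
    have "0 < (T (Suc j) - T j) / real m" using T[OF l(3)] m by simp
    then show "w l < w (Suc l)" unfolding l(1) w[OF l(2)] wS[OF l(2)] using ustep[of j i] by linarith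
  qed
  have w0: "w 0 = T 0" using w[of 0 0] m by (simp add: u_def)
  define inc where "inc l \<omega> = B (w (Suc l)) \<omega> - B (w l) \<omega>" for l \<omega>
  have ind: "indep_vars (\<lambda>_. borel) inc {..<n * m}"
    unfolding inc_def using brownian_motionD(6)[OF BM, of w "n * m"] wstep T0 by (simp add: w0 less_imp_le)
  have Ksub: "K j \<subseteq> {..<n * m}" if "j < n" for j
  proof
    fix l assume "l \<in> K j"
    then have "l < Suc j * m" by (auto simp: K_def)
    also have "\<dots> \<le> n * m" using that by (intro mult_right_mono) auto
    finally show "l \<in> {..<n * m}" by simp
  qed
  have Kdis: "disjoint_family_on K {..<n}"
    unfolding disjoint_family_on_def
  proof (intro ballI impI)
    have "K a \<inter> K b = {}" if "a < b" for a b
    proof -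
      have "Suc a * m \<le> b * m" using that by (intro mult_right_mono) auto
      then show ?thesis by (auto simp: K_def)
    qed
    then show "K a \<inter> K b = {}" if "a \<noteq> b" for a b using that by (metis linorder_neqE_nat inf_commute)
  qed
  have Gsum: "G j \<omega> = (\<Sum>l\<in>K j. k (w l) * inc l \<omega>)" for j \<omega>
  proof -
    have "(\<Sum>l\<in>K j. k (w l) * inc l \<omega>) = (\<Sum>i<m. k (w (j * m + i)) * inc (j * m + i) \<omega>)"
      by (rule sum.reindex_bij_witness[of _ "\<lambda>i. j * m + i" "\<lambda>l. l - j * m"]) (auto simp: K_def)
    also have "\<dots> = G j \<omega>" unfolding G_def by (intro sum.cong) (auto simp: inc_def w wS)
    finally show ?thesis ..
  qed
  have "indep_vars (\<lambda>_. borel) (\<lambda>j \<omega>. (\<lambda>x. \<Sum>l\<in>K j. k (w l) * x l) (restrict (\<lambda>l. inc l \<omega>) (K j))) {..<n}"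
  proof (rule indep_vars_compose2[OF indep_vars_restrict[OF ind _ Kdis]])
    show "(\<lambda>x. \<Sum>l\<in>K j. k (w l) * x l) \<in> borel_measurable (Pi\<^sub>M (K j) (\<lambda>_. borel))" for j
      by measurable
  qed (use Ksub in auto)
  then show "indep_vars (\<lambda>_. borel) G {..<n}"
    by (rule indep_vars_cong[THEN iffD1, rotated -1]) (auto simp: Gsum fun_eq_iff)
  fix j assume j: "j < n"
  \<comment> \<open>Nonzero coefficients keep every summand nondegenerate, as the addition theorem
    for normal densities demands.\<close>
  have kw: "k (w l) \<noteq> 0" if "l \<in> K j" for l
  proof -
    have "l = j * m + (l - j * m)" "l - j * m < m" using that by (auto simp: K_def)
    then have "w l = u j (l - j * m)" using w[of "l - j * m" j] by simp
    then show ?thesis using k[OF j] ub[OF j] \<open>l - j * m < m\<close> by simp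
  qed
  have "distributed M lborel (\<lambda>\<omega>. \<Sum>l\<in>K j. k (w l) * inc l \<omega>)
     (normal_density (\<Sum>l\<in>K j. 0) (sqrt (\<Sum>l\<in>K j. (\<bar>k (w l)\<bar> * sqrt (w (Suc l) - w l))\<^sup>2)))"
  proof (rule sum_indep_normal)
    show "indep_vars (\<lambda>i. borel) (\<lambda>l \<omega>. k (w l) * inc l \<omega>) (K j)"
      using indep_vars_compose2[OF indep_vars_subset[OF ind Ksub[OF j]], of "\<lambda>l x. k (w l) * x" "\<lambda>_. borel"] by simp
    fix l assume l: "l \<in> K j"
    then have lt: "w l < w (Suc l)" "0 \<le> w l" using Ksub[OF j] wstep wpos by auto
    then show "0 < \<bar>k (w l)\<bar> * sqrt (w (Suc l) - w l)" using kw[OF l] by simp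
    have "distributed M lborel (inc l) (normal_density 0 (sqrt (w (Suc l) - w l)))"
      unfolding inc_def using brownian_motionD(5)[OF BM] lt by simp
    from normal_density_affine[OF this, of "k (w l)" 0]
    show "distributed M lborel (\<lambda>\<omega>. k (w l) * inc l \<omega>) (normal_density 0 (\<bar>k (w l)\<bar> * sqrt (w (Suc l) - w l)))"
      using kw[OF l] lt by simp
  qed (use m in \<open>auto simp: K_def\<close>)
  moreover have "(\<Sum>l\<in>K j. (\<bar>k (w l)\<bar> * sqrt (w (Suc l) - w l))\<^sup>2) = (\<Sum>i<m. (k (u j i))\<^sup>2 * ((T (Suc j) - T j) / real m))"
  proof -
    have "(\<Sum>l\<in>K j. (\<bar>k (w l)\<bar> * sqrt (w (Suc l) - w l))\<^sup>2) = (\<Sum>l\<in>K j. (k (w l))\<^sup>2 * (w (Suc l) - w l))"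
      using Ksub[OF j] wstep by (intro sum.cong) (auto simp: power_mult_distrib less_imp_le subset_eq)
    also have "\<dots> = (\<Sum>i<m. (k (w (j * m + i)))\<^sup>2 * (w (Suc (j * m + i)) - w (j * m + i)))"
      by (rule sum.reindex_bij_witness[of _ "\<lambda>i. j * m + i" "\<lambda>l. l - j * m"]) (auto simp: K_def)
    also have "\<dots> = (\<Sum>i<m. (k (u j i))\<^sup>2 * ((T (Suc j) - T j) / real m))"
      by (intro sum.cong) (auto simp: w wS ustep)
    finally show ?thesis .
  qed
  ultimately show "distributed M lborel (G j)
       (normal_density 0 (sqrt (\<Sum>i<m. (k (u j i))\<^sup>2 * ((T (Suc j) - T j) / real m))))"
    by (simp add: Gsum[abs_def])
qed

lemma subalgebra_augmented_filtration:
  assumes "brownian_motion M B"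
  shows "subalgebra M (augmented_filtration M B t)"
proof -
  have 1: "sets (natural_filtration (space M) B t) \<subseteq> sets M"
    unfolding natural_filtration_def using brownian_motionD(2)[OF assms]
    by (subst sets_measure_of) (auto intro!: sets.sigma_sets_subset measurable_sets)
  have "sets (augmented_filtration M B t) \<subseteq> sets M" unfolding augmented_filtration_def
    using 1 sets.sets_into_space[of _ M] by (subst sets_measure_of) (auto intro!: sets.sigma_sets_subset)
  then show ?thesis by (simp add: subalgebra_def augmented_filtration_def space_measure_of_conv)
qed

lemma strong_solution_measurable:
  assumes "brownian_motion M B" "strong_solution M B \<psi> c x X" "0 \<le> t" "t < c"
  shows "X t \<in> borel_measurable M"
proof -
  have "X t \<in> borel_measurable (augmented_filtration M B t)"
    using assms(2-4) unfolding strong_solution_def by simp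
  then show ?thesis by (rule measurable_from_subalg[OF subalgebra_augmented_filtration[OF assms(1)]])
qed

lemma continuous_on_half_open_interval:
  fixes f :: "real \<Rightarrow> 'a::topological_space"
  assumes "\<And>v. a \<le> v \<Longrightarrow> v < c \<Longrightarrow> continuous_on {a..v} f"
  shows "continuous_on {a..<c} f"
  unfolding continuous_on_eq_continuous_within
proof
  fix x assume x: "x \<in> {a..<c}"
  then obtain v where v: "x < v" "v < c" using dense[of x c] by auto
  have "continuous (at x within {a..v}) f"
    using assms[of v] v x by (auto simp: continuous_on_eq_continuous_within)
  moreover have "at x within {a..<c} = at x within {a..v}"
    by (rule at_within_nhd[of x "{..<v}"]) (use v x in auto)
  ultimately show "continuous (at x within {a..<c}) f" by (simp add: continuous_within)
qed

lemma tau_diff: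
  assumes cont: "continuous_on {0..<c} \<psi>" and nz: "\<And>t. t \<in> {0..<c} \<Longrightarrow> \<psi> t \<noteq> 0" and st: "0 \<le> s" "s \<le> t" "t < c"
  shows "tau \<psi> t - tau \<psi> s = integral {s..t} (\<lambda>r. 1 / (\<psi> r)\<^sup>2)"
proof -
  have "continuous_on {0..t} \<psi>" using cont by (rule continuous_on_subset) (use st in auto)
  then have "(\<lambda>r. 1 / (\<psi> r)\<^sup>2) integrable_on {0..t}"
    using nz st by (intro integrable_continuous_real continuous_intros) auto
  then show ?thesis unfolding tau_def
    using Henstock_Kurzweil_Integration.integral_combine[OF st(1,2)] by fastforce
qed

lemma tau_strict_mono:
  assumes cont: "continuous_on {0..<c} \<psi>" and nz: "\<And>t. t \<in> {0..<c} \<Longrightarrow> \<psi> t \<noteq> 0" and st: "0 \<le> s" "s < t" "t < c"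
  shows "tau \<psi> s < tau \<psi> t"
proof -
  have "continuous_on {s..t} \<psi>" using cont by (rule continuous_on_subset) (use st in auto)
  then have co: "continuous_on {s..t} (\<lambda>r. 1 / (\<psi> r)\<^sup>2)"
    using nz st by (intro continuous_intros) auto
  obtain z where z: "z \<in> {s..t}" "\<And>r. r \<in> {s..t} \<Longrightarrow> 1 / (\<psi> z)\<^sup>2 \<le> 1 / (\<psi> r)\<^sup>2"
    using continuous_attains_inf[OF _ _ co] st by auto
  have "0 < 1 / (\<psi> z)\<^sup>2 * (t - s)" using nz[of z] z st by simp
  also have "\<dots> = integral {s..t} (\<lambda>r. 1 / (\<psi> z)\<^sup>2)" using st by simp
  also have "\<dots> \<le> integral {s..t} (\<lambda>r. 1 / (\<psi> r)\<^sup>2)"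
    using z by (intro integral_le integrable_continuous_real co) auto
  also have "\<dots> = tau \<psi> t - tau \<psi> s" using tau_diff[OF cont nz st(1) _ st(3)] st by simp
  finally show ?thesis by simp
qed

text \<open>By the pathwise solution formula each D j is almost surely the limit of the block sums
  with k = 1/\<psi>. Their variances are Riemann sums of \<open>\<psi>\<^sup>-\<^sup>2\<close>,
  which is how tau enters; positive variance excludes atoms, so independence passes to the
  limit.\<close>

lemma solution_increments:
  fixes T :: "nat \<Rightarrow> real"
  assumes BM: "brownian_motion M B" and sol: "strong_solution M B \<psi> c x X"
    and ac: "\<And>v. 0 \<le> v \<Longrightarrow> v < c \<Longrightarrow> abs_cont 0 v \<psi>" and nz: "\<And>t. t \<in> {0..<c} \<Longrightarrow> \<psi> t \<noteq> 0"
    and T: "0 \<le> T 0" "\<And>i. i < n \<Longrightarrow> T i < T (Suc i)" "T n < c"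
  defines "D \<equiv> \<lambda>j \<omega>. X (T (Suc j)) \<omega> / \<psi> (T (Suc j)) - X (T j) \<omega> / \<psi> (T j)"
  shows "prob_space.indep_vars M (\<lambda>_. borel) D {..<n}"
    and "\<And>j. j < n \<Longrightarrow> distributed M lborel (D j) (normal_density 0 (sqrt (tau \<psi> (T (Suc j)) - tau \<psi> (T j))))"
proof -
  interpret prob_space M by (rule brownian_motionD[OF BM])
  have Tmono: "T i \<le> T j" if "i \<le> j" "j \<le> n" for i j
    using increasing_upto_mono[of n T i j] T(2) that by simp
  have Tb: "0 \<le> T j" "T j < c" if "j \<le> n" for j using Tmono[of 0 j] Tmono[of j n] T that by auto
  have cont: "continuous_on {0..<c} \<psi>"
    by (rule continuous_on_half_open_interval) (use ac abs_cont_imp_continuous in blast)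
  define k where "k r = 1 / \<psi> r" for r
  define u where "u m j i = T j + real i * (T (Suc j) - T j) / real m" for m j i :: nat
  define G where "G m j \<omega> = (\<Sum>i<m. k (u m j i) * (B (u m j (Suc i)) \<omega> - B (u m j i) \<omega>))" for m j \<omega>
  define \<sigma> where "\<sigma> m j = sqrt (\<Sum>i<m. (k (u m j i))\<^sup>2 * ((T (Suc j) - T j) / real m))" for m j
  have knz: "k r \<noteq> 0" if "j < n" "T j \<le> r" "r \<le> T (Suc j)" for j r
    using nz[of r] that Tb[of j] Tb[of "Suc j"] by (auto simp: k_def)
  have Gind: "indep_vars (\<lambda>_. borel) (G m) {..<n}" if "Suc 0 \<le> m" for m
    unfolding G_def[abs_def] u_def by (rule brownian_block_sums(1)[OF BM T(1,2) _ knz]) (use that in auto)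
  have Gdist: "distributed M lborel (G m j) (normal_density 0 (\<sigma> m j))" if "Suc 0 \<le> m" "j < n" for m j
    unfolding G_def[abs_def] u_def \<sigma>_def by (rule brownian_block_sums(2)[OF BM T(1,2) _ knz that(2)]) (use that in auto)
  have XM: "X (T j) \<in> borel_measurable M" if "j \<le> n" for j
    using strong_solution_measurable[OF BM sol] Tb[OF that] by blast
  have DM: "D j \<in> borel_measurable M" if "j < n" for j
  proof -
    have "X (T j) \<in> borel_measurable M" "X (T (Suc j)) \<in> borel_measurable M"
      using XM[of j] XM[of "Suc j"] that by auto
    then show ?thesis unfolding D_def by (intro borel_measurable_diff borel_measurable_divide) auto
  qed
  have lim: "AE \<omega> in M. (\<lambda>m. G m j \<omega>) \<longlonglongrightarrow> D j \<omega>" if j: "j < n" for j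
  proof -
    have "AE \<omega> in M. \<forall>t\<in>{0..<c}.
        (\<lambda>s. deriv \<psi> s / \<psi> s * X s \<omega>) absolutely_integrable_on {0..t} \<and>
        X t \<omega> = x + integral {0..t} (\<lambda>s. deriv \<psi> s / \<psi> s * X s \<omega>) + B t \<omega>"
      using sol by (simp add: strong_solution_def)
    then show ?thesis
      using AE_space
    proof eventually_elim
      case (elim \<omega>)
      let ?s = "T j" and ?t = "T (Suc j)"
      have st: "0 \<le> ?s" "?s \<le> ?t" "?t < c" using Tb[of j] Tb[of "Suc j"] T(2)[OF j] j by auto
      have act: "abs_cont 0 ?t \<psi>" using ac st by auto
      have D: "D j \<omega> = 1 / \<psi> ?t * B ?t \<omega> - 1 / \<psi> ?s * B ?s \<omega> - integral {?s..?t} (\<lambda>r. B r \<omega> * deriv (\<lambda>r. 1 / \<psi> r) r)"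
        unfolding D_def
        by (rule linear_equation_solution[OF act, where a=x])
          (use nz st elim(1)[rule_format, of ?t] elim(1) in auto)
      have "continuous_on {?s..?t} (\<lambda>t. B t \<omega>)"
        using brownian_motionD(3)[OF BM elim(2)] by (rule continuous_on_subset) (use st in auto)
      moreover have "abs_cont ?s ?t k" unfolding k_def
        by (rule abs_cont_subinterval[OF abs_cont_inverse[OF act]]) (use nz st in auto)
      ultimately have "(\<lambda>m. G m j \<omega>) \<longlonglongrightarrow> k ?t * B ?t \<omega> - k ?s * B ?s \<omega> - integral {?s..?t} (\<lambda>r. B r \<omega> * deriv k r)"
        unfolding G_def u_def by (intro stieltjes_sums_tendsto st)
      then show ?case unfolding D k_def[abs_def] .
    qed
  qed
  have spos: "0 < \<sigma> m j" if "Suc 0 \<le> m" "j < n" for m j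
  proof -
    have "0 < (\<Sum>i<m. (k (u m j i))\<^sup>2 * ((T (Suc j) - T j) / real m))"
    proof (rule sum_pos)
      fix i assume i: "i \<in> {..<m}"
      have "real i / real m * (T (Suc j) - T j) \<le> 1 * (T (Suc j) - T j)"
        using T(2)[OF that(2)] i by (intro mult_right_mono) auto
      then have "k (u m j i) \<noteq> 0" using T(2)[OF that(2)] by (intro knz[OF that(2)]) (auto simp: u_def)
      then show "0 < (k (u m j i))\<^sup>2 * ((T (Suc j) - T j) / real m)" using T(2)[OF that(2)] that by simp
    qed (use that in \<open>auto simp: lessThan_empty_iff\<close>)
    then show ?thesis by (simp add: \<sigma>_def)
  qed
  have dist: "distributed M lborel (D j) (normal_density 0 (sqrt (tau \<psi> (T (Suc j)) - tau \<psi> (T j))))" if j: "j < n" for j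
  proof (rule distributed_normal_limit[where N="Suc 0" and G="\<lambda>m. G m j" and \<sigma>="\<lambda>m. \<sigma> m j"])
    have st: "0 \<le> T j" "T j < T (Suc j)" "T (Suc j) < c" using Tb[of j] Tb[of "Suc j"] T(2)[OF j] j by auto
    show "0 < sqrt (tau \<psi> (T (Suc j)) - tau \<psi> (T j))" using tau_strict_mono[OF cont nz st] by simp
    have "continuous_on {T j..T (Suc j)} (\<lambda>r. (k r)\<^sup>2)" unfolding k_def
      using nz st by (intro continuous_intros continuous_on_subset[OF cont]) auto
    from riemann_sums_tendsto[OF less_imp_le[OF st(2)] this]
    have "(\<lambda>m. \<sigma> m j) \<longlonglongrightarrow> sqrt (integral {T j..T (Suc j)} (\<lambda>r. (k r)\<^sup>2))"
      unfolding \<sigma>_def u_def by (intro tendsto_intros)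
    then show "(\<lambda>m. \<sigma> m j) \<longlonglongrightarrow> sqrt (tau \<psi> (T (Suc j)) - tau \<psi> (T j))"
      using tau_diff[OF cont nz st(1) less_imp_le[OF st(2)] st(3)] by (simp add: k_def power_divide)
  qed (use Gdist spos lim DM j in auto)
  show "indep_vars (\<lambda>_. borel) D {..<n}"
    by (rule indep_vars_limit[where G=G and N="Suc 0"])
      (use Gind DM lim distributed_lborel_no_atom[OF dist] in auto)
  show "\<And>j. j < n \<Longrightarrow> distributed M lborel (D j) (normal_density 0 (sqrt (tau \<psi> (T (Suc j)) - tau \<psi> (T j))))"
    by (rule dist)
qed

section \<open>Transition densities\<close>

text \<open>The strict bound leaves the variable at time T n free for a test function; in this form
  the induction on n runs.\<close>

definition fdd_event :: "'w measure \<Rightarrow> (real \<Rightarrow> 'w \<Rightarrow> real) \<Rightarrow> (nat \<Rightarrow> real) \<Rightarrow> (nat \<Rightarrow> real set) \<Rightarrow> nat \<Rightarrow> 'w set" where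
  "fdd_event M X T A n = {\<omega> \<in> space M. \<forall>i<n. X (T i) \<omega> \<in> A i}"

lemma fdd_event_measurable:
  assumes "\<And>i. i < n \<Longrightarrow> X (T i) \<in> borel_measurable M" "\<And>i. i < n \<Longrightarrow> A i \<in> sets borel"
  shows "fdd_event M X T A n \<in> sets M"
proof -
  have "fdd_event M X T A n = space M \<inter> (\<Inter>i\<in>{..<n}. X (T i) -` A i \<inter> space M)" if "n \<noteq> 0"
    using that by (auto simp: fdd_event_def)
  moreover have "(\<Inter>i\<in>{..<n}. X (T i) -` A i \<inter> space M) \<in> sets M" if "n \<noteq> 0"
    using assms that by (intro sets.finite_INT) (auto intro!: measurable_sets simp: lessThan_empty_iff)
  ultimately show ?thesis by (cases "n = 0") (auto simp: fdd_event_def)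
qed

lemma normal_density_shift_scale:
  fixes g :: "real \<Rightarrow> ennreal"
  assumes [measurable]: "g \<in> borel_measurable borel" and s: "0 < \<sigma>" and a: "a \<noteq> 0"
  shows "(\<integral>\<^sup>+ d. g (m + a * d) * ennreal (normal_density 0 \<sigma> d) \<partial>lborel) =
    (\<integral>\<^sup>+ u. g u * ennreal (normal_density m (\<bar>a\<bar> * \<sigma>) u) \<partial>lborel)"
proof -
  have eq: "\<bar>a\<bar> * normal_density m (\<bar>a\<bar> * \<sigma>) (m + a * d) = normal_density 0 \<sigma> d" for d
    using s a by (simp add: normal_density_def real_sqrt_mult power_mult_distrib field_simps)
  have "(\<integral>\<^sup>+ u. g u * ennreal (normal_density m (\<bar>a\<bar> * \<sigma>) u) \<partial>lborel)
     = ennreal \<bar>a\<bar> * (\<integral>\<^sup>+ d. g (m + a * d) * ennreal (normal_density m (\<bar>a\<bar> * \<sigma>) (m + a * d)) \<partial>lborel)"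
    using a by (subst nn_integral_real_affine[of _ a m]) auto
  also have "\<dots> = (\<integral>\<^sup>+ d. g (m + a * d) * ennreal (\<bar>a\<bar> * normal_density m (\<bar>a\<bar> * \<sigma>) (m + a * d)) \<partial>lborel)"
    by (subst nn_integral_cmult[symmetric]) (auto intro!: nn_integral_cong simp: ennreal_mult' mult_ac)
  finally show ?thesis unfolding eq by simp
qed

text \<open>The past is a function of the increments D 0, ..., D (n - 1), and D n is independent of
  them. Fubini on the product of the two laws replaces conditional expectations, and an affine
  substitution turns the law of D n into the transition density.\<close>

lemma solution_markov:
  fixes T :: "nat \<Rightarrow> real" and g :: "real \<Rightarrow> ennreal"
  assumes BM: "brownian_motion M B" and sol: "strong_solution M B \<psi> c x X"
    and ac: "\<And>v. 0 \<le> v \<Longrightarrow> v < c \<Longrightarrow> abs_cont 0 v \<psi>" and nz: "\<And>t. t \<in> {0..<c} \<Longrightarrow> \<psi> t \<noteq> 0"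
    and T: "T 0 = 0" "\<And>i. i \<le> n \<Longrightarrow> T i < T (Suc i)" "T (Suc n) < c"
    and A: "\<And>i. A i \<in> sets borel" and g: "g \<in> borel_measurable borel"
  shows "(\<integral>\<^sup>+ \<omega>. indicator (fdd_event M X T A (Suc n)) \<omega> * g (X (T (Suc n)) \<omega>) \<partial>M) =
    (\<integral>\<^sup>+ \<omega>. indicator (fdd_event M X T A (Suc n)) \<omega> *
      (\<integral>\<^sup>+ u. g u * ennreal (normal_density (\<psi> (T (Suc n)) * X (T n) \<omega> / \<psi> (T n))
         (\<bar>\<psi> (T (Suc n))\<bar> * sqrt (tau \<psi> (T (Suc n)) - tau \<psi> (T n))) u) \<partial>lborel) \<partial>M)"
proof -
  interpret prob_space M by (rule brownian_motionD[OF BM])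
  note [measurable] = g A
  have Tmono: "T i \<le> T j" if "i \<le> j" "j \<le> Suc n" for i j
    using increasing_upto_mono[of "Suc n" T i j] T(2) that by simp
  have Tb: "0 \<le> T j" "T j < c" if "j \<le> Suc n" for j using Tmono[of 0 j] Tmono[of j "Suc n"] T that by auto
  have cont: "continuous_on {0..<c} \<psi>"
    by (rule continuous_on_half_open_interval) (use ac abs_cont_imp_continuous in blast)
  have p: "\<psi> (T j) \<noteq> 0" if "j \<le> Suc n" for j using nz Tb[OF that] by auto
  have XM: "X (T j) \<in> borel_measurable M" if "j \<le> Suc n" for j
    using strong_solution_measurable[OF BM sol] Tb[OF that] by blast
  define D where "D j \<omega> = X (T (Suc j)) \<omega> / \<psi> (T (Suc j)) - X (T j) \<omega> / \<psi> (T j)" for j \<omega>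
  define \<sigma> where "\<sigma> = sqrt (tau \<psi> (T (Suc n)) - tau \<psi> (T n))"
  have ind: "indep_vars (\<lambda>_. borel) D {..<Suc n}" unfolding D_def
    by (rule solution_increments(1)[OF BM sol ac nz]) (use T in auto)
  have dist: "distributed M lborel (D n) (normal_density 0 \<sigma>)" unfolding D_def \<sigma>_def
    by (rule solution_increments(2)[OF BM sol ac nz, where n="Suc n"]) (use T in auto)
  have \<sigma>: "0 < \<sigma>" unfolding \<sigma>_def using tau_strict_mono[OF cont nz, of "T n" "T (Suc n)"] T Tb[of n] by simp
  have Dn: "D n \<in> borel_measurable M" using dist by (simp add: distributed_def)
  let ?P = "Pi\<^sub>M {..<n} (\<lambda>_. borel :: real measure)"
  define V where "V \<omega> = restrict (\<lambda>j. D j \<omega>) {..<n}" for \<omega>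
  let ?P' = "Pi\<^sub>M {n} (\<lambda>_. borel :: real measure)"
  \<comment> \<open>The splitting of an independent family yields blocks of coordinates, so D n
    appears as a block of one.\<close>
  define W where "W \<omega> = restrict (\<lambda>j. D j \<omega>) {n}" for \<omega>
  have "indep_var ?P V ?P' W"
    using ind unfolding V_def W_def by (rule indep_var_restrict) auto
  then have V: "V \<in> measurable M ?P" and W: "W \<in> measurable M ?P'"
    and joint: "distr M ?P V \<Otimes>\<^sub>M distr M ?P' W = distr M (?P \<Otimes>\<^sub>M ?P') (\<lambda>\<omega>. (V \<omega>, W \<omega>))"
    by (auto simp: indep_var_distribution_eq)
  have Wn: "W \<omega> n = D n \<omega>" for \<omega> by (simp add: W_def)
  \<comment> \<open>This rebuilds X (T i) from the increments; it holds almost surely, since X 0 = x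
    does.\<close>
  define F where "F i v = \<psi> (T i) * (x / \<psi> (T 0) + (\<Sum>j<i. v j))" for i and v :: "nat \<Rightarrow> real"
  have Fm [measurable]: "F i \<in> borel_measurable ?P" if "i \<le> n" for i
    unfolding F_def using that by (intro borel_measurable_times borel_measurable_add borel_measurable_sum measurable_component_singleton) auto
  have Fn [measurable]: "F n \<in> borel_measurable ?P" by (rule Fm) simp
  define S where "S = {v \<in> space ?P. \<forall>i\<le>n. F i v \<in> A i}"
  have S [measurable]: "S \<in> sets ?P"
  proof -
    have "S = (\<Inter>i\<in>{..n}. F i -` A i \<inter> space ?P)" by (auto simp: S_def)
    then show ?thesis using Fm A by (auto intro!: sets.finite_INT measurable_sets)
  qed
  let ?t = "\<psi> (T (Suc n))" and ?s = "\<psi> (T n)"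
  define \<Phi> where "\<Phi> v d = indicator S v * g (?t * F n v / ?s + ?t * d)" for v d
  have \<Phi>m: "(\<lambda>(v, w). \<Phi> v (w n)) \<in> borel_measurable (?P \<Otimes>\<^sub>M ?P')" unfolding \<Phi>_def by measurable
  have tele: "(\<Sum>j<i. D j \<omega>) = X (T i) \<omega> / \<psi> (T i) - X (T 0) \<omega> / \<psi> (T 0)" for i \<omega>
    unfolding D_def by (rule sum_lessThan_telescope)
  have X0: "AE \<omega> in M. X 0 \<omega> = x"
    by (rule strong_solution_initial[OF BM sol]) (use T Tb[of 0] in auto)
  have key: "AE \<omega> in M. (\<forall>i\<le>n. X (T i) \<omega> = F i (V \<omega>)) \<and> X (T (Suc n)) \<omega> = ?t * F n (V \<omega>) / ?s + ?t * D n \<omega>"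
    using X0
  proof eventually_elim
    case (elim \<omega>)
    have 1: "X (T i) \<omega> = F i (V \<omega>)" if "i \<le> n" for i
    proof -
      have "(\<Sum>j<i. V \<omega> j) = (\<Sum>j<i. D j \<omega>)" using that by (intro sum.cong) (auto simp: V_def)
      then show ?thesis unfolding F_def tele using p[of i] that elim T(1) by (simp add: field_simps)
    qed
    have "X (T (Suc n)) \<omega> = ?t * X (T n) \<omega> / ?s + ?t * D n \<omega>"
      using p[of n] p[of "Suc n"] by (simp add: D_def field_simps)
    then show ?case using 1 by auto
  qed
  have ev: "indicator (fdd_event M X T A (Suc n)) \<omega> = (indicator S (V \<omega>) :: ennreal)"
    if "\<omega> \<in> space M" "\<forall>i\<le>n. X (T i) \<omega> = F i (V \<omega>)" for \<omega>
    using that measurable_space[OF V that(1)] by (auto simp: fdd_event_def S_def indicator_def less_Suc_eq_le)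
  have "(\<integral>\<^sup>+ \<omega>. indicator (fdd_event M X T A (Suc n)) \<omega> * g (X (T (Suc n)) \<omega>) \<partial>M) = (\<integral>\<^sup>+ \<omega>. \<Phi> (V \<omega>) (D n \<omega>) \<partial>M)"
  proof (rule nn_integral_cong_AE)
    show "AE \<omega> in M. indicator (fdd_event M X T A (Suc n)) \<omega> * g (X (T (Suc n)) \<omega>) = \<Phi> (V \<omega>) (D n \<omega>)"
      using key AE_space by eventually_elim (simp add: ev \<Phi>_def)
  qed
  also have "\<dots> = (\<integral>\<^sup>+ z. (case z of (v, w) \<Rightarrow> \<Phi> v (w n)) \<partial>(distr M ?P V \<Otimes>\<^sub>M distr M ?P' W))"
    unfolding joint using V W \<Phi>m by (subst nn_integral_distr) (auto simp: Wn)
  also have "\<dots> = (\<integral>\<^sup>+ v. (\<integral>\<^sup>+ w. \<Phi> v (w n) \<partial>distr M ?P' W) \<partial>distr M ?P V)"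
  proof -
    interpret W: prob_space "distr M ?P' W" by (rule prob_space_distr[OF W])
    show ?thesis using \<Phi>m by (subst W.nn_integral_fst[symmetric]) auto
  qed
  also have "\<dots> = (\<integral>\<^sup>+ v. (\<integral>\<^sup>+ d. \<Phi> v d \<partial>distr M borel (D n)) \<partial>distr M ?P V)"
  proof (rule nn_integral_cong)
    fix v
    have "\<Phi> v \<in> borel_measurable borel" unfolding \<Phi>_def by measurable
    then show "(\<integral>\<^sup>+ w. \<Phi> v (w n) \<partial>distr M ?P' W) = (\<integral>\<^sup>+ d. \<Phi> v d \<partial>distr M borel (D n))"
      using W Dn by (subst (1 2) nn_integral_distr) (auto simp: Wn)
  qed
  also have "\<dots> = (\<integral>\<^sup>+ v. indicator S v * (\<integral>\<^sup>+ u. g u * ennreal (normal_density (?t * F n v / ?s) (\<bar>?t\<bar> * \<sigma>) u) \<partial>lborel) \<partial>distr M ?P V)"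
  proof (intro nn_integral_cong)
    fix v
    have "distr M borel (D n) = density lborel (normal_density 0 \<sigma>)"
      using dist distr_cong[of M M borel lborel "D n" "D n"] by (simp add: distributed_def)
    then have "(\<integral>\<^sup>+ d. \<Phi> v d \<partial>distr M borel (D n)) = (\<integral>\<^sup>+ d. ennreal (normal_density 0 \<sigma> d) * \<Phi> v d \<partial>lborel)"
      unfolding \<Phi>_def by (simp only:) (subst nn_integral_density, auto)
    also have "\<dots> = indicator S v * (\<integral>\<^sup>+ d. g (?t * F n v / ?s + ?t * d) * ennreal (normal_density 0 \<sigma> d) \<partial>lborel)"
      unfolding \<Phi>_def by (subst nn_integral_cmult[symmetric]) (auto intro!: nn_integral_cong simp: mult_ac)
    finally show "(\<integral>\<^sup>+ d. \<Phi> v d \<partial>distr M borel (D n)) = indicator S v * (\<integral>\<^sup>+ u. g u * ennreal (normal_density (?t * F n v / ?s) (\<bar>?t\<bar> * \<sigma>) u) \<partial>lborel)"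
      using normal_density_shift_scale[OF g \<sigma>, of ?t] p[of "Suc n"] by simp
  qed
  also have "\<dots> = (\<integral>\<^sup>+ \<omega>. indicator S (V \<omega>) * (\<integral>\<^sup>+ u. g u * ennreal (normal_density (?t * F n (V \<omega>) / ?s) (\<bar>?t\<bar> * \<sigma>) u) \<partial>lborel) \<partial>M)"
    unfolding normal_density_def by (rule nn_integral_distr[OF V]) measurable
  also have "\<dots> = (\<integral>\<^sup>+ \<omega>. indicator (fdd_event M X T A (Suc n)) \<omega> *
      (\<integral>\<^sup>+ u. g u * ennreal (normal_density (?t * X (T n) \<omega> / ?s) (\<bar>?t\<bar> * \<sigma>) u) \<partial>lborel) \<partial>M)"
  proof (rule nn_integral_cong_AE)
    show "AE \<omega> in M. indicator S (V \<omega>) * (\<integral>\<^sup>+ u. g u * ennreal (normal_density (?t * F n (V \<omega>) / ?s) (\<bar>?t\<bar> * \<sigma>) u) \<partial>lborel) =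
      indicator (fdd_event M X T A (Suc n)) \<omega> * (\<integral>\<^sup>+ u. g u * ennreal (normal_density (?t * X (T n) \<omega> / ?s) (\<bar>?t\<bar> * \<sigma>) u) \<partial>lborel)"
      using key AE_space by eventually_elim (simp add: ev)
  qed
  finally show ?thesis unfolding \<sigma>_def .
qed

section \<open>Gaussian densities under the transform\<close>

text \<open>Here p, q are the values of \<phi>, and A, C those of \<alpha> + \<beta> tau, at the
  later and the earlier time; \<Delta> is the increment of tau. The terms in u y of the two
  exponents coincide, so the quotient of the densities splits into a function of u and one of y. The
  relation A - C = \<beta> \<Delta> then turns the coefficients of the squares into those of
  H.\<close>

lemma normal_density_h_transform:
  fixes \<alpha> \<beta> p q A C \<Delta> y u :: real
  assumes p: "p > 0" and q: "q > 0" and d: "\<Delta> > 0" and A: "\<alpha> * A > 0" and C: "\<alpha> * C > 0" and eq: "A = C + \<beta> * \<Delta>"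
  shows "normal_density (p * A * y / (q * C)) (\<bar>p * A\<bar> * sqrt (\<Delta> / (A * C))) u =
    normal_density (p * y / q) (\<bar>p\<bar> * sqrt \<Delta>) u *
     (sqrt (\<alpha> * p / (p * A)) * exp (\<beta> / 2 * (u\<^sup>2 / (p * (p * A)))) /
     (sqrt (\<alpha> * q / (q * C)) * exp (\<beta> / 2 * (y\<^sup>2 / (q * (q * C))))))"
proof -
  have nz: "A \<noteq> 0" "C \<noteq> 0" "\<alpha> \<noteq> 0" using A C by auto
  have AC: "A * C > 0" "A / C > 0" "C / A > 0"
    using A C by (auto simp: zero_less_mult_iff zero_less_divide_iff)
  have s1: "(\<bar>p * A\<bar> * sqrt (\<Delta> / (A * C)))\<^sup>2 = p\<^sup>2 * \<Delta> * (A / C)"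
    using AC d nz by (simp add: power_mult_distrib field_simps power2_eq_square)
  have s2: "(\<bar>p\<bar> * sqrt \<Delta>)\<^sup>2 = p\<^sup>2 * \<Delta>" using d by (simp add: power_mult_distrib)
  have pre: "sqrt (\<alpha> * p / (p * A)) / sqrt (\<alpha> * q / (q * C)) = sqrt (C / A)"
    using p q nz by (simp add: real_sqrt_divide[symmetric] field_simps)
  have pre2: "1 / sqrt (2 * pi * (p\<^sup>2 * \<Delta> * (A / C))) = 1 / sqrt (2 * pi * (p\<^sup>2 * \<Delta>)) * sqrt (C / A)"
    by (simp add: real_sqrt_mult real_sqrt_divide)
  \<comment> \<open>Eliminating \<beta> leaves an identity between rational functions.\<close>
  have b: "\<beta> = (A - C) / \<Delta>" using eq d by simp
  have ex: "- ((u - p * A * y / (q * C))\<^sup>2 / (2 * (p\<^sup>2 * \<Delta> * (A / C)))) =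
    - ((u - p * y / q)\<^sup>2 / (2 * (p\<^sup>2 * \<Delta>))) + (\<beta> / 2 * (u\<^sup>2 / (p * (p * A))) - \<beta> / 2 * (y\<^sup>2 / (q * (q * C))))"
    unfolding b using p q d nz by (simp add: divide_simps) algebra
  have "normal_density (p * A * y / (q * C)) (\<bar>p * A\<bar> * sqrt (\<Delta> / (A * C))) u =
    1 / sqrt (2 * pi * (p\<^sup>2 * \<Delta>)) * sqrt (C / A) *
    exp (- ((u - p * y / q)\<^sup>2 / (2 * (p\<^sup>2 * \<Delta>))) + (\<beta> / 2 * (u\<^sup>2 / (p * (p * A))) - \<beta> / 2 * (y\<^sup>2 / (q * (q * C)))))"
    unfolding normal_density_def s1 using ex pre2 by (simp only: minus_divide_left[symmetric])
  also have "\<dots> = 1 / sqrt (2 * pi * (p\<^sup>2 * \<Delta>)) * exp (- ((u - p * y / q)\<^sup>2 / (2 * (p\<^sup>2 * \<Delta>)))) *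
    (sqrt (C / A) * (exp (\<beta> / 2 * (u\<^sup>2 / (p * (p * A)))) / exp (\<beta> / 2 * (y\<^sup>2 / (q * (q * C))))))"
    by (simp only: exp_add exp_diff mult_ac)
  also have "\<dots> = normal_density (p * y / q) (\<bar>p\<bar> * sqrt \<Delta>) u *
     (sqrt (\<alpha> * p / (p * A)) * exp (\<beta> / 2 * (u\<^sup>2 / (p * (p * A)))) /
     (sqrt (\<alpha> * q / (q * C)) * exp (\<beta> / 2 * (y\<^sup>2 / (q * (q * C))))))"
    unfolding normal_density_def s2 pre[symmetric] by (simp only: times_divide_times_eq minus_divide_left)
  finally show ?thesis .
qed

locale pi_transform =
  fixes \<alpha> \<beta> a b :: real and \<phi> :: "real \<Rightarrow> real"
  assumes alpha: "\<alpha> \<noteq> 0"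
    and phi: "\<phi> \<in> class_A b a" "locally_absolutely_continuous b \<phi>" "\<phi> 0 = 1"
begin

abbreviation l :: real where "l \<equiv> ell \<alpha> \<beta> b a \<phi>"
abbreviation \<psi> :: "real \<Rightarrow> real" where "\<psi> \<equiv> Pi_trans \<alpha> \<beta> \<phi>"
abbreviation H :: "real \<Rightarrow> real \<Rightarrow> real" where "H \<equiv> H_fun \<alpha> \<beta> \<phi>"

lemma ab_pos: "0 < a" "0 < b" using phi(1) by (auto simp: class_A_def)

lemma phi_cont: "continuous_on {0..<b} \<phi>" using phi(1) by (auto simp: class_A_def)

text \<open>The value \<phi> 0 = 1 rules out the negative alternative in
  \<open>class_A\<close>.\<close>

lemma phi_pos: "t \<in> {0..<b} \<Longrightarrow> 0 < \<phi> t"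
  using phi(1,3) ab_pos by (auto simp: class_A_def dest: bspec[of _ _ 0])

lemma phi_nonzero: "t \<in> {0..<b} \<Longrightarrow> \<phi> t \<noteq> 0"
  using phi_pos by fastforce

lemma phi_ac: "0 \<le> v \<Longrightarrow> v < b \<Longrightarrow> abs_cont 0 v \<phi>"
  using phi(2) unfolding locally_absolutely_continuous_def
  by (auto intro: absolutely_continuous_fun_on_imp_abs_cont)

lemma tau_0 [simp]: "tau \<phi> 0 = 0" by (simp add: tau_def)

lemma tau_less: "0 \<le> s \<Longrightarrow> s < t \<Longrightarrow> t < b \<Longrightarrow> tau \<phi> s < tau \<phi> t"
  using tau_strict_mono[OF phi_cont] phi_pos by (metis less_irrefl)

lemma inverse_square_cont: "v < b \<Longrightarrow> continuous_on {0..v} (\<lambda>r. 1 / (\<phi> r)\<^sup>2)"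
  using phi_pos by (intro continuous_intros continuous_on_subset[OF phi_cont]) (auto simp: less_le)

lemma tau_ac: "v < b \<Longrightarrow> abs_cont 0 v (tau \<phi>)"
  unfolding tau_def by (intro abs_cont_indefinite_integral absolutely_integrable_continuous_real inverse_square_cont)

lemma tau_lt_a:
  assumes "0 \<le> t" "t < b"
  shows "tau \<phi> t < a"
proof -
  obtain t' where t': "t < t'" "t' < b" using dense assms by blast
  have "tau \<phi> t' \<le> a"
  proof (rule tendsto_lowerbound)
    show "(tau \<phi> \<longlongrightarrow> a) (at_left b)" using phi(1) by (auto simp: class_A_def)
    have "\<forall>\<^sub>F s in at_left b. t' < s \<and> s < b"
      using t' by (auto simp: eventually_at_left)
    then show "\<forall>\<^sub>F s in at_left b. tau \<phi> t' \<le> tau \<phi> s"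
      by eventually_elim (use t' assms tau_less in \<open>auto simp: less_imp_le\<close>)
  qed simp
  then show ?thesis using tau_less[of t t'] t' assms by simp
qed

lemma tau_nonneg: "0 \<le> t \<Longrightarrow> t < b \<Longrightarrow> 0 \<le> tau \<phi> t"
  using tau_less[of 0 t] by (cases "t = 0") auto

text \<open>The quantity \<alpha> (\<alpha> + \<beta> tau) is affine in tau and equals \<alpha>^2 >
  0 at time 0. If it is positive at tau = a, it is positive throughout. Otherwise \<alpha> \<beta> <
  0, its zero r = - \<alpha>/\<beta> lies in (0,a], and \<open>l\<close> is the time at which the
  clock reaches r.\<close>

lemma ell_bounds: "0 < l" "l \<le> b"
  and ell_sign: "\<And>t. 0 \<le> t \<Longrightarrow> t < l \<Longrightarrow> 0 < \<alpha> * (\<alpha> + \<beta> * tau \<phi> t)"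
proof -
  have "0 < l \<and> l \<le> b \<and> (\<forall>t. 0 \<le> t \<longrightarrow> t < l \<longrightarrow> 0 < \<alpha> * (\<alpha> + \<beta> * tau \<phi> t))"
  proof (cases "\<alpha> * (\<alpha> + \<beta> * a) > 0")
    case True
    have "0 < \<alpha> * (\<alpha> + \<beta> * tau \<phi> t)" if t: "0 \<le> t" "t < b" for t
    proof (cases "\<alpha> * \<beta> \<ge> 0")
      case True
      then have "0 \<le> \<alpha> * \<beta> * tau \<phi> t" using tau_nonneg[OF t] by simp
      moreover have "0 < \<alpha> * \<alpha>" using alpha by (metis not_real_square_gt_zero)
      ultimately show ?thesis by (simp add: algebra_simps add_pos_nonneg)
    next
      case False
      then have "\<alpha> * \<beta> * a \<le> \<alpha> * \<beta> * tau \<phi> t" using tau_lt_a[OF t] by (intro mult_left_mono_neg) auto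
      then show ?thesis using \<open>\<alpha> * (\<alpha> + \<beta> * a) > 0\<close> by (simp add: algebra_simps)
    qed
    then show ?thesis using True ab_pos by (simp add: ell_def)
  next
    case False
    have aa: "0 < \<alpha> * \<alpha>" using alpha by (metis not_real_square_gt_zero)
    have le: "\<alpha> * \<alpha> + \<alpha> * \<beta> * a \<le> 0" using False by (simp add: algebra_simps)
    then have "\<alpha> * \<beta> * a < 0" using aa by linarith
    then have neg: "\<alpha> * \<beta> < 0" using ab_pos(1) by (simp add: mult_less_0_iff)
    then have bnz: "\<beta> \<noteq> 0" by auto
    define r where "r = - (\<alpha> / \<beta>)"
    have r: "\<alpha> * \<beta> * r = - (\<alpha> * \<alpha>)" using bnz by (simp add: r_def)
    have r0: "0 < r"
    proof (rule ccontr)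
      assume "\<not> 0 < r"
      then have "0 \<le> \<alpha> * \<beta> * r" using neg by (intro mult_nonpos_nonpos) auto
      then show False using r aa by simp
    qed
    have ra: "r \<le> a"
    proof (rule ccontr)
      assume "\<not> r \<le> a"
      then have "\<alpha> * \<beta> * r < \<alpha> * \<beta> * a" using neg by (intro mult_strict_left_mono_neg) auto
      then show False using r le by simp
    qed
    let ?f = "(tau \<phi>)(b := a)"
    have less: "?f s < ?f t" if "0 \<le> s" "s < t" "t \<le> b" for s t
      using that tau_less[of s t] tau_lt_a[of s] by auto
    have inj: "inj_on ?f {0..b}"
      by (rule linorder_inj_onI) (use less in force)+
    have "\<exists>z\<in>{0..b}. ?f z = r"
    \<comment> \<open>For r = a the zero is met only at the end point, so that z = b; for r < a the
      intermediate value theorem provides z.\<close>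
    proof (cases "r = a")
      case True
      then show ?thesis using ab_pos by (intro bexI[of _ b]) auto
    next
      case False
      then have "\<forall>\<^sub>F s in at_left b. r < tau \<phi> s"
        using phi(1) ra by (intro order_tendstoD(1)[of _ a]) (auto simp: class_A_def)
      moreover have "\<forall>\<^sub>F s in at_left b. 0 < s \<and> s < b" using ab_pos by (auto simp: eventually_at_left)
      ultimately have "\<forall>\<^sub>F s in at_left b. r < tau \<phi> s \<and> 0 < s \<and> s < b" by eventually_elim auto
      then obtain s where s: "r < tau \<phi> s" "0 < s" "s < b"
        using eventually_happens[of _ "at_left b"] by auto
      obtain z where "0 \<le> z" "z \<le> s" "tau \<phi> z = r"
        using IVT'[of "tau \<phi>" 0 r s] s r0 abs_cont_imp_continuous[OF tau_ac[OF s(3)]] by auto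
      then show ?thesis using s by (intro bexI[of _ z]) auto
    qed
    then obtain z where z: "z \<in> {0..b}" "?f z = r" by blast
    have lz: "l = z"
      using False the_inv_into_f_f[OF inj z(1)] z(2) by (simp add: ell_def rho_tau_def r_def)
    have "z \<noteq> 0" using z(2) r0 ab_pos by auto
    moreover have "0 < \<alpha> * (\<alpha> + \<beta> * tau \<phi> t)" if t: "0 \<le> t" "t < z" for t
    proof -
      have "tau \<phi> t < r" using less[of t z] t z by auto
      then have "\<alpha> * \<beta> * r < \<alpha> * \<beta> * tau \<phi> t" using neg by (intro mult_strict_left_mono_neg) auto
      then show ?thesis using r by (simp add: algebra_simps)
    qed
    ultimately show ?thesis using z(1) lz by auto
  qed
  then show "0 < l" "l \<le> b" "\<And>t. 0 \<le> t \<Longrightarrow> t < l \<Longrightarrow> 0 < \<alpha> * (\<alpha> + \<beta> * tau \<phi> t)" by auto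
qed

lemma psi_nonzero: "t \<in> {0..<l} \<Longrightarrow> \<psi> t \<noteq> 0"
  using ell_sign[of t] phi_pos[of t] ell_bounds by (auto simp: Pi_trans_def)

lemma psi_ac: "0 \<le> v \<Longrightarrow> v < l \<Longrightarrow> abs_cont 0 v \<psi>"
  unfolding Pi_trans_def[abs_def] using ell_bounds
  by (intro abs_cont_mult abs_cont_add abs_cont_const phi_ac tau_ac) auto

text \<open>As a function of tau the right-hand side has derivative
  \<open>(\<alpha> + \<beta> * tau)\<^sup>-\<^sup>2\<close>; times
  \<open>\<phi>\<^sup>-\<^sup>2\<close>, the derivative of tau, this is
  \<open>\<psi>\<^sup>-\<^sup>2\<close>. Since \<phi> is continuous, the classical fundamental
  theorem applies.\<close>

lemma tau_psi:
  assumes t: "0 \<le> t" "t < l"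
  shows "tau \<psi> t = tau \<phi> t / (\<alpha> * (\<alpha> + \<beta> * tau \<phi> t))"
proof -
  let ?F = "\<lambda>t. tau \<phi> t / (\<alpha> * (\<alpha> + \<beta> * tau \<phi> t))"
  have tb: "t < b" using t ell_bounds by simp
  have "((\<lambda>s. 1 / (\<psi> s)\<^sup>2) has_integral ?F t - ?F 0) {0..t}"
  proof (rule fundamental_theorem_of_calculus[OF t(1)])
    fix s assume s: "s \<in> {0..t}"
    have d: "(tau \<phi> has_real_derivative 1 / (\<phi> s)\<^sup>2) (at s within {0..t})"
      unfolding tau_def by (rule integral_has_real_derivative[OF inverse_square_cont[OF tb] s])
    have pos: "0 < \<alpha> * (\<alpha> + \<beta> * tau \<phi> s)" using ell_sign[of s] s t by auto
    then have nz: "\<alpha> \<noteq> 0" "\<alpha> + \<beta> * tau \<phi> s \<noteq> 0" by auto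
    have p: "\<phi> s \<noteq> 0" using phi_pos[of s] s tb by auto
    have "(?F has_real_derivative
       ((1 / (\<phi> s)\<^sup>2) * (\<alpha> * (\<alpha> + \<beta> * tau \<phi> s)) - tau \<phi> s * (\<alpha> * (\<beta> * (1 / (\<phi> s)\<^sup>2)))) / ((\<alpha> * (\<alpha> + \<beta> * tau \<phi> s)) * (\<alpha> * (\<alpha> + \<beta> * tau \<phi> s)))) (at s within {0..t})"
      using nz by (auto intro!: derivative_eq_intros d)
    moreover have "((1 / (\<phi> s)\<^sup>2) * (\<alpha> * (\<alpha> + \<beta> * tau \<phi> s)) - tau \<phi> s * (\<alpha> * (\<beta> * (1 / (\<phi> s)\<^sup>2)))) / ((\<alpha> * (\<alpha> + \<beta> * tau \<phi> s)) * (\<alpha> * (\<alpha> + \<beta> * tau \<phi> s))) = 1 / (\<psi> s)\<^sup>2"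
      unfolding Pi_trans_def using nz p by (simp add: divide_simps) algebra
    ultimately show "(?F has_vector_derivative 1 / (\<psi> s)\<^sup>2) (at s within {0..t})"
      by (simp add: has_real_derivative_iff_has_vector_derivative)
  qed
  then show ?thesis by (simp add: tau_def[of \<psi>] integral_unique)
qed

lemma H_pos: "0 \<le> t \<Longrightarrow> t < l \<Longrightarrow> 0 < H t x"
  using ell_sign[of t] phi_pos[of t] ell_bounds alpha
  by (auto simp: H_fun_def Pi_trans_def zero_less_mult_iff zero_less_divide_iff)

lemma H_measurable [measurable]: "H t \<in> borel_measurable borel"
  unfolding H_fun_def by measurable

lemma transition_density_h_transform:
  assumes st: "0 \<le> s" "s < t" "t < l"
  shows "normal_density (\<psi> t * y / \<psi> s) (\<bar>\<psi> t\<bar> * sqrt (tau \<psi> t - tau \<psi> s)) u =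
    normal_density (\<phi> t * y / \<phi> s) (\<bar>\<phi> t\<bar> * sqrt (tau \<phi> t - tau \<phi> s)) u * (H t u / H s y)"
proof -
  let ?A = "\<alpha> + \<beta> * tau \<phi> t" and ?C = "\<alpha> + \<beta> * tau \<phi> s"
  have AC: "\<alpha> * ?A > 0" "\<alpha> * ?C > 0" using ell_sign st by auto
  then have nz: "\<alpha> \<noteq> 0" "?A \<noteq> 0" "?C \<noteq> 0" by auto
  have tau: "tau \<psi> t - tau \<psi> s = (tau \<phi> t - tau \<phi> s) / (?A * ?C)"
  proof -
    have "tau \<phi> t * (\<alpha> * ?C) - tau \<phi> s * (\<alpha> * ?A) = \<alpha> * (\<alpha> * (tau \<phi> t - tau \<phi> s))"
      by (simp add: algebra_simps)
    then have "tau \<psi> t - tau \<psi> s = \<alpha> * (\<alpha> * (tau \<phi> t - tau \<phi> s)) / (\<alpha> * ?A * (\<alpha> * ?C))"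
      using tau_psi[of t] tau_psi[of s] st nz by (simp add: diff_frac_eq)
    also have "\<dots> = (\<alpha> * \<alpha> * (tau \<phi> t - tau \<phi> s)) / (\<alpha> * \<alpha> * (?A * ?C))" by (simp only: mult_ac)
    also have "\<dots> = (tau \<phi> t - tau \<phi> s) / (?A * ?C)" using nz(1) by (intro mult_divide_mult_cancel_left) simp
    finally show ?thesis .
  qed
  have pos: "0 < tau \<phi> t - tau \<phi> s" "0 < \<phi> t" "0 < \<phi> s"
    using tau_less[OF st(1,2)] phi_pos[of t] phi_pos[of s] st ell_bounds by auto
  have "?A = ?C + \<beta> * (tau \<phi> t - tau \<phi> s)" by (simp add: algebra_simps)
  then show ?thesis
    unfolding tau unfolding H_fun_def Pi_trans_def by (rule normal_density_h_transform[OF pos(2,3,1) AC])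
qed

end

section \<open>Comparison of the finite-dimensional laws\<close>

text \<open>The two solutions share only their starting point: spaces, Brownian motions and horizons
  are separate. Y lives on [0,l) because \<psi> may vanish at l, while X runs up to b.\<close>

locale pi_transform_processes = pi_transform +
  fixes M :: "'w measure" and B :: "real \<Rightarrow> 'w \<Rightarrow> real" and X :: "real \<Rightarrow> 'w \<Rightarrow> real"
    and N :: "'v measure" and W :: "real \<Rightarrow> 'v \<Rightarrow> real" and Y :: "real \<Rightarrow> 'v \<Rightarrow> real" and x :: real
  assumes P_process: "brownian_motion M B" "strong_solution M B \<phi> b x X"
    and Q_process: "brownian_motion N W" "strong_solution N W \<psi> l x Y"
begin

lemma X_measurable: "0 \<le> t \<Longrightarrow> t < b \<Longrightarrow> X t \<in> borel_measurable M"
  by (rule strong_solution_measurable[OF P_process])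

text \<open>Induction on the number of times: integrating out the last step of Y leaves a test
  function at the previous time, so g must be arbitrary. The factors H t / H s of successive steps
  telescope to H (T n) / H 0.\<close>

lemma fdd_h_transform:
  fixes T :: "nat \<Rightarrow> real" and g :: "real \<Rightarrow> ennreal"
  assumes "T 0 = 0" "\<And>i. i < n \<Longrightarrow> T i < T (Suc i)" "T n < l"
    and A: "\<And>i. A i \<in> sets borel" and "g \<in> borel_measurable borel"
  shows "(\<integral>\<^sup>+ \<omega>. indicator (fdd_event N Y T A n) \<omega> * g (Y (T n) \<omega>) \<partial>N) =
    (\<integral>\<^sup>+ \<omega>. indicator (fdd_event M X T A n) \<omega> * (g (X (T n) \<omega>) * ennreal (H (T n) (X (T n) \<omega>) / H 0 x)) \<partial>M)"
  using assms(1-3,5)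
proof (induction n arbitrary: g)
  case 0
  interpret M: prob_space M by (rule brownian_motionD[OF P_process(1)])
  interpret N: prob_space N by (rule brownian_motionD[OF Q_process(1)])
  have "(\<integral>\<^sup>+ \<omega>. indicator (fdd_event N Y T A 0) \<omega> * g (Y (T 0) \<omega>) \<partial>N) = (\<integral>\<^sup>+ \<omega>. g x \<partial>N)"
    using strong_solution_initial[OF Q_process ell_bounds(1)] AE_space 0(1)
    by (intro nn_integral_cong_AE) (auto simp: fdd_event_def)
  also have "\<dots> = g x" by (simp add: N.emeasure_space_1)
  also have "\<dots> = (\<integral>\<^sup>+ \<omega>. g x \<partial>M)" by (simp add: M.emeasure_space_1)
  also have "\<dots> = (\<integral>\<^sup>+ \<omega>. indicator (fdd_event M X T A 0) \<omega> * (g (X (T 0) \<omega>) * ennreal (H (T 0) (X (T 0) \<omega>) / H 0 x)) \<partial>M)"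
    using strong_solution_initial[OF P_process ab_pos(2)] AE_space 0(1) H_pos[of 0 x] ell_bounds(1)
    by (intro nn_integral_cong_AE) (auto simp: fdd_event_def)
  finally show ?case .
next
  case (Suc n)
  note [measurable] = Suc.prems(4) A
  let ?s = "T n" and ?t = "T (Suc n)"
  have st: "0 \<le> ?s" "?s < ?t" "?t < l" 
    using increasing_upto_mono[of "Suc n" T 0 n] Suc.prems(1,2,3) by auto
  define pq where "pq y u = normal_density (\<psi> ?t * y / \<psi> ?s) (\<bar>\<psi> ?t\<bar> * sqrt (tau \<psi> ?t - tau \<psi> ?s)) u" for y u
  define pp where "pp y u = normal_density (\<phi> ?t * y / \<phi> ?s) (\<bar>\<phi> ?t\<bar> * sqrt (tau \<phi> ?t - tau \<phi> ?s)) u" for y u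
  have pqp: "pq y u = pp y u * (H ?t u / H ?s y)" for y u
    unfolding pq_def pp_def by (rule transition_density_h_transform[OF st])
  have [measurable]: "(\<lambda>(y, u). pq y u) \<in> borel_measurable (borel \<Otimes>\<^sub>M borel)"
    unfolding pq_def normal_density_def by measurable
  define k where "k y = (\<integral>\<^sup>+ u. g u * ennreal (pq y u) \<partial>lborel)" for y
  have km [measurable]: "k \<in> borel_measurable borel" unfolding k_def by measurable
  define h where "h u = g u * ennreal (H ?t u / H 0 x)" for u
  have hm: "h \<in> borel_measurable borel" unfolding h_def by measurable
  have ev: "indicator (fdd_event M' Z T A (Suc n)) \<omega> = (indicator (fdd_event M' Z T A n) \<omega> * indicator (A n) (Z ?s \<omega>) :: ennreal)"
    for M' :: "'z measure" and Z \<omega>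
    by (auto simp: fdd_event_def indicator_def less_Suc_eq)
  \<comment> \<open>The weight H s / H 0 from the induction hypothesis cancels the denominator of H
    t / H s, leaving the transition density of X with test function h.\<close>
  have kh: "k y * ennreal (H ?s y / H 0 x) = (\<integral>\<^sup>+ u. h u * ennreal (pp y u) \<partial>lborel)" for y
  proof -
    have "k y * ennreal (H ?s y / H 0 x) = (\<integral>\<^sup>+ u. g u * ennreal (pq y u) * ennreal (H ?s y / H 0 x) \<partial>lborel)"
      unfolding k_def by (rule nn_integral_multc[symmetric]) measurable
    also have "\<dots> = (\<integral>\<^sup>+ u. h u * ennreal (pp y u) \<partial>lborel)"
    proof (rule nn_integral_cong)
      fix u
      have H: "0 < H ?s y" "0 < H ?t u" "0 < H 0 x" using H_pos st ell_bounds by auto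
      have pp: "0 \<le> pp y u" unfolding pp_def by simp
      have "pq y u * (H ?s y / H 0 x) = (H ?t u / H 0 x) * pp y u" unfolding pqp using H by simp
      then have "ennreal (pq y u) * ennreal (H ?s y / H 0 x) = ennreal (H ?t u / H 0 x) * ennreal (pp y u)"
        using H pp by (simp add: ennreal_mult'[symmetric] ennreal_mult''[symmetric])
      then show "g u * ennreal (pq y u) * ennreal (H ?s y / H 0 x) = h u * ennreal (pp y u)"
        unfolding h_def by (simp add: mult.assoc)
    qed
    finally show ?thesis .
  qed
  have "(\<integral>\<^sup>+ \<omega>. indicator (fdd_event N Y T A (Suc n)) \<omega> * g (Y ?t \<omega>) \<partial>N) =
    (\<integral>\<^sup>+ \<omega>. indicator (fdd_event N Y T A (Suc n)) \<omega> * k (Y ?s \<omega>) \<partial>N)"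
    unfolding k_def pq_def
    by (rule solution_markov[OF Q_process psi_ac psi_nonzero]) (use Suc.prems A in auto)
  also have "\<dots> = (\<integral>\<^sup>+ \<omega>. indicator (fdd_event N Y T A n) \<omega> * (\<lambda>y. indicator (A n) y * k y) (Y ?s \<omega>) \<partial>N)"
    by (simp add: ev mult.assoc)
  \<comment> \<open>The induction hypothesis is used for the test function
    \<open>indicator (A n) y * k y\<close>, which absorbs the condition at time T n.\<close>
  also have "\<dots> = (\<integral>\<^sup>+ \<omega>. indicator (fdd_event M X T A n) \<omega> * ((\<lambda>y. indicator (A n) y * k y) (X ?s \<omega>) * ennreal (H ?s (X ?s \<omega>) / H 0 x)) \<partial>M)"
    by (rule Suc.IH) (use Suc.prems order_less_trans[OF st(2,3)] in auto)
  also have "\<dots> = (\<integral>\<^sup>+ \<omega>. indicator (fdd_event M X T A (Suc n)) \<omega> * (\<integral>\<^sup>+ u. h u * ennreal (pp (X ?s \<omega>) u) \<partial>lborel) \<partial>M)"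
    by (simp add: ev mult.assoc kh)
  also have "\<dots> = (\<integral>\<^sup>+ \<omega>. indicator (fdd_event M X T A (Suc n)) \<omega> * h (X ?t \<omega>) \<partial>M)"
    unfolding pp_def
    by (rule solution_markov[OF P_process phi_ac phi_nonzero, symmetric])
      (use Suc.prems A hm order_less_le_trans[OF st(3) ell_bounds(2)] in auto)
  finally show ?case by (simp add: h_def)
qed

end

section \<open>Laws on path space\<close>

lemma sets_natural_filtration:
  "sets (natural_filtration \<Omega> X t) = sigma_sets \<Omega> (\<Union>s\<in>{0..t}. {X s -` A \<inter> \<Omega> | A. A \<in> sets borel})"
  unfolding natural_filtration_def by (rule sets_measure_of) auto

lemma space_natural_filtration [simp]: "space (natural_filtration \<Omega> X t) = \<Omega>"
  by (simp add: natural_filtration_def space_measure_of_conv)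

lemma natural_filtration_measurable:
  assumes "0 \<le> s" "s \<le> t"
  shows "X s \<in> borel_measurable (natural_filtration \<Omega> X t)"
proof (rule measurableI)
  fix A :: "real set" assume "A \<in> sets borel"
  then show "X s -` A \<inter> space (natural_filtration \<Omega> X t) \<in> sets (natural_filtration \<Omega> X t)"
    unfolding sets_natural_filtration using assms
    by (intro sigma_sets.Basic UN_I[of s]) (auto simp: Int_def conj_commute)
qed simp

lemma subalgebra_natural_filtration:
  assumes "\<And>s. s \<in> {0..t} \<Longrightarrow> X s \<in> borel_measurable M"
  shows "subalgebra M (natural_filtration (space M) X t)"
  unfolding subalgebra_def sets_natural_filtration
  using assms by (auto intro!: sets.sigma_sets_subset measurable_sets)

lemma natural_filtration_mono:
  "s \<le> t \<Longrightarrow> sets (natural_filtration \<Omega> X s) \<subseteq> sets (natural_filtration \<Omega> X t)"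
  unfolding sets_natural_filtration by (rule sigma_sets_mono') fastforce

text \<open>Equality needs to be tested only on cylinder events along increasing times from 0 to t,
  the events that the transition densities handle. Any finite set of times is brought into this form
  by adding 0 and t with trivial conditions and sorting.\<close>

lemma natural_filtration_eqI:
  assumes t: "0 \<le> t" and \<mu>: "sets \<mu> = sets (natural_filtration \<Omega> X t)" and \<nu>: "sets \<nu> = sets (natural_filtration \<Omega> X t)"
    and fin: "emeasure \<mu> \<Omega> \<noteq> \<infinity>"
    and eq: "\<And>n T A. T 0 = 0 \<Longrightarrow> (\<And>i. i < n \<Longrightarrow> T i < T (Suc i)) \<Longrightarrow> T n = t \<Longrightarrow> (\<And>i. A i \<in> sets borel) \<Longrightarrow>
       emeasure \<mu> {\<omega>\<in>\<Omega>. \<forall>i<Suc n. X (T i) \<omega> \<in> A i} = emeasure \<nu> {\<omega>\<in>\<Omega>. \<forall>i<Suc n. X (T i) \<omega> \<in> A i}"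
  shows "\<mu> = \<nu>"
proof -
  define E where "E = {{\<omega>\<in>\<Omega>. \<forall>s\<in>J. X s \<omega> \<in> A s} | J A. finite J \<and> J \<subseteq> {0..t} \<and> (\<forall>s. A s \<in> sets borel)}"
  have EI: "{\<omega>\<in>\<Omega>. \<forall>s\<in>J. X s \<omega> \<in> A s} \<in> E" if "finite J" "J \<subseteq> {0..t}" "\<And>s. A s \<in> sets borel" for J A
    unfolding E_def using that by blast
  have sig: "sigma_sets \<Omega> (\<Union>s\<in>{0..t}. {X s -` A \<inter> \<Omega> | A. A \<in> sets borel}) = sigma_sets \<Omega> E"
  proof (rule sigma_sets_eqI)
    fix a assume "a \<in> (\<Union>s\<in>{0..t}. {X s -` A \<inter> \<Omega> | A. A \<in> sets borel})"
    then obtain s A where s: "s \<in> {0..t}" "A \<in> sets borel" "a = X s -` A \<inter> \<Omega>" by auto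
    then have "a = {\<omega>\<in>\<Omega>. \<forall>r\<in>{s}. X r \<omega> \<in> A}" by auto
    also have "\<dots> \<in> E" using s by (intro EI) auto
    finally show "a \<in> sigma_sets \<Omega> E" by (rule sigma_sets.Basic)
  next
    fix b assume "b \<in> E"
    then obtain J A where J: "finite J" "J \<subseteq> {0..t}" "\<And>s. A s \<in> sets borel" "b = {\<omega>\<in>\<Omega>. \<forall>s\<in>J. X s \<omega> \<in> A s}"
      unfolding E_def by blast
    have "{\<omega> \<in> space (natural_filtration \<Omega> X t). \<forall>s\<in>J. X s \<omega> \<in> A s} \<in> sets (natural_filtration \<Omega> X t)"
    proof (rule sets.sets_Collect_finite_All)
      fix s assume "s \<in> J"
      then have "X s -` A s \<inter> space (natural_filtration \<Omega> X t) \<in> sets (natural_filtration \<Omega> X t)"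
        using natural_filtration_measurable[of s t X \<Omega>] J by (intro measurable_sets) auto
      then show "{\<omega> \<in> space (natural_filtration \<Omega> X t). X s \<omega> \<in> A s} \<in> sets (natural_filtration \<Omega> X t)"
        by (simp add: vimage_def Int_def conj_commute)
    qed (rule J)
    then show "b \<in> sigma_sets \<Omega> (\<Union>s\<in>{0..t}. {X s -` A \<inter> \<Omega> | A. A \<in> sets borel})"
      using J(4) by (simp add: sets_natural_filtration)
  qed
  show ?thesis
  proof (rule measure_eqI_generator_eq[where E=E and \<Omega>=\<Omega> and A="\<lambda>_. \<Omega>"])
    show "sets \<mu> = sigma_sets \<Omega> E" "sets \<nu> = sigma_sets \<Omega> E" using \<mu> \<nu> sig by (simp_all add: sets_natural_filtration)
    show "E \<subseteq> Pow \<Omega>" by (auto simp: E_def)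
    have "\<Omega> \<in> E" using EI[of "{}" "\<lambda>_. UNIV"] by simp
    then show "range (\<lambda>_::nat. \<Omega>) \<subseteq> E" by auto
    show "Int_stable E"
      unfolding Int_stable_def
    proof (intro ballI)
      fix c d assume "c \<in> E" "d \<in> E"
      then obtain J A K C where J: "finite J" "J \<subseteq> {0..t}" "\<And>s. A s \<in> sets borel" "c = {\<omega>\<in>\<Omega>. \<forall>s\<in>J. X s \<omega> \<in> A s}"
        and K: "finite K" "K \<subseteq> {0..t}" "\<And>s. C s \<in> sets borel" "d = {\<omega>\<in>\<Omega>. \<forall>s\<in>K. X s \<omega> \<in> C s}"
        unfolding E_def by blast
      \<comment> \<open>At a common time both conditions are imposed; at a time of only one of the
        events the other contributes \<open>UNIV\<close>.\<close>
      have "c \<inter> d = {\<omega>\<in>\<Omega>. \<forall>s\<in>J \<union> K. X s \<omega> \<in> (if s \<in> J then A s else UNIV) \<inter> (if s \<in> K then C s else UNIV)}"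
        unfolding J(4) K(4) by auto
      also have "\<dots> \<in> E" using J K by (intro EI) auto
      finally show "c \<inter> d \<in> E" .
    qed
    fix b assume "b \<in> E"
    then obtain J A where J: "finite J" "J \<subseteq> {0..t}" "\<And>s. A s \<in> sets borel" "b = {\<omega>\<in>\<Omega>. \<forall>s\<in>J. X s \<omega> \<in> A s}"
      unfolding E_def by blast
    define J' where "J' = insert 0 (insert t J)"
    have J': "finite J'" "J' \<noteq> {}" "J' \<subseteq> {0..t}" using J t by (auto simp: J'_def)
    define xs where "xs = sorted_list_of_set J'"
    have xs: "set xs = J'" "sorted_wrt (<) xs" using J' by (auto simp: xs_def)
    then have xs0: "xs \<noteq> []" using J' by auto
    define n where "n = length xs - 1"
    have len: "length xs = Suc n" using xs0 by (simp add: n_def)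
    define T where "T i = xs ! i" for i
    have TS: "T i < T (Suc i)" if "i < n" for i
      using xs(2) that len by (auto simp: T_def sorted_wrt_iff_nth_less)
    have Tle: "T i \<le> T j" if "i \<le> j" "j \<le> n" for i j
      using xs(2) that len by (cases "i = j") (auto simp: T_def sorted_wrt_iff_nth_less intro: less_imp_le)
    have Timg: "\<exists>i\<le>n. T i = s" if "s \<in> J'" for s
      using that xs(1) len by (auto simp: T_def in_set_conv_nth less_Suc_eq_le)
    have TJ: "T i \<in> J'" if "i \<le> n" for i using that xs(1) len by (auto simp: T_def)
    have T0: "T 0 = 0"
    proof -
      obtain i where "i \<le> n" "T i = 0" using Timg[of 0] by (auto simp: J'_def)
      then have "T 0 \<le> 0" using Tle[of 0 i] by simp
      moreover have "T 0 \<in> {0..t}" using TJ[of 0] J'(3) by blast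
      ultimately show ?thesis by simp
    qed
    have Tn: "T n = t"
    proof -
      obtain i where "i \<le> n" "T i = t" using Timg[of t] by (auto simp: J'_def)
      then have "t \<le> T n" using Tle[of i n] by simp
      moreover have "T n \<in> {0..t}" using TJ[of n] J'(3) by blast
      ultimately show ?thesis by simp
    qed
    define C where "C i = (if T i \<in> J then A (T i) else UNIV)" for i
    have "b = {\<omega>\<in>\<Omega>. \<forall>i<Suc n. X (T i) \<omega> \<in> C i}"
    proof -
      have "(\<forall>s\<in>J. X s \<omega> \<in> A s) \<longleftrightarrow> (\<forall>i<Suc n. X (T i) \<omega> \<in> C i)" for \<omega>
      proof
        assume *: "\<forall>i<Suc n. X (T i) \<omega> \<in> C i"
        show "\<forall>s\<in>J. X s \<omega> \<in> A s"
        proof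
          fix s assume "s \<in> J"
          then obtain i where "i \<le> n" "T i = s" using Timg[of s] by (auto simp: J'_def)
          then show "X s \<omega> \<in> A s" using * \<open>s \<in> J\<close> by (auto simp: C_def less_Suc_eq_le)
        qed
      qed (auto simp: C_def)
      then show ?thesis unfolding J(4) by auto
    qed
    then show "emeasure \<mu> b = emeasure \<nu> b" using eq[OF T0 TS Tn, of C] J(3) by (auto simp: C_def)
  qed (use fin in auto)
qed

lemma space_path_space: "space (path_space c) = {\<omega> \<in> extensional {0..<c}. continuous_on {0..<c} \<omega>}"
  by (auto simp: path_space_def space_restrict_space space_PiM PiE_def)

lemma path_space_coordinate [measurable]: "t \<in> {0..<c} \<Longrightarrow> (\<lambda>\<omega>. \<omega> t) \<in> borel_measurable (path_space c)"
  unfolding path_space_def by (intro measurable_restrict_space1 measurable_component_singleton)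

lemma measurable_path_space:
  assumes "\<And>t. t \<in> {0..<c} \<Longrightarrow> X t \<in> borel_measurable M" "\<And>\<omega>. \<omega> \<in> space M \<Longrightarrow> continuous_on {0..<c} (\<lambda>t. X t \<omega>)"
  shows "(\<lambda>\<omega>. \<lambda>t\<in>{0..<c}. X t \<omega>) \<in> measurable M (path_space c)"
  unfolding path_space_def
proof (rule measurable_restrict_space2)
  show "(\<lambda>\<omega>. \<lambda>t\<in>{0..<c}. X t \<omega>) \<in> measurable M (Pi\<^sub>M {0..<c} (\<lambda>_. borel))"
    using assms(1) by (rule measurable_restrict)
  show "(\<lambda>\<omega>. \<lambda>t\<in>{0..<c}. X t \<omega>) \<in> space M \<rightarrow> {\<omega>. continuous_on {0..<c} \<omega>}"
  proof
    fix \<omega> assume \<omega>: "\<omega> \<in> space M"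
    have "continuous_on {0..<c} (\<lambda>t\<in>{0..<c}. X t \<omega>) \<longleftrightarrow> continuous_on {0..<c} (\<lambda>t. X t \<omega>)"
      by (rule continuous_on_cong) auto
    then show "(\<lambda>t\<in>{0..<c}. X t \<omega>) \<in> {\<omega>. continuous_on {0..<c} \<omega>}" using assms(2)[OF \<omega>] by simp
  qed
qed

lemma measurable_path_restrict:
  assumes "c \<le> b"
  shows "(\<lambda>\<omega>. restrict \<omega> {0..<c}) \<in> measurable (path_space b) (path_space c)"
  by (rule measurable_path_space) (use assms in \<open>auto simp: space_path_space intro: continuous_on_subset\<close>)

lemma subalgebra_path_filtration: "t < c \<Longrightarrow> subalgebra (path_space c) (path_filtration c t)"
  unfolding path_filtration_def by (rule subalgebra_natural_filtration) auto

lemma path_filtration_coordinate: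
  "0 \<le> s \<Longrightarrow> s \<le> t \<Longrightarrow> (\<lambda>\<omega>. \<omega> s) \<in> borel_measurable (path_filtration c t)"
  unfolding path_filtration_def using natural_filtration_measurable[of s t "\<lambda>t \<omega>. \<omega> t"] by simp

lemma strong_solution_path_measurable:
  assumes "brownian_motion M B" "strong_solution M B \<psi> c x X"
  shows "(\<lambda>\<omega>. \<lambda>t\<in>{0..<c}. X t \<omega>) \<in> measurable M (path_space c)"
  by (rule measurable_path_space)
    (use strong_solution_measurable[OF assms] assms(2) in \<open>auto simp: strong_solution_def\<close>)

section \<open>Absolute continuity and the martingale property\<close>

context pi_transform_processes
begin

lemma X_path: "(\<lambda>\<omega>. \<lambda>t\<in>{0..<b}. X t \<omega>) \<in> measurable M (path_space b)"
  by (rule strong_solution_path_measurable[OF P_process])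

lemma Y_path: "(\<lambda>\<omega>. \<lambda>t\<in>{0..<l}. Y t \<omega>) \<in> measurable N (path_space l)"
  by (rule strong_solution_path_measurable[OF Q_process])

lemma X_path_short: "(\<lambda>\<omega>. \<lambda>t\<in>{0..<l}. X t \<omega>) \<in> measurable M (path_space l)"
  by (rule measurable_path_space)
    (use X_measurable ell_bounds P_process(2) in \<open>auto simp: strong_solution_def intro: continuous_on_subset\<close>)

abbreviation P :: "(real \<Rightarrow> real) measure" where "P \<equiv> path_law M b X"
abbreviation P' :: "(real \<Rightarrow> real) measure" where "P' \<equiv> shorten_law l P"
abbreviation Q :: "(real \<Rightarrow> real) measure" where "Q \<equiv> path_law N l Y"

lemma shorten_P: "P' = path_law M l X"
proof -
  have "P' = distr M (path_space l) ((\<lambda>\<omega>. restrict \<omega> {0..<l}) \<circ> (\<lambda>\<omega>. \<lambda>t\<in>{0..<b}. X t \<omega>))"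
    unfolding shorten_law_def path_law_def
    by (rule distr_distr[OF measurable_path_restrict[OF ell_bounds(2)] X_path])
  also have "(\<lambda>\<omega>. restrict \<omega> {0..<l}) \<circ> (\<lambda>\<omega>. \<lambda>t\<in>{0..<b}. X t \<omega>) = (\<lambda>\<omega>. \<lambda>t\<in>{0..<l}. X t \<omega>)"
    using ell_bounds(2) by (auto simp: fun_eq_iff restrict_def)
  finally show ?thesis by (simp only: path_law_def)
qed

lemma prob_P: "prob_space P" and prob_P': "prob_space P'" and prob_Q: "prob_space Q"
  unfolding shorten_P unfolding path_law_def
  using brownian_motionD(1)[OF P_process(1)] brownian_motionD(1)[OF Q_process(1)] X_path X_path_short Y_path
  by (auto intro: prob_space.prob_space_distr)

lemma sets_laws [simp, measurable_cong]: "sets P = sets (path_space b)" "sets P' = sets (path_space l)" "sets Q = sets (path_space l)"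
  by (simp_all add: path_law_def shorten_law_def)

lemma space_laws [simp]: "space P = space (path_space b)" "space P' = space (path_space l)" "space Q = space (path_space l)"
  by (simp_all add: path_law_def shorten_law_def)

lemma nn_integral_path_law:
  assumes Z: "(\<lambda>\<omega>. \<lambda>t\<in>{0..<c}. Z t \<omega>) \<in> measurable M' (path_space c)"
    and T: "\<And>i. i < n \<Longrightarrow> 0 \<le> T i \<and> T i < c" and A: "\<And>i. A i \<in> sets borel"
    and g: "g \<in> borel_measurable borel" and t: "0 \<le> t" "t < c"
  shows "(\<integral>\<^sup>+ \<omega>. indicator {\<omega> \<in> space (path_space c). \<forall>i<n. \<omega> (T i) \<in> A i} \<omega> * g (\<omega> t) \<partial>path_law M' c Z) =
    (\<integral>\<^sup>+ \<omega>. indicator (fdd_event M' Z T A n) \<omega> * g (Z t \<omega>) \<partial>M')"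
proof -
  have "{\<omega> \<in> space (path_space c). \<forall>i<n. \<omega> (T i) \<in> A i} = fdd_event (path_space c) (\<lambda>t \<omega>. \<omega> t) T A n"
    by (simp add: fdd_event_def)
  also have "\<dots> \<in> sets (path_space c)" using T A by (intro fdd_event_measurable) auto
  finally have E: "{\<omega> \<in> space (path_space c). \<forall>i<n. \<omega> (T i) \<in> A i} \<in> sets (path_space c)" .
  have co: "(\<lambda>\<omega>. \<omega> t) \<in> borel_measurable (path_space c)" by (rule path_space_coordinate) (use t in simp)
  define f where "f \<omega> = indicator {\<omega> \<in> space (path_space c). \<forall>i<n. \<omega> (T i) \<in> A i} \<omega> * g (\<omega> t)" for \<omega>
  have fm: "f \<in> borel_measurable (path_space c)" unfolding f_def
    by (intro borel_measurable_times_ennreal borel_measurable_indicator E measurable_compose[OF co g])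
  have "(\<integral>\<^sup>+ \<omega>. f \<omega> \<partial>path_law M' c Z) = (\<integral>\<^sup>+ \<omega>. f (\<lambda>t\<in>{0..<c}. Z t \<omega>) \<partial>M')"
    unfolding path_law_def by (rule nn_integral_distr[OF Z]) (use fm in simp)
  also have "\<dots> = (\<integral>\<^sup>+ \<omega>. indicator (fdd_event M' Z T A n) \<omega> * g (Z t \<omega>) \<partial>M')"
    using T t measurable_space[OF Z] by (intro nn_integral_cong) (auto simp: fdd_event_def indicator_def f_def)
  finally show ?thesis by (simp add: f_def)
qed

end

context pi_transform_processes
begin

text \<open>The condition at the last time T n is passed as the test function, which closes the gap
  between n and n + 1 conditions.\<close>

lemma fdd_h_transform_event:
  assumes T: "T 0 = 0" "\<And>i. i < n \<Longrightarrow> T i < T (Suc i)" "T n < l" and A: "\<And>i. A i \<in> sets borel"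
  shows "(\<integral>\<^sup>+ \<omega>. indicator (fdd_event N Y T A (Suc n)) \<omega> * 1 \<partial>N) =
    (\<integral>\<^sup>+ \<omega>. indicator (fdd_event M X T A (Suc n)) \<omega> * ennreal (H (T n) (X (T n) \<omega>) / H 0 x) \<partial>M)"
proof -
  have ev: "indicator (fdd_event M' Z T A (Suc n)) \<omega> = (indicator (fdd_event M' Z T A n) \<omega> * indicator (A n) (Z (T n) \<omega>) :: ennreal)"
    for M' :: "'z measure" and Z \<omega>
    by (auto simp: fdd_event_def indicator_def less_Suc_eq)
  have "(\<integral>\<^sup>+ \<omega>. indicator (fdd_event N Y T A n) \<omega> * indicator (A n) (Y (T n) \<omega>) \<partial>N) =
    (\<integral>\<^sup>+ \<omega>. indicator (fdd_event M X T A n) \<omega> * (indicator (A n) (X (T n) \<omega>) * ennreal (H (T n) (X (T n) \<omega>) / H 0 x)) \<partial>M)"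
    by (rule fdd_h_transform[OF T A]) (use A in auto)
  then show ?thesis by (simp add: ev mult.assoc)
qed

lemma increasing_times_bounds:
  fixes T :: "nat \<Rightarrow> real"
  assumes "T 0 = 0" "\<And>i. i < n \<Longrightarrow> T i < T (Suc i)" "i \<le> n"
  shows "0 \<le> T i" "T i \<le> T n"
  using increasing_upto_mono[of n T 0 i] increasing_upto_mono[of n T i n] assms by auto

lemma path_event_measurable:
  fixes T :: "nat \<Rightarrow> real"
  assumes "\<And>i. i < n \<Longrightarrow> 0 \<le> T i \<and> T i \<le> t" "\<And>i. A i \<in> sets borel"
  shows "{\<omega> \<in> space (path_space c). \<forall>i<n. \<omega> (T i) \<in> A i} \<in> sets (path_filtration c t)"
proof -
  have "{\<omega> \<in> space (path_space c). \<forall>i<n. \<omega> (T i) \<in> A i} = fdd_event (path_filtration c t) (\<lambda>t \<omega>. \<omega> t) T A n"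
    by (simp add: fdd_event_def path_filtration_def)
  also have "\<dots> \<in> sets (path_filtration c t)"
    using assms by (intro fdd_event_measurable path_filtration_coordinate) auto
  finally show ?thesis .
qed

lemma subalgebra_P: "t < b \<Longrightarrow> subalgebra P (path_filtration b t)"
  and subalgebra_P': "t < l \<Longrightarrow> subalgebra P' (path_filtration l t)"
  and subalgebra_Q: "t < l \<Longrightarrow> subalgebra Q (path_filtration l t)"
  using subalgebra_path_filtration[of t] by (auto simp: subalgebra_def)

lemma H_coordinate_measurable:
  "0 \<le> s \<Longrightarrow> s \<le> t \<Longrightarrow> (\<lambda>\<omega>. H s (\<omega> s)) \<in> borel_measurable (path_filtration c t)"
  by (rule measurable_compose[OF path_filtration_coordinate H_measurable])

lemma H_ratio_measurable:
  "0 \<le> s \<Longrightarrow> s \<le> t \<Longrightarrow> (\<lambda>\<omega>. ennreal (H s (\<omega> s) / H 0 x)) \<in> borel_measurable (path_filtration c t)"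
  using H_coordinate_measurable[of s t] by (intro measurable_compose[OF _ measurable_ennreal] borel_measurable_divide) auto

theorem density_relation:
  assumes t: "0 \<le> t" "t < l"
  shows "restr_to_subalg Q (path_filtration l t) =
    density (restr_to_subalg P' (path_filtration l t)) (\<lambda>\<omega>. ennreal (H t (\<omega> t) / H 0 x))"
proof -
  let ?F = "path_filtration l t" and ?h = "\<lambda>\<omega>. ennreal (H t (\<omega> t) / H 0 x)"
  note sP = subalgebra_P'[OF t(2)] and sQ = subalgebra_Q[OF t(2)]
  have hF: "?h \<in> borel_measurable ?F" by (rule H_ratio_measurable) (use t in auto)
  show ?thesis
  proof (rule natural_filtration_eqI[OF t(1), where \<Omega>="space (path_space l)" and X="\<lambda>t \<omega>. \<omega> t", folded path_filtration_def])
    show "sets (restr_to_subalg Q ?F) = sets ?F" by (rule sets_restr_to_subalg[OF sQ])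
    show "sets (density (restr_to_subalg P' ?F) ?h) = sets ?F" using sets_restr_to_subalg[OF sP] by simp
    have "space (path_space l) \<in> sets ?F" using sets.top[of ?F] by (simp add: path_filtration_def)
    then have "emeasure (restr_to_subalg Q ?F) (space (path_space l)) = emeasure Q (space Q)"
      using emeasure_restr_to_subalg[OF sQ] by simp
    then show "emeasure (restr_to_subalg Q ?F) (space (path_space l)) \<noteq> \<infinity>"
      using prob_space.emeasure_space_1[OF prob_Q] by simp
  next
    fix n T A
    assume T: "T 0 = 0" "\<And>i. i < n \<Longrightarrow> T i < T (Suc i)" "T n = t" and A: "\<And>i::nat. A i \<in> sets (borel :: real measure)"
    define E where "E = {\<omega> \<in> space (path_space l). \<forall>i<Suc n. \<omega> (T i) \<in> A i}"
    have Tb: "0 \<le> T i \<and> T i \<le> t" if "i < Suc n" for i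
      using increasing_times_bounds[of T n i] T that by auto
    have Tl: "0 \<le> T i \<and> T i < l" if "i < Suc n" for i using Tb[OF that] t by auto
    have E: "E \<in> sets ?F" unfolding E_def by (rule path_event_measurable[OF Tb A])
    have EQ: "E \<in> sets Q" "E \<in> sets P'" using E sQ sP unfolding subalgebra_def by blast+
    have "emeasure (restr_to_subalg Q ?F) E = emeasure Q E" by (rule emeasure_restr_to_subalg[OF sQ E])
    also have "\<dots> = (\<integral>\<^sup>+ \<omega>. indicator E \<omega> * 1 \<partial>Q)" by (simp only: mult_1_right nn_integral_indicator[OF EQ(1)])
    also have "\<dots> = (\<integral>\<^sup>+ \<omega>. indicator (fdd_event N Y T A (Suc n)) \<omega> * 1 \<partial>N)"
      unfolding E_def by (rule nn_integral_path_law[OF Y_path Tl A _ t]) auto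
    also have "\<dots> = (\<integral>\<^sup>+ \<omega>. indicator (fdd_event M X T A (Suc n)) \<omega> * ennreal (H t (X t \<omega>) / H 0 x) \<partial>M)"
      using fdd_h_transform_event[of T n A] T A t by simp
    also have "\<dots> = (\<integral>\<^sup>+ \<omega>. indicator E \<omega> * ennreal (H t (\<omega> t) / H 0 x) \<partial>P')"
      unfolding shorten_P E_def by (rule nn_integral_path_law[OF X_path_short Tl A _ t, symmetric]) auto
    also have "\<dots> = (\<integral>\<^sup>+ \<omega>. indicator E \<omega> * ennreal (H t (\<omega> t) / H 0 x) \<partial>restr_to_subalg P' ?F)"
      using E hF by (intro nn_integral_subalgebra2[OF sP, symmetric]) auto
    also have "\<dots> = emeasure (density (restr_to_subalg P' ?F) ?h) E"
      using E hF sets_restr_to_subalg[OF sP] measurable_in_subalg[OF sP hF]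
      by (subst emeasure_density) (auto simp: mult.commute)
    finally show "emeasure (restr_to_subalg Q ?F) {\<omega> \<in> space (path_space l). \<forall>i<Suc n. \<omega> (T i) \<in> A i}
      = emeasure (density (restr_to_subalg P' ?F) ?h) {\<omega> \<in> space (path_space l). \<forall>i<Suc n. \<omega> (T i) \<in> A i}"
      unfolding E_def .
  qed
qed

text \<open>For a cylinder event with times up to s, the integral of H r / H 0 is the probability of
  the corresponding event for Y, whatever r in [s,l) is chosen. The martingale property is thus the
  consistency of the law of Y. It is shown on the original horizon b, where the filtration of X
  lives.\<close>

lemma nn_martingale:
  assumes st: "0 \<le> s" "s \<le> t" "t < l" and C: "C \<in> sets (path_filtration b s)"
  shows "(\<integral>\<^sup>+ \<omega>. indicator C \<omega> * ennreal (H t (\<omega> t) / H 0 x) \<partial>P) = (\<integral>\<^sup>+ \<omega>. indicator C \<omega> * ennreal (H s (\<omega> s) / H 0 x) \<partial>P)"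
    and "(\<integral>\<^sup>+ \<omega>. ennreal (H t (\<omega> t) / H 0 x) \<partial>P) = 1"
proof -
  let ?F = "path_filtration b s" and ?h = "\<lambda>t \<omega>. ennreal (H t (\<omega> t) / H 0 x)"
  have sb: "s < b" "t < b" using st ell_bounds by auto
  note sP = subalgebra_P[OF sb(1)] and tP = subalgebra_P[OF sb(2)]
  have hF: "?h s \<in> borel_measurable ?F" by (rule H_ratio_measurable) (use st in auto)
  have ht: "?h t \<in> borel_measurable P"
    by (rule measurable_from_subalg[OF tP H_ratio_measurable]) (use st in auto)
  have hs: "?h s \<in> borel_measurable P" by (rule measurable_from_subalg[OF sP hF])
  have sD: "subalgebra (density P (?h t)) ?F" using sP by (simp add: subalgebra_def)
  have FP: "E \<in> sets P" if "E \<in> sets ?F" for E using that sP unfolding subalgebra_def by blast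
  have em1: "emeasure (density (restr_to_subalg P ?F) (?h s)) E = (\<integral>\<^sup>+ \<omega>. indicator E \<omega> * ?h s \<omega> \<partial>P)" if E: "E \<in> sets ?F" for E
  proof -
    have "(\<integral>\<^sup>+ \<omega>. indicator E \<omega> * ?h s \<omega> \<partial>P) = (\<integral>\<^sup>+ \<omega>. indicator E \<omega> * ?h s \<omega> \<partial>restr_to_subalg P ?F)"
      using E hF by (intro nn_integral_subalgebra2[OF sP, symmetric]) auto
    then show ?thesis
      using E sets_restr_to_subalg[OF sP] measurable_in_subalg[OF sP hF]
      by (subst emeasure_density) (auto simp: mult.commute)
  qed
  have em2: "emeasure (restr_to_subalg (density P (?h t)) ?F) E = (\<integral>\<^sup>+ \<omega>. indicator E \<omega> * ?h t \<omega> \<partial>P)" if E: "E \<in> sets ?F" for E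
    unfolding emeasure_restr_to_subalg[OF sD E] using ht FP[OF E] by (subst emeasure_density) (auto simp: mult.commute)
  have key: "(\<integral>\<^sup>+ \<omega>. indicator {\<omega> \<in> space (path_space b). \<forall>i<Suc n. \<omega> (T i) \<in> A i} \<omega> * ?h r \<omega> \<partial>P)
      = (\<integral>\<^sup>+ \<omega>. indicator (fdd_event N Y T A (Suc n)) \<omega> * 1 \<partial>N)"
    if r: "s \<le> r" "r < l" and T: "T 0 = 0" "\<And>i. i < n \<Longrightarrow> T i < T (Suc i)" "T n = s" and A: "\<And>i. A i \<in> sets borel" for r n T A
  proof -
    have Tb: "0 \<le> T i \<and> T i < b" if "i < Suc n" for i
      using increasing_times_bounds[of T n i] T sb that by auto
    have "(\<integral>\<^sup>+ \<omega>. indicator {\<omega> \<in> space (path_space b). \<forall>i<Suc n. \<omega> (T i) \<in> A i} \<omega> * ?h r \<omega> \<partial>P)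
      = (\<integral>\<^sup>+ \<omega>. indicator (fdd_event M X T A (Suc n)) \<omega> * ennreal (H r (X r \<omega>) / H 0 x) \<partial>M)"
      by (rule nn_integral_path_law[OF X_path Tb A]) (use st r ell_bounds in auto)
    also have "\<dots> = (\<integral>\<^sup>+ \<omega>. indicator (fdd_event N Y T A (Suc n)) \<omega> * 1 \<partial>N)"
    proof (cases "r = s")
      case True
      then show ?thesis using fdd_h_transform_event[of T n A] T A r by simp
    next
      case False
      \<comment> \<open>For r > s the grid is prolonged by the time r, at which no condition is
        imposed and the test function is 1.\<close>
      define T' where "T' = T(Suc n := r)"
      have ev: "fdd_event M' Z T A (Suc n) = fdd_event M' Z T' A (Suc n)" for M' :: "'z measure" and Z
        by (simp add: fdd_event_def T'_def)
      have T': "T' 0 = 0" "\<And>i. i < Suc n \<Longrightarrow> T' i < T' (Suc i)" "T' (Suc n) < l"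
        using T r False by (auto simp: T'_def less_Suc_eq)
      show ?thesis
        using fdd_h_transform[of T' "Suc n" A "\<lambda>_. 1", OF T' A] unfolding ev by (simp add: T'_def)
    qed
    finally show ?thesis .
  qed
  have total: "(\<integral>\<^sup>+ \<omega>. ?h t \<omega> \<partial>P) = 1"
  proof -
    have "(\<integral>\<^sup>+ \<omega>. ?h t \<omega> \<partial>P) = (\<integral>\<^sup>+ \<omega>. indicator {\<omega> \<in> space (path_space b). \<forall>i<(0::nat). \<omega> (0::real) \<in> (UNIV :: real set)} \<omega> * ?h t \<omega> \<partial>P)"
      by (intro nn_integral_cong) auto
    also have "\<dots> = (\<integral>\<^sup>+ \<omega>. indicator (fdd_event M X (\<lambda>i. if i = 0 then 0 else t) (\<lambda>_. UNIV) 0) \<omega> * ennreal (H t (X t \<omega>) / H 0 x) \<partial>M)"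
      using nn_integral_path_law[OF X_path, of 0 "\<lambda>_. 0" "\<lambda>_. UNIV" "\<lambda>u. ennreal (H t u / H 0 x)" t] st sb
      by (simp add: fdd_event_def)
    also have "\<dots> = 1"
    \<comment> \<open>Grids start at 0 and increase strictly, so a single time serves for t = 0 and
      the pair 0, t otherwise.\<close>
    proof (cases "t = 0")
      case True
      then show ?thesis
        using fdd_h_transform[of "\<lambda>_. 0" 0 "\<lambda>_. UNIV" "\<lambda>_. 1"] ell_bounds
        by (simp add: fdd_event_def prob_space.emeasure_space_1[OF brownian_motionD(1)[OF Q_process(1)]])
    next
      case False
      then show ?thesis
        using fdd_h_transform[of "\<lambda>i. if i = 0 then 0 else t" "Suc 0" "\<lambda>_. UNIV" "\<lambda>_. 1"] st
        by (simp add: fdd_event_def prob_space.emeasure_space_1[OF brownian_motionD(1)[OF Q_process(1)]])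
    qed
    finally show ?thesis .
  qed
  then show "(\<integral>\<^sup>+ \<omega>. ?h t \<omega> \<partial>P) = 1" .
  have "restr_to_subalg (density P (?h t)) ?F = density (restr_to_subalg P ?F) (?h s)"
  proof (rule natural_filtration_eqI[OF st(1), where \<Omega>="space (path_space b)" and X="\<lambda>t \<omega>. \<omega> t", folded path_filtration_def])
    show "sets (restr_to_subalg (density P (?h t)) ?F) = sets ?F" by (rule sets_restr_to_subalg[OF sD])
    show "sets (density (restr_to_subalg P ?F) (?h s)) = sets ?F" using sets_restr_to_subalg[OF sP] by simp
    have sp: "space (path_space b) \<in> sets ?F" using sets.top[of ?F] by (simp add: path_filtration_def)
    have "emeasure (restr_to_subalg (density P (?h t)) ?F) (space (path_space b)) = (\<integral>\<^sup>+ \<omega>. ?h t \<omega> \<partial>P)"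
      unfolding em2[OF sp] by (intro nn_integral_cong) auto
    then show "emeasure (restr_to_subalg (density P (?h t)) ?F) (space (path_space b)) \<noteq> \<infinity>" using total by simp
  next
    fix n T A
    assume T: "T 0 = 0" "\<And>i. i < n \<Longrightarrow> T i < T (Suc i)" "T n = s" and A: "\<And>i::nat. A i \<in> sets (borel :: real measure)"
    let ?E = "{\<omega> \<in> space (path_space b). \<forall>i<Suc n. \<omega> (T i) \<in> A i}"
    have Tb: "0 \<le> T i \<and> T i \<le> s" if "i < Suc n" for i
      using increasing_times_bounds[of T n i] T that by auto
    have E: "?E \<in> sets ?F" by (rule path_event_measurable[OF Tb A])
    show "emeasure (restr_to_subalg (density P (?h t)) ?F) ?E = emeasure (density (restr_to_subalg P ?F) (?h s)) ?E"
      unfolding em1[OF E] em2[OF E] using key[OF st(2,3) T A] key[OF order_refl _ T A] st by simp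
  qed
  then show "(\<integral>\<^sup>+ \<omega>. indicator C \<omega> * ?h t \<omega> \<partial>P) = (\<integral>\<^sup>+ \<omega>. indicator C \<omega> * ?h s \<omega> \<partial>P)"
    using em1[OF C] em2[OF C] by simp
qed

text \<open>The identities for nonnegative integrals carry over to conditional expectations because
  the integral of H t equals H 0 x, which is finite.\<close>

theorem H_martingale: "martingale P (path_filtration b) l (\<lambda>t \<omega>. H t (\<omega> t))"
proof -
  have H0: "0 < H 0 x" using H_pos[of 0 x] ell_bounds by simp
  have HM: "(\<lambda>\<omega>. H t (\<omega> t)) \<in> borel_measurable P" if "0 \<le> t" "t < l" for t
    by (rule measurable_from_subalg[OF subalgebra_P[of t] H_coordinate_measurable]) (use that ell_bounds in auto)
  have nn: "(\<integral>\<^sup>+ \<omega>. ennreal (indicator C \<omega> * H t (\<omega> t)) \<partial>P) = ennreal (H 0 x) * (\<integral>\<^sup>+ \<omega>. indicator C \<omega> * ennreal (H t (\<omega> t) / H 0 x) \<partial>P)"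
    if t: "0 \<le> t" "t < l" and C: "C \<in> sets P" for t C
  proof -
    have "ennreal (indicator C \<omega> * H t (\<omega> t)) = ennreal (H 0 x) * (indicator C \<omega> * ennreal (H t (\<omega> t) / H 0 x))" for \<omega>
      using H0 H_pos[OF t, of "\<omega> t"] by (cases "\<omega> \<in> C") (auto simp: ennreal_mult'[symmetric])
    then show ?thesis using HM[OF t] C by (simp add: nn_integral_cmult)
  qed
  have int: "integrable P (\<lambda>\<omega>. H t (\<omega> t))" if t: "0 \<le> t" "t < l" for t
  proof (rule integrableI_nn_integral_finite[where x="H 0 x"])
    have "(\<integral>\<^sup>+ \<omega>. ennreal (H t (\<omega> t)) \<partial>P) = (\<integral>\<^sup>+ \<omega>. ennreal (indicator (space P) \<omega> * H t (\<omega> t)) \<partial>P)"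
      by (intro nn_integral_cong) auto
    also have "\<dots> = ennreal (H 0 x) * (\<integral>\<^sup>+ \<omega>. ennreal (H t (\<omega> t) / H 0 x) \<partial>P)"
      unfolding nn[OF t sets.top] by (intro arg_cong2[where f="(*)"] refl nn_integral_cong) auto
    finally show "(\<integral>\<^sup>+ \<omega>. ennreal (H t (\<omega> t)) \<partial>P) = ennreal (H 0 x)"
      using nn_martingale(2)[OF t(1) order_refl t(2), of "{}"] by simp
  qed (use HM[OF t] H_pos[OF t] in \<open>auto simp: less_imp_le\<close>)
  show ?thesis unfolding martingale_def
  proof (intro conjI ballI allI impI)
    fix t assume t: "t \<in> {0..<l}"
    then show "subalgebra P (path_filtration b t)" using subalgebra_P ell_bounds by simp
    show "(\<lambda>\<omega>. H t (\<omega> t)) \<in> borel_measurable (path_filtration b t)" using H_coordinate_measurable t by simp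
    show "integrable P (\<lambda>\<omega>. H t (\<omega> t))" using int t by simp
  next
    fix s t assume st: "0 \<le> s" "s \<le> t" "t < l"
    have sb: "s < b" using st ell_bounds by auto
    interpret P: prob_space P by (rule prob_P)
    have "finite_measure_subalgebra P (path_filtration b s)"
      by unfold_locales (rule subalgebra_P[OF sb])
    then interpret sigma_finite_subalgebra P "path_filtration b s"
      by (rule finite_measure_subalgebra_is_sigma_finite)
    show "AE \<omega> in P. real_cond_exp P (path_filtration b s) (\<lambda>\<omega>. H t (\<omega> t)) \<omega> = H s (\<omega> s)"
    proof (rule real_cond_exp_charact)
      show "integrable P (\<lambda>\<omega>. H t (\<omega> t))" "integrable P (\<lambda>\<omega>. H s (\<omega> s))" using int st by auto
      show "(\<lambda>\<omega>. H s (\<omega> s)) \<in> borel_measurable (path_filtration b s)" using H_coordinate_measurable st by simp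
      fix C assume C: "C \<in> sets (path_filtration b s)"
      then have CP: "C \<in> sets P" using subalgebra_P[OF sb] unfolding subalgebra_def by blast
      have eq: "(LINT \<omega>:C|P. H r (\<omega> r)) = enn2real (\<integral>\<^sup>+ \<omega>. ennreal (indicator C \<omega> * H r (\<omega> r)) \<partial>P)" if r: "0 \<le> r" "r < l" for r
        unfolding set_lebesgue_integral_def using HM[OF r] CP H_pos[OF r]
        by (subst integral_eq_nn_integral) (auto simp: less_imp_le indicator_def)
      show "(LINT \<omega>:C|P. H t (\<omega> t)) = (LINT \<omega>:C|P. H s (\<omega> s))"
        using nn_martingale(1)[OF st C] nn[OF _ _ CP, of t] nn[OF _ _ CP, of s] st eq[of t] eq[of s] by simp
    qed
  qed
qed

end

section \<open>Hitting times\<close>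

lemma hitting_time_less_iff:
  "hitting_time c y \<omega> < z \<longleftrightarrow> (\<exists>t. 0 < t \<and> t < c \<and> ereal t < z \<and> \<omega> t = y)"
  unfolding hitting_time_def Inf_less_iff by auto

lemma hitting_time_nonneg: "0 \<le> hitting_time c y \<omega>"
  unfolding hitting_time_def by (rule Inf_greatest) auto

text \<open>A hit becomes a countable condition: on a compact interval |f - y| attains its infimum,
  and that infimum is 0 as soon as rational times make it arbitrarily small. Rational times inside
  [p,q] are close to every point of it because p < q.\<close>

lemma continuous_hits_iff:
  fixes f :: "real \<Rightarrow> real"
  assumes f: "continuous_on {p..q} f" and pq: "p < q"
  shows "(\<exists>s\<in>{p..q}. f s = y) \<longleftrightarrow> (\<forall>m::nat. \<exists>r::rat. real_of_rat r \<in> {p..q} \<and> \<bar>f (real_of_rat r) - y\<bar> < 1 / real (Suc m))"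
proof
  assume "\<exists>s\<in>{p..q}. f s = y"
  then obtain s where s: "s \<in> {p..q}" "f s = y" by auto
  show "\<forall>m::nat. \<exists>r::rat. real_of_rat r \<in> {p..q} \<and> \<bar>f (real_of_rat r) - y\<bar> < 1 / real (Suc m)"
  proof
    fix m :: nat
    have "0 < 1 / real (Suc m)" by simp
    then obtain d where d: "d > 0" "\<And>r. r \<in> {p..q} \<Longrightarrow> dist r s < d \<Longrightarrow> dist (f r) (f s) < 1 / real (Suc m)"
      using f s(1) unfolding continuous_on_iff by blast
    have "max p (s - d) < min q (s + d)" using s pq d(1) by auto
    then obtain r where "max p (s - d) < real_of_rat r" "real_of_rat r < min q (s + d)" using of_rat_dense by blast
    then have "real_of_rat r \<in> {p..q}" "dist (real_of_rat r) s < d" by (auto simp: dist_real_def)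
    then show "\<exists>r::rat. real_of_rat r \<in> {p..q} \<and> \<bar>f (real_of_rat r) - y\<bar> < 1 / real (Suc m)"
      using d(2)[of "real_of_rat r"] s(2) by (auto simp: dist_real_def)
  qed
next
  assume R: "\<forall>m::nat. \<exists>r::rat. real_of_rat r \<in> {p..q} \<and> \<bar>f (real_of_rat r) - y\<bar> < 1 / real (Suc m)"
  have "continuous_on {p..q} (\<lambda>s. \<bar>f s - y\<bar>)" using f by (intro continuous_intros)
  then obtain s where s: "s \<in> {p..q}" "\<And>r. r \<in> {p..q} \<Longrightarrow> \<bar>f s - y\<bar> \<le> \<bar>f r - y\<bar>"
    using continuous_attains_inf[of "{p..q}" "\<lambda>s. \<bar>f s - y\<bar>"] pq by auto
  have "\<bar>f s - y\<bar> = 0"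
  proof (rule ccontr)
    assume "\<bar>f s - y\<bar> \<noteq> 0"
    then obtain m where m: "1 / real (Suc m) < \<bar>f s - y\<bar>" using nat_approx_posE[of "\<bar>f s - y\<bar>"] by auto
    then show False using R s(2) by (meson less_trans not_less)
  qed
  then show "\<exists>s\<in>{p..q}. f s = y" using s(1) by auto
qed

text \<open>The inequality is strict, so the event depends only on the path in the open interval
  (0,a), which is exhausted by compact intervals. It therefore belongs to the filtration at time a
  itself, without a right limit.\<close>

lemma hitting_event_measurable:
  assumes a: "0 < a" "a < c"
  shows "{\<omega> \<in> space (path_space c). hitting_time c y \<omega> < ereal a} \<in> sets (path_filtration c a)"
proof -
  \<comment> \<open>The shift by 3 gives 2 p n < a, so that each of the intervals has positive
    length.\<close>
  define p where "p n = a / real (n + 3)" for n :: nat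
  have p: "0 < p n" "p n < a - p n" for n
  proof -
    show "0 < p n" using a by (simp add: p_def)
    have "2 * p n = a * (2 / real (n + 3))" by (simp add: p_def)
    also have "\<dots> < a * 1" using a by (intro mult_strict_left_mono) auto
    finally show "p n < a - p n" by simp
  qed
  have iff: "hitting_time c y \<omega> < ereal a \<longleftrightarrow>
      (\<exists>n. \<forall>m. \<exists>r::rat. real_of_rat r \<in> {p n..a - p n} \<and> \<bar>\<omega> (real_of_rat r) - y\<bar> < 1 / real (Suc m))"
    if \<omega>: "\<omega> \<in> space (path_space c)" for \<omega>
  proof -
    have co: "continuous_on {p n..a - p n} \<omega>" for n
      using \<omega> p[of n] a by (auto simp: space_path_space intro: continuous_on_subset)
    have "hitting_time c y \<omega> < ereal a \<longleftrightarrow> (\<exists>t. 0 < t \<and> t < a \<and> \<omega> t = y)"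
      using a by (auto simp: hitting_time_less_iff)
    also have "\<dots> \<longleftrightarrow> (\<exists>n. \<exists>t\<in>{p n..a - p n}. \<omega> t = y)"
    proof
      assume "\<exists>t. 0 < t \<and> t < a \<and> \<omega> t = y"
      then obtain t where t: "0 < t" "t < a" "\<omega> t = y" by blast
      obtain n :: nat where n: "a / min t (a - t) < real n" using reals_Archimedean2 by blast
      have mp: "0 < min t (a - t)" using t by simp
      have "a < real n * min t (a - t)" using n mp by (simp add: pos_divide_less_eq)
      also have "\<dots> \<le> real (n + 3) * min t (a - t)" using mp by (intro mult_right_mono) auto
      finally have "p n < min t (a - t)" unfolding p_def
        by (subst pos_divide_less_eq) (simp, simp only: mult.commute)
      then show "\<exists>n. \<exists>t\<in>{p n..a - p n}. \<omega> t = y" using t by (intro exI[of _ n] bexI[of _ t]) auto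
    next
      assume "\<exists>n. \<exists>t\<in>{p n..a - p n}. \<omega> t = y"
      then obtain n t where "t \<in> {p n..a - p n}" "\<omega> t = y" by blast
      then show "\<exists>t. 0 < t \<and> t < a \<and> \<omega> t = y" using p[of n] by (intro exI[of _ t]) auto
    qed
    finally show ?thesis using continuous_hits_iff[OF co p(2)] by simp
  qed
  have "{\<omega> \<in> space (path_space c). hitting_time c y \<omega> < ereal a} =
    {\<omega> \<in> space (path_filtration c a). \<exists>n. \<forall>m. \<exists>r::rat. real_of_rat r \<in> {p n..a - p n} \<and> \<bar>\<omega> (real_of_rat r) - y\<bar> < 1 / real (Suc m)}"
    using iff by (auto simp: path_filtration_def)
  also have "\<dots> \<in> sets (path_filtration c a)"
  proof (intro sets.sets_Collect_countable_Ex sets.sets_Collect_countable_All)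
    fix n m :: nat and r :: rat
    show "{\<omega> \<in> space (path_filtration c a). real_of_rat r \<in> {p n..a - p n} \<and> \<bar>\<omega> (real_of_rat r) - y\<bar> < 1 / real (Suc m)} \<in> sets (path_filtration c a)"
    proof (cases "real_of_rat r \<in> {p n..a - p n}")
      case True
      then have "p n \<le> real_of_rat r" "real_of_rat r \<le> a - p n" by auto
      then have "0 \<le> real_of_rat r" "real_of_rat r \<le> a" using p(1)[of n] by linarith+
      then have "(\<lambda>\<omega>. \<omega> (real_of_rat r)) \<in> borel_measurable (path_filtration c a)"
        by (rule path_filtration_coordinate)
      then have "{\<omega> \<in> space (path_filtration c a). \<bar>\<omega> (real_of_rat r) - y\<bar> < 1 / real (Suc m)} \<in> sets (path_filtration c a)"
        by measurable
      also have "{\<omega> \<in> space (path_filtration c a). \<bar>\<omega> (real_of_rat r) - y\<bar> < 1 / real (Suc m)} =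
        {\<omega> \<in> space (path_filtration c a). real_of_rat r \<in> {p n..a - p n} \<and> \<bar>\<omega> (real_of_rat r) - y\<bar> < 1 / real (Suc m)}"
        using True by auto
      finally show ?thesis .
    next
      case False
      then have "{\<omega> \<in> space (path_filtration c a). real_of_rat r \<in> {p n..a - p n} \<and> \<bar>\<omega> (real_of_rat r) - y\<bar> < 1 / real (Suc m)} = {}"
        by auto
      then show ?thesis by (simp only: sets.empty_sets)
    qed
  qed
  finally show ?thesis .
qed

lemma hitting_time_measurable:
  assumes c: "0 < c"
  shows "hitting_time c y \<in> borel_measurable (path_space c)"
proof -
  have 1: "{\<omega> \<in> space (path_space c). hitting_time c y \<omega> < ereal a} \<in> sets (path_space c)" if "a < c" for a
  proof (cases "0 < a")
    case True
    then show ?thesis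
      using hitting_event_measurable[OF True that, of y] subalgebra_path_filtration[OF that] unfolding subalgebra_def by blast
  next
    case False
    then have "{\<omega> \<in> space (path_space c). hitting_time c y \<omega> < ereal a} = {}"
      using hitting_time_less_iff[of c y _ "ereal a"] by auto
    then show ?thesis by (simp only: sets.empty_sets)
  qed
  have 2: "{\<omega> \<in> space (path_space c). hitting_time c y \<omega> < ereal c} \<in> sets (path_space c)"
  proof -
    have "{\<omega> \<in> space (path_space c). hitting_time c y \<omega> < ereal c} =
      (\<Union>n::nat. {\<omega> \<in> space (path_space c). hitting_time c y \<omega> < ereal (c - 1 / real (Suc n))})"
    proof (intro equalityI subsetI)
      fix \<omega> assume "\<omega> \<in> {\<omega> \<in> space (path_space c). hitting_time c y \<omega> < ereal c}"
      then obtain t where t: "\<omega> \<in> space (path_space c)" "0 < t" "t < c" "\<omega> t = y" by (auto simp: hitting_time_less_iff)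
      then obtain n where "1 / real (Suc n) < c - t" using nat_approx_posE[of "c - t"] by auto
      then have "t < c - 1 / real (Suc n)" by simp
      then show "\<omega> \<in> (\<Union>n::nat. {\<omega> \<in> space (path_space c). hitting_time c y \<omega> < ereal (c - 1 / real (Suc n))})"
        using t by (auto simp: hitting_time_less_iff)
    next
      fix \<omega> assume "\<omega> \<in> (\<Union>n::nat. {\<omega> \<in> space (path_space c). hitting_time c y \<omega> < ereal (c - 1 / real (Suc n))})"
      then show "\<omega> \<in> {\<omega> \<in> space (path_space c). hitting_time c y \<omega> < ereal c}"
        by (auto simp: hitting_time_less_iff)
    qed
    then show ?thesis using 1 by (auto intro!: sets.countable_UN)
  qed
  show ?thesis
  proof (rule borel_measurableI_less)
    fix z :: ereal
    show "{\<omega> \<in> space (path_space c). hitting_time c y \<omega> < z} \<in> sets (path_space c)"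
    proof (cases "z < ereal c")
      case True
      show ?thesis
      proof (cases z)
        case (real r)
        then show ?thesis using 1[of r] True by simp
      next
        case MInf
        then have "{\<omega> \<in> space (path_space c). hitting_time c y \<omega> < z} = {}" by auto
        then show ?thesis by (simp only: sets.empty_sets)
      qed (use True in auto)
    next
      case False
      \<comment> \<open>A finite hitting time is always below c, so a larger threshold adds no
        path.\<close>
      then have "{\<omega> \<in> space (path_space c). hitting_time c y \<omega> < z} = {\<omega> \<in> space (path_space c). hitting_time c y \<omega> < ereal c}"
        by (auto simp: hitting_time_less_iff not_less) (metis less_ereal.simps(1) less_le_trans)
      then show ?thesis using 2 by simp
    qed
  qed
qed

lemma hitting_time_attained:
  assumes \<omega>: "continuous_on {0..<c} \<omega>" and less: "hitting_time c y \<omega> < ereal u" "u \<le> c"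
  obtains \<tau> where "hitting_time c y \<omega> = ereal \<tau>" "0 \<le> \<tau>" "\<tau> < u" "\<omega> \<tau> = y"
proof -
  obtain \<tau> where \<tau>: "hitting_time c y \<omega> = ereal \<tau>"
    using less hitting_time_nonneg[of c y \<omega>] by (cases "hitting_time c y \<omega>") auto
  have t0: "0 \<le> \<tau>" "\<tau> < u" using \<tau> less hitting_time_nonneg[of c y \<omega>] by auto
  have "\<bar>\<omega> \<tau> - y\<bar> \<le> e" if e: "e > 0" for e
  proof -
    have "\<tau> \<in> {0..<c}" using t0 less by auto
    then obtain d where d: "d > 0" "\<And>r. r \<in> {0..<c} \<Longrightarrow> dist r \<tau> < d \<Longrightarrow> dist (\<omega> r) (\<omega> \<tau>) < e"
      using \<omega> e unfolding continuous_on_iff by blast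
    have "hitting_time c y \<omega> < ereal (\<tau> + d)" using \<tau> d by simp
    then obtain t where t: "0 < t" "t < c" "t < \<tau> + d" "\<omega> t = y" by (auto simp: hitting_time_less_iff)
    have "\<not> hitting_time c y \<omega> < ereal \<tau>" using \<tau> by simp
    then have "\<tau> \<le> t" using t(1,2,4) by (meson hitting_time_less_iff less_ereal.simps(1) not_less)
    then show ?thesis using d(2)[of t] t by (auto simp: dist_real_def)
  qed
  then have "\<bar>\<omega> \<tau> - y\<bar> \<le> 0 + e" if "e > 0" for e using that by simp
  then have "\<bar>\<omega> \<tau> - y\<bar> \<le> 0" by (rule field_le_epsilon)
  then show ?thesis using that \<tau> t0 by auto
qed

section \<open>Hitting laws under a density\<close>

lemma real_floor_grid:
  fixes \<tau> u :: real
  assumes "0 \<le> \<tau>" "\<tau> < u" "0 < n"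
  shows "\<exists>!k. k < n \<and> real k * u / real n \<le> \<tau> \<and> \<tau> < real (Suc k) * u / real n"
proof -
  define k where "k = nat \<lfloor>\<tau> * real n / u\<rfloor>"
  have u: "0 < u" using assms by simp
  have kk: "real k \<le> \<tau> * real n / u" "\<tau> * real n / u < real k + 1"
    using assms u by (auto simp: k_def)
  have iff: "(real j * u / real n \<le> \<tau> \<longleftrightarrow> real j \<le> \<tau> * real n / u) \<and> (\<tau> < real (Suc j) * u / real n \<longleftrightarrow> \<tau> * real n / u < real j + 1)" for j
    using u assms(3) by (auto simp: field_simps)
  show ?thesis
  proof (rule ex1I[of _ k])
    have "\<tau> * real n / u < real n" using assms u by (simp add: field_simps)
    then show "k < n \<and> real k * u / real n \<le> \<tau> \<and> \<tau> < real (Suc k) * u / real n"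
      using kk iff[of k] by linarith
    fix j assume "j < n \<and> real j * u / real n \<le> \<tau> \<and> \<tau> < real (Suc j) * u / real n"
    then have "real j \<le> \<tau> * real n / u" "\<tau> * real n / u < real j + 1" using iff[of j] by auto
    then show "j = k" using kk by linarith
  qed
qed

text \<open>The relation on \<open>\<F>\<^sub>t\<close> is applied at the right end points of a partition of \<open>[0,u)\<close>,
  on the event that the hitting time lies in the corresponding cell; the bound on \<open>G\<close> replaces
  optional stopping in the limit.\<close>

lemma hitting_before_density:
  assumes sets_mu: "sets \<mu> = sets (path_space c)" and sets_nu: "sets \<nu> = sets (path_space c)"
    and fin: "finite_measure \<mu>"
    and rel: "\<And>t A. 0 \<le> t \<Longrightarrow> t < c \<Longrightarrow> A \<in> sets (path_filtration c t) \<Longrightarrow>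
       emeasure \<nu> A = (\<integral>\<^sup>+ \<omega>. indicator A \<omega> * ennreal (G t (\<omega> t)) \<partial>\<mu>)"
    and cont: "continuous_on ({0..<c} \<times> UNIV) (\<lambda>(t, z). G t z)"
    and bdd: "\<And>t. 0 \<le> t \<Longrightarrow> t < c \<Longrightarrow> \<exists>C. \<forall>s\<in>{0..t}. \<forall>z. G s z \<le> C"
    and u: "0 < u" "u < c"
  shows "emeasure \<nu> {\<omega> \<in> space (path_space c). hitting_time c y \<omega> < ereal u} =
    (\<integral>\<^sup>+ \<omega>. indicator {\<omega> \<in> space (path_space c). hitting_time c y \<omega> < ereal u} \<omega> *
       ennreal (G (real_of_ereal (hitting_time c y \<omega>)) y) \<partial>\<mu>)"
proof -
  let ?T = "hitting_time c y"
  interpret finite_measure \<mu> by (rule fin)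
  have sp: "space \<mu> = space (path_space c)" using sets_mu by (rule sets_eq_imp_space_eq)
  obtain K where K: "\<forall>s\<in>{0..u}. \<forall>z. G s z \<le> K" using bdd[OF less_imp_le[OF u(1)] u(2)] by blast
  define v where "v n k = real k * u / real n" for n k :: nat
  \<comment> \<open>This is the event that the hitting time lies in [v n k, v n (k + 1)), and it is
    decided at the right end point.\<close>
  define C where "C n k = {\<omega> \<in> space (path_space c). ?T \<omega> < ereal (v n (Suc k))} - {\<omega> \<in> space (path_space c). ?T \<omega> < ereal (v n k)}" for n k
  have v: "0 < v n (Suc k)" "v n (Suc k) \<le> u" "v n k < v n (Suc k)" if "k < n" for n k
  proof -
    have "real (Suc k) / real n * u \<le> 1 * u" using that u by (intro mult_right_mono) auto
    then show "0 < v n (Suc k)" "v n (Suc k) \<le> u" "v n k < v n (Suc k)" using that u by (auto simp: v_def divide_strict_right_mono)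
  qed
  have vc: "0 \<le> v n (Suc k)" "v n (Suc k) < c" if "k < n" for n k
    using v(1,2)[OF that] u by linarith+
  have less_mono: "{\<omega> \<in> space (path_space c). ?T \<omega> < ereal r} \<in> sets (path_filtration c t)" if "r \<le> t" "0 < t" "t < c" for r t
  proof (cases "0 < r")
    case True
    then show ?thesis using hitting_event_measurable[of r c y] that natural_filtration_mono[of r t] unfolding path_filtration_def by auto
  next
    case False
    then have "{\<omega> \<in> space (path_space c). ?T \<omega> < ereal r} = {}"
      using hitting_time_less_iff[of c y _ "ereal r"] by auto
    then show ?thesis by (simp only: sets.empty_sets)
  qed
  have CF: "C n k \<in> sets (path_filtration c (v n (Suc k)))" if "k < n" for n k
    unfolding C_def using v[OF that] u by (intro sets.Diff less_mono) auto
  have CS: "C n k \<in> sets (path_space c)" if "k < n" for n k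
    using CF[OF that] subalgebra_path_filtration[of "v n (Suc k)" c] v[OF that] u unfolding subalgebra_def by auto
  define S where "S = {\<omega> \<in> space (path_space c). ?T \<omega> < ereal u}"
  have SS: "S \<in> sets (path_space c)"
    using less_mono[of u u] u subalgebra_path_filtration[of u c] unfolding S_def subalgebra_def by auto
  have grid: "\<exists>k<n. (\<forall>j<n. \<omega> \<in> C n j \<longleftrightarrow> j = k) \<and> \<tau> < v n (Suc k) \<and> v n (Suc k) \<le> \<tau> + u / real n"
    if \<omega>: "\<omega> \<in> S" and \<tau>: "?T \<omega> = ereal \<tau>" and n: "0 < n" for \<omega> \<tau> n
  proof -
    have t: "0 \<le> \<tau>" "\<tau> < u" using hitting_time_nonneg[of c y \<omega>] \<omega> \<tau> by (auto simp: S_def)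
    have Ciff: "\<omega> \<in> C n j \<longleftrightarrow> v n j \<le> \<tau> \<and> \<tau> < v n (Suc j)" for j
      using \<omega> \<tau> by (auto simp: C_def S_def not_less)
    obtain k where k: "k < n" "v n k \<le> \<tau>" "\<tau> < v n (Suc k)"
      and uniq: "\<And>j. j < n \<Longrightarrow> v n j \<le> \<tau> \<Longrightarrow> \<tau> < v n (Suc j) \<Longrightarrow> j = k"
      using real_floor_grid[OF t n] unfolding v_def by (elim ex1E) blast
    have "v n (Suc k) = v n k + u / real n" by (simp add: v_def add_divide_distrib distrib_right)
    then have "v n (Suc k) \<le> \<tau> + u / real n" using k(2) by linarith
    moreover have "\<forall>j<n. \<omega> \<in> C n j \<longleftrightarrow> j = k" using uniq k(2,3) unfolding Ciff by blast
    ultimately show ?thesis using k(1,3) by blast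
  qed
  have cover: "S = (\<Union>k<n. C n k)" if n: "0 < n" for n
  proof (intro equalityI subsetI)
    fix \<omega> assume \<omega>: "\<omega> \<in> S"
    then obtain \<tau> where "?T \<omega> = ereal \<tau>"
      using hitting_time_nonneg[of c y \<omega>] by (cases "?T \<omega>") (auto simp: S_def)
    from grid[OF \<omega> this n] show "\<omega> \<in> (\<Union>k<n. C n k)" by auto
  next
    fix \<omega> assume "\<omega> \<in> (\<Union>k<n. C n k)"
    then obtain k where k: "k < n" "\<omega> \<in> space (path_space c)" "?T \<omega> < ereal (v n (Suc k))" by (auto simp: C_def)
    then show "\<omega> \<in> S" using v(2)[OF k(1)] by (auto simp: S_def intro: less_le_trans)
  qed
  have dis: "disjoint_family_on (C n) {..<n}" for n
    unfolding disjoint_family_on_def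
  proof (intro ballI impI)
    have "C n j \<inter> C n k = {}" if "j < k" for j k
    proof -
      have "real (Suc j) * u / real n \<le> real k * u / real n"
        using that u by (intro divide_right_mono mult_right_mono) auto
      then have "v n (Suc j) \<le> v n k" by (simp add: v_def)
      then show ?thesis by (auto simp: C_def intro: less_le_trans)
    qed
    then show "C n j \<inter> C n k = {}" if "j \<noteq> k" for j k using that by (metis linorder_neqE_nat inf_commute)
  qed
  define f where "f n \<omega> = (\<Sum>k<n. indicator (C n k) \<omega> * ennreal (G (v n (Suc k)) (\<omega> (v n (Suc k)))))" for n \<omega>
  have Gm: "(\<lambda>z. ennreal (G t z)) \<in> borel_measurable borel" if "0 \<le> t" "t < c" for t
  proof -
    have "continuous_on UNIV (\<lambda>z. (\<lambda>(t, z). G t z) (t, z))"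
      by (rule continuous_on_compose2[OF cont]) (use that in \<open>auto intro!: continuous_intros\<close>)
    then have "G t \<in> borel_measurable borel" by (intro borel_measurable_continuous_onI) simp
    then show ?thesis by measurable
  qed
  have fm1: "(\<lambda>\<omega>. indicator (C n k) \<omega> * ennreal (G (v n (Suc k)) (\<omega> (v n (Suc k))))) \<in> borel_measurable \<mu>" if "k < n" for n k
  proof -
    note vc = vc[OF that]
    have "(\<lambda>\<omega>. \<omega> (v n (Suc k))) \<in> borel_measurable (path_space c)" by (rule path_space_coordinate) (use vc in auto)
    from measurable_compose[OF this Gm[OF vc]] CS[OF that]
    have "(\<lambda>\<omega>. indicator (C n k) \<omega> * ennreal (G (v n (Suc k)) (\<omega> (v n (Suc k))))) \<in> borel_measurable (path_space c)"
      by (intro borel_measurable_times_ennreal borel_measurable_indicator)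
    then show ?thesis unfolding measurable_cong_sets[OF sets_mu refl] .
  qed
  have nu: "emeasure \<nu> S = (\<integral>\<^sup>+ \<omega>. f n \<omega> \<partial>\<mu>)" if n: "0 < n" for n
  proof -
    have "emeasure \<nu> S = (\<Sum>k<n. emeasure \<nu> (C n k))"
      unfolding cover[OF n] using CS dis by (intro sum_emeasure[symmetric]) (auto simp: sets_nu)
    also have "\<dots> = (\<Sum>k<n. \<integral>\<^sup>+ \<omega>. indicator (C n k) \<omega> * ennreal (G (v n (Suc k)) (\<omega> (v n (Suc k)))) \<partial>\<mu>)"
      by (intro sum.cong refl rel CF vc) auto
    also have "\<dots> = (\<integral>\<^sup>+ \<omega>. f n \<omega> \<partial>\<mu>)"
      unfolding f_def using fm1 by (intro nn_integral_sum[symmetric]) auto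
    finally show ?thesis .
  qed
  define h where "h \<omega> = indicator S \<omega> * ennreal (G (real_of_ereal (?T \<omega>)) y)" for \<omega>
  have conv: "(\<lambda>n. f (Suc n) \<omega>) \<longlonglongrightarrow> h \<omega>" and bound: "f (Suc n) \<omega> \<le> ennreal K" if \<omega>sp: "\<omega> \<in> space \<mu>" for \<omega> n
  proof -
    have "(\<lambda>n. f (Suc n) \<omega>) \<longlonglongrightarrow> h \<omega> \<and> (\<forall>n. f (Suc n) \<omega> \<le> ennreal K)"
    proof (cases "\<omega> \<in> S")
      case False
      then have "\<omega> \<notin> C (Suc n) k" if "k < Suc n" for n k using cover[of "Suc n"] that by auto
      then have "f (Suc n) \<omega> = 0" for n unfolding f_def by (intro sum.neutral) auto
      then show ?thesis using False by (simp add: h_def)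
    next
      case True
      have co: "continuous_on {0..<c} \<omega>" using \<omega>sp by (simp add: sp space_path_space)
      obtain \<tau> where \<tau>: "?T \<omega> = ereal \<tau>" "0 \<le> \<tau>" "\<tau> < u" "\<omega> \<tau> = y"
        using hitting_time_attained[OF co, of y u] True u by (auto simp: S_def)
      have "\<forall>n. \<exists>k<Suc n. (\<forall>j<Suc n. \<omega> \<in> C (Suc n) j \<longleftrightarrow> j = k) \<and> \<tau> < v (Suc n) (Suc k) \<and> v (Suc n) (Suc k) \<le> \<tau> + u / real (Suc n)"
        using grid[OF True \<tau>(1)] by blast
      then obtain k where k: "\<And>n. k n < Suc n" "\<And>n j. j < Suc n \<Longrightarrow> \<omega> \<in> C (Suc n) j \<longleftrightarrow> j = k n"
        "\<And>n. \<tau> < v (Suc n) (Suc (k n))" "\<And>n. v (Suc n) (Suc (k n)) \<le> \<tau> + u / real (Suc n)" by metis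
      \<comment> \<open>The right end of the only cell that contains \<tau>; it exceeds \<tau> by at
        most u / (n + 1), and the sum f (n + 1) reduces to its term there.\<close>
      define w where "w n = v (Suc n) (Suc (k n))" for n
      have f: "f (Suc n) \<omega> = ennreal (G (w n) (\<omega> (w n)))" for n
      proof -
        have "f (Suc n) \<omega> = (\<Sum>j<Suc n. if j = k n then ennreal (G (w n) (\<omega> (w n))) else 0)"
          unfolding f_def by (intro sum.cong refl) (auto simp: indicator_def k(2) w_def simp del: lessThan_Suc sum.lessThan_Suc)
        also have "\<dots> = ennreal (G (w n) (\<omega> (w n)))" using k(1)[of n] by (subst sum.delta) auto
        finally show ?thesis .
      qed
      have wu: "0 \<le> w n" "w n \<le> u" for n using v[OF k(1)[of n]] by (auto simp: w_def)
      have wc: "w n < c" for n using vc[OF k(1)[of n]] by (simp add: w_def)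
      have wlim: "w \<longlonglongrightarrow> \<tau>"
      proof (rule tendsto_sandwich[where f="\<lambda>_. \<tau>" and h="\<lambda>n. \<tau> + u / real (Suc n)"])
        show "(\<lambda>n. \<tau> + u / real (Suc n)) \<longlonglongrightarrow> \<tau>"
          using tendsto_add[OF tendsto_const[of \<tau>] LIMSEQ_Suc[OF lim_const_over_n[of u]]] by simp
        show "\<forall>\<^sub>F n in sequentially. \<tau> \<le> w n" "\<forall>\<^sub>F n in sequentially. w n \<le> \<tau> + u / real (Suc n)"
          using k(3,4) by (auto simp: w_def less_imp_le)
      qed auto
      have wlim\<omega>: "(\<lambda>n. \<omega> (w n)) \<longlonglongrightarrow> \<omega> \<tau>"
        by (rule continuous_on_tendsto_compose[OF co wlim]) (use wu wc u \<tau> in auto)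
      \<comment> \<open>G is jointly continuous and the path has the value y at \<tau>; this is
        where the position disappears from the limit.\<close>
      have "(\<lambda>n. (\<lambda>(t, z). G t z) (w n, \<omega> (w n))) \<longlonglongrightarrow> (\<lambda>(t, z). G t z) (\<tau>, \<omega> \<tau>)"
        by (rule continuous_on_tendsto_compose[OF cont tendsto_Pair[OF wlim wlim\<omega>]])
          (use wu wc u \<tau> in auto)
      then have "(\<lambda>n. ennreal (G (w n) (\<omega> (w n)))) \<longlonglongrightarrow> ennreal (G \<tau> y)"
        using \<tau> by (intro tendsto_ennrealI) simp
      moreover have "h \<omega> = ennreal (G \<tau> y)" using True \<tau>(1) by (simp add: h_def)
      moreover have "f (Suc n) \<omega> \<le> ennreal K" for n
        unfolding f using wu K by (intro ennreal_leI) auto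
      ultimately show ?thesis by (simp add: f)
    qed
    then show "(\<lambda>n. f (Suc n) \<omega>) \<longlonglongrightarrow> h \<omega>" "f (Suc n) \<omega> \<le> ennreal K" by auto
  qed
  have fm: "f (Suc n) \<in> borel_measurable \<mu>" for n
    unfolding f_def using fm1 by (intro borel_measurable_sum) auto
  have hm: "h \<in> borel_measurable \<mu>"
    by (rule borel_measurable_LIMSEQ_order[OF conv fm])
  have "(\<lambda>n. \<integral>\<^sup>+ \<omega>. f (Suc n) \<omega> \<partial>\<mu>) \<longlonglongrightarrow> (\<integral>\<^sup>+ \<omega>. h \<omega> \<partial>\<mu>)"
  proof (rule nn_integral_dominated_convergence[where w="\<lambda>_. ennreal K"])
    show "(\<integral>\<^sup>+ \<omega>. ennreal K \<partial>\<mu>) < \<infinity>"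
      by (simp add: emeasure_eq_measure ennreal_mult''[symmetric])
  qed (use fm hm conv bound in auto)
  moreover have "(\<integral>\<^sup>+ \<omega>. f (Suc n) \<omega> \<partial>\<mu>) = emeasure \<nu> S" for n using nu[of "Suc n"] by simp
  ultimately have "emeasure \<nu> S = (\<integral>\<^sup>+ \<omega>. h \<omega> \<partial>\<mu>)" using LIMSEQ_unique[OF tendsto_const] by simp
  then show ?thesis by (simp add: h_def S_def)
qed

lemma less_ereal_trans: "z < ereal r \<Longrightarrow> r < c \<Longrightarrow> z < ereal c"
  by (cases z) auto

text \<open>The generators end strictly before c, so that the density relation is called for only at
  times inside the horizon.\<close>

lemma sets_restrict_ereal_interval:
  assumes c: "0 < c"
  shows "sets (restrict_space (borel :: ereal measure) {0..<ereal c}) = sigma_sets {0..<ereal c} {{0..<ereal u} | u. 0 < u \<and> u < c}"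
proof -
  let ?\<Omega> = "{0..<ereal c}" and ?E = "{{0..<ereal u} | u. 0 < u \<and> u < c}"
  have borel: "sets (borel :: ereal measure) = sigma_sets UNIV (range lessThan)"
    unfolding borel_Iio by (rule sets_measure_of) auto
  have "?\<Omega> \<in> sigma_sets UNIV (range lessThan)"
    unfolding borel[symmetric] by simp
  then have "sets (restrict_space (borel :: ereal measure) ?\<Omega>) = sigma_sets ?\<Omega> ((\<inter>) ?\<Omega> ` range lessThan)"
    unfolding sets_restrict_space borel by (rule sigma_sets_Int) auto
  also have "\<dots> = sigma_sets ?\<Omega> ?E"
  proof (rule sigma_sets_eqI)
    have full: "?\<Omega> \<in> sigma_sets ?\<Omega> ?E" by (rule sigma_sets_top)
    fix a assume "a \<in> (\<inter>) ?\<Omega> ` range lessThan"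
    then obtain z where a: "a = ?\<Omega> \<inter> {..<z}" by auto
    show "a \<in> sigma_sets ?\<Omega> ?E"
    proof (cases "z < ereal c")
      case False
      then have "a = ?\<Omega>" using a by (auto simp: not_less intro: less_le_trans)
      then show ?thesis using full by simp
    next
      case True
      show ?thesis
      proof (cases "0 < z")
        case False
        then have "a = {}" using a by (auto simp: not_less)
        then show ?thesis by (simp add: sigma_sets.Empty)
      next
        case pos: True
        then obtain r where r: "z = ereal r" using True by (cases z) auto
        have "a = {0..<ereal r}" using a True r by (auto intro: less_ereal_trans)
        then show ?thesis using pos True r by (intro sigma_sets.Basic) auto
      qed
    qed
  next
    fix a assume "a \<in> ?E"
    then obtain u where u: "a = {0..<ereal u}" "u < c" by auto
    have "a = ?\<Omega> \<inter> {..<ereal u}"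
      unfolding u(1) using u(2) by (auto intro: less_ereal_trans)
    then show "a \<in> sigma_sets ?\<Omega> ((\<inter>) ?\<Omega> ` range lessThan)" by (intro sigma_sets.Basic) auto
  qed
  finally show ?thesis .
qed

text \<open>Both measures are compared on the intervals [0,u), where
  \<open>hitting_before_density\<close> computes them. The pair of laws and G are left abstract
  because the result is applied in both directions, with G a multiple of H or of 1/H.\<close>

lemma hitting_law_density:
  assumes c: "0 < c" and sets_mu: "sets \<mu> = sets (path_space c)" and sets_nu: "sets \<nu> = sets (path_space c)"
    and fin: "finite_measure \<mu>" "finite_measure \<nu>"
    and rel: "\<And>t A. 0 \<le> t \<Longrightarrow> t < c \<Longrightarrow> A \<in> sets (path_filtration c t) \<Longrightarrow>
       emeasure \<nu> A = (\<integral>\<^sup>+ \<omega>. indicator A \<omega> * ennreal (G t (\<omega> t)) \<partial>\<mu>)"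
    and cont: "continuous_on ({0..<c} \<times> UNIV) (\<lambda>(t, z). G t z)"
    and bdd: "\<And>t. 0 \<le> t \<Longrightarrow> t < c \<Longrightarrow> \<exists>C. \<forall>s\<in>{0..t}. \<forall>z. G s z \<le> C"
  shows "(\<lambda>t. ennreal (G (real_of_ereal t) y)) \<in> borel_measurable (restrict_space borel {0..<ereal c})"
    and "hitting_law \<nu> c y c = density (hitting_law \<mu> c y c) (\<lambda>t. ennreal (G (real_of_ereal t) y))"
proof -
  let ?T = "hitting_time c y" and ?\<Omega> = "{0..<ereal c}" and ?g = "\<lambda>t. ennreal (G (real_of_ereal t) y)"
  have Tm: "?T \<in> borel_measurable \<mu>" "?T \<in> borel_measurable \<nu>"
    using hitting_time_measurable[OF c, of y] measurable_cong_sets[OF sets_mu refl] measurable_cong_sets[OF sets_nu refl] by auto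
  have sp: "space \<mu> = space (path_space c)" "space \<nu> = space (path_space c)"
    using sets_eq_imp_space_eq sets_mu sets_nu by auto
  have "continuous_on {0..<c} (\<lambda>t. (\<lambda>(t, z). G t z) (t, y))"
    by (rule continuous_on_compose2[OF cont]) (auto intro!: continuous_intros)
  then have "(\<lambda>t. G t y) \<in> borel_measurable (restrict_space borel {0..<c})"
    by (intro borel_measurable_continuous_on_restrict) simp
  then have g0: "(\<lambda>t. ennreal (G t y)) \<in> borel_measurable (restrict_space borel {0..<c})" by measurable
  have "real_of_ereal \<in> measurable (restrict_space borel ?\<Omega>) (restrict_space borel {0..<c})"
  proof (rule measurable_restrict_space2)
    show "real_of_ereal \<in> space (restrict_space borel ?\<Omega>) \<rightarrow> {0..<c}"
    proof
      fix z :: ereal assume "z \<in> space (restrict_space borel ?\<Omega>)"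
      then have "0 \<le> z" "z < ereal c" by (auto simp: space_restrict_space)
      then show "real_of_ereal z \<in> {0..<c}" by (cases z) auto
    qed
  qed (rule measurable_restrict_space1, measurable)
  from measurable_compose[OF this g0]
  show gm: "?g \<in> borel_measurable (restrict_space borel ?\<Omega>)" .
  have sets_law: "sets (hitting_law \<rho> c y c) = sets (restrict_space borel ?\<Omega>)" for \<rho>
    unfolding hitting_law_def by (rule sets_restrict_space_cong) simp
  have \<Omega>b: "?\<Omega> \<inter> space (distr \<rho> borel ?T) \<in> sets (distr \<rho> borel ?T)" for \<rho> by simp
  have law: "emeasure (hitting_law \<nu> c y c) {0..<ereal u} = emeasure \<nu> {\<omega> \<in> space (path_space c). ?T \<omega> < ereal u}" if "u < c" for u
  proof -
    have "emeasure (hitting_law \<nu> c y c) {0..<ereal u} = emeasure (distr \<nu> borel ?T) {0..<ereal u}"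
      unfolding hitting_law_def by (rule emeasure_restrict_space[OF \<Omega>b]) (use that in \<open>auto intro: less_ereal_trans\<close>)
    also have "\<dots> = emeasure \<nu> (?T -` {0..<ereal u} \<inter> space \<nu>)"
      by (rule emeasure_distr[OF Tm(2)]) simp
    also have "?T -` {0..<ereal u} \<inter> space \<nu> = {\<omega> \<in> space (path_space c). ?T \<omega> < ereal u}"
      using sp hitting_time_nonneg by auto
    finally show ?thesis .
  qed
  have dens: "emeasure (density (hitting_law \<mu> c y c) ?g) {0..<ereal u} =
    (\<integral>\<^sup>+ \<omega>. indicator {\<omega> \<in> space (path_space c). ?T \<omega> < ereal u} \<omega> * ?g (?T \<omega>) \<partial>\<mu>)" if u: "0 < u" "u < c" for u
  proof -
    have g': "?g \<in> borel_measurable (hitting_law \<mu> c y c)"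
      using gm unfolding measurable_cong_sets[OF sets_law refl] .
    have U: "{0..<ereal u} \<in> sets (hitting_law \<mu> c y c)"
      unfolding sets_law sets_restrict_ereal_interval[OF c] using u by (intro sigma_sets.Basic) auto
    have sub: "{0..<ereal u} \<subseteq> ?\<Omega>" using u by (auto intro: less_ereal_trans)
    \<comment> \<open>Extension by 0 to all extended reals, so that the integral can be moved
      through the unrestricted image law.\<close>
    define k where "k t = ?g t * indicator {0..<ereal u} t * indicator ?\<Omega> t" for t :: ereal
    have km: "k \<in> borel_measurable borel"
    proof -
      have "(\<lambda>t. ?g t * indicator {0..<ereal u} t) \<in> borel_measurable (restrict_space borel ?\<Omega>)"
        using gm by (intro borel_measurable_times_ennreal borel_measurable_indicator)
          (use U in \<open>auto simp: sets_law\<close>)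
      then show ?thesis unfolding k_def
        by (subst (asm) borel_measurable_restrict_space_iff_ennreal) (auto simp: mult.commute)
    qed
    have "emeasure (density (hitting_law \<mu> c y c) ?g) {0..<ereal u} = (\<integral>\<^sup>+ t. ?g t * indicator {0..<ereal u} t \<partial>hitting_law \<mu> c y c)"
      by (rule emeasure_density[OF g' U])
    also have "\<dots> = (\<integral>\<^sup>+ t. k t \<partial>distr \<mu> borel ?T)"
      unfolding hitting_law_def k_def by (rule nn_integral_restrict_space[OF \<Omega>b])
    also have "\<dots> = (\<integral>\<^sup>+ \<omega>. k (?T \<omega>) \<partial>\<mu>)"
      by (rule nn_integral_distr[OF Tm(1)]) (use km in simp)
    also have "\<dots> = (\<integral>\<^sup>+ \<omega>. indicator {\<omega> \<in> space (path_space c). ?T \<omega> < ereal u} \<omega> * ?g (?T \<omega>) \<partial>\<mu>)"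
    proof (rule nn_integral_cong)
      fix \<omega> assume "\<omega> \<in> space \<mu>"
      then show "k (?T \<omega>) = indicator {\<omega> \<in> space (path_space c). ?T \<omega> < ereal u} \<omega> * ?g (?T \<omega>)"
        using sp sub hitting_time_nonneg[of c y \<omega>] u
        by (auto simp: k_def indicator_def dest: less_ereal_trans)
    qed
    finally show ?thesis .
  qed
  show "hitting_law \<nu> c y c = density (hitting_law \<mu> c y c) ?g"
  proof (rule measure_eqI_generator_eq[where \<Omega>="?\<Omega>" and E="{{0..<ereal u} | u. 0 < u \<and> u < c}" and A="\<lambda>n. {0..<ereal (c - c / real (n + 2))}"])
    show "Int_stable {{0..<ereal u} | u. 0 < u \<and> u < c}"
      unfolding Int_stable_def
    proof (intro ballI)
      fix A B assume "A \<in> {{0..<ereal u} | u. 0 < u \<and> u < c}" "B \<in> {{0..<ereal u} | u. 0 < u \<and> u < c}"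
      then obtain p q where pq: "A = {0..<ereal p}" "0 < p" "p < c" "B = {0..<ereal q}" "0 < q" "q < c" by blast
      then have "A \<inter> B = {0..<ereal (min p q)}" by auto
      moreover have "0 < min p q" "min p q < c" using pq by auto
      ultimately show "A \<inter> B \<in> {{0..<ereal u} | u. 0 < u \<and> u < c}" by blast
    qed
    show "{{0..<ereal u} | u. 0 < u \<and> u < c} \<subseteq> Pow ?\<Omega>"
      by (auto intro: less_ereal_trans)
    show "sets (hitting_law \<nu> c y c) = sigma_sets ?\<Omega> {{0..<ereal u} | u. 0 < u \<and> u < c}"
      "sets (density (hitting_law \<mu> c y c) ?g) = sigma_sets ?\<Omega> {{0..<ereal u} | u. 0 < u \<and> u < c}"
      by (simp_all only: sets_density sets_law sets_restrict_ereal_interval[OF c])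
    fix X assume "X \<in> {{0..<ereal u} | u. 0 < u \<and> u < c}"
    then obtain u where u: "X = {0..<ereal u}" "0 < u" "u < c" by auto
    show "emeasure (hitting_law \<nu> c y c) X = emeasure (density (hitting_law \<mu> c y c) ?g) X"
      unfolding u(1) law[OF u(3)] dens[OF u(2,3)]
      by (rule hitting_before_density[OF sets_mu sets_nu fin(1) rel cont bdd u(2,3)])
  next
    \<comment> \<open>With n + 2 in the denominator the bounds are positive from n = 0 on, and they
      increase to c.\<close>
    have r: "0 < c - c / real (n + 2) \<and> c - c / real (n + 2) < c" for n
    proof -
      have "c * (1 / real (n + 2)) < c * 1" using c by (intro mult_strict_left_mono) auto
      then show ?thesis using c by simp
    qed
    then show "range (\<lambda>n. {0..<ereal (c - c / real (n + 2))}) \<subseteq> {{0..<ereal u} | u. 0 < u \<and> u < c}" by blast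
    show "(\<Union>n. {0..<ereal (c - c / real (n + 2))}) = ?\<Omega>"
    proof (intro equalityI subsetI)
      fix z assume "z \<in> (\<Union>n. {0..<ereal (c - c / real (n + 2))})"
      then obtain n where n: "0 \<le> z" "z < ereal (c - c / real (n + 2))" by auto
      have "z < ereal c" by (rule less_ereal_trans[OF n(2)]) (use r[of n] in blast)
      then show "z \<in> ?\<Omega>" using n(1) by simp
    next
      fix z assume z: "z \<in> ?\<Omega>"
      then obtain s where s: "z = ereal s" "0 \<le> s" "s < c" by (cases z) auto
      obtain n :: nat where n: "c / (c - s) < real n" using reals_Archimedean2 by blast
      have "c < real n * (c - s)" using n s by (simp add: pos_divide_less_eq)
      also have "\<dots> \<le> real (n + 2) * (c - s)" using s by (intro mult_right_mono) auto
      finally have "c / real (n + 2) < c - s" by (subst pos_divide_less_eq) (simp, simp only: mult.commute)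
      then have "s < c - c / real (n + 2)" by linarith
      then have "z \<in> {0..<ereal (c - c / real (n + 2))}" using s by simp
      then show "z \<in> (\<Union>n. {0..<ereal (c - c / real (n + 2))})" by blast
    qed
    fix n :: nat
    have "emeasure (hitting_law \<nu> c y c) {0..<ereal (c - c / real (n + 2))} \<le> emeasure \<nu> (space \<nu>)"
      using law r[of n] emeasure_space by metis
    then show "emeasure (hitting_law \<nu> c y c) {0..<ereal (c - c / real (n + 2))} \<noteq> \<infinity>"
      using finite_measure.emeasure_finite[OF fin(2), of "space \<nu>"] by (auto simp: top_unique)
  qed
qed

section \<open>Change of the time horizon\<close>

text \<open>If some hit occurs before l, later ones do not affect the infimum; if none does, the
  shortened path never hits.\<close>

lemma hitting_time_shorten:
  assumes lb: "l \<le> b"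
  shows "hitting_time l y (restrict \<omega> {0..<l}) = (if hitting_time b y \<omega> < ereal l then hitting_time b y \<omega> else \<infinity>)"
proof -
  let ?S = "{t. 0 < t \<and> t < b \<and> \<omega> t = y}"
  have eq: "hitting_time l y (restrict \<omega> {0..<l}) = Inf (ereal ` {t \<in> ?S. t < l})"
    unfolding hitting_time_def using lb by (intro arg_cong[where f=Inf] image_cong) auto
  show ?thesis
  proof (cases "hitting_time b y \<omega> < ereal l")
    case True
    then obtain s where s: "s \<in> ?S" "s < l" by (auto simp: hitting_time_less_iff)
    have "Inf (ereal ` {t \<in> ?S. t < l}) = Inf (ereal ` ?S)"
    proof (rule antisym)
      show "Inf (ereal ` ?S) \<le> Inf (ereal ` {t \<in> ?S. t < l})" by (rule Inf_superset_mono) auto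
      show "Inf (ereal ` {t \<in> ?S. t < l}) \<le> Inf (ereal ` ?S)"
      proof (rule Inf_greatest)
        fix z assume "z \<in> ereal ` ?S"
        then obtain t where t: "t \<in> ?S" "z = ereal t" by auto
        show "Inf (ereal ` {t \<in> ?S. t < l}) \<le> z"
        proof (cases "t < l")
          case True
          then show ?thesis using t by (intro Inf_lower) auto
        next
          case False
          have "Inf (ereal ` {t \<in> ?S. t < l}) \<le> ereal s" using s by (intro Inf_lower) auto
          also have "\<dots> \<le> z" using s(2) False t(2) by simp
          finally show ?thesis .
        qed
      qed
    qed
    then show ?thesis using True eq by (simp add: hitting_time_def)
  next
    case False
    then have "{t \<in> ?S. t < l} = {}" by (auto simp: hitting_time_less_iff)
    then have "hitting_time l y (restrict \<omega> {0..<l}) = \<infinity>"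
      unfolding eq by (simp only: image_empty Inf_empty top_ereal_def)
    then show ?thesis using False by simp
  qed
qed

text \<open>The two hitting times differ only where the longer path first hits at or after l, and
  such values lie outside [0,l).\<close>

lemma hitting_law_shorten:
  assumes l: "0 < l" "l \<le> b" and P: "sets P = sets (path_space b)"
  shows "hitting_law (shorten_law l P) l y l = hitting_law P b y l"
proof (rule measure_eqI)
  let ?r = "\<lambda>\<omega>. restrict \<omega> {0..<l}"
  have sets_law: "sets (hitting_law \<rho> c y l) = sets (restrict_space borel {0..<ereal l})" for \<rho> c
    unfolding hitting_law_def by (rule sets_restrict_space_cong) simp
  then show "sets (hitting_law (shorten_law l P) l y l) = sets (hitting_law P b y l)" by simp
  have r: "?r \<in> measurable P (path_space l)"
    using measurable_path_restrict[OF l(2)] unfolding measurable_cong_sets[OF P refl] .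
  have Tb: "hitting_time b y \<in> borel_measurable P"
    using hitting_time_measurable[of b y] l unfolding measurable_cong_sets[OF P refl] by simp
  have Tl: "hitting_time l y \<in> borel_measurable (path_space l)" by (rule hitting_time_measurable[OF l(1)])
  have Tl': "hitting_time l y \<in> borel_measurable (shorten_law l P)"
    using Tl by (simp add: shorten_law_def)
  fix E assume "E \<in> sets (hitting_law (shorten_law l P) l y l)"
  then obtain E' where E': "E' \<in> sets borel" "E = {0..<ereal l} \<inter> E'" unfolding sets_law sets_restrict_space by auto
  have E: "E \<in> sets borel" "E \<subseteq> {0..<ereal l}" using E' by auto
  have "emeasure (hitting_law (shorten_law l P) l y l) E = emeasure (distr (shorten_law l P) borel (hitting_time l y)) E"
    unfolding hitting_law_def by (rule emeasure_restrict_space) (use E in auto)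
  also have "\<dots> = emeasure (shorten_law l P) (hitting_time l y -` E \<inter> space (path_space l))"
    using emeasure_distr[OF Tl' E(1)] by (simp add: shorten_law_def)
  also have "\<dots> = emeasure P (?r -` (hitting_time l y -` E \<inter> space (path_space l)) \<inter> space P)"
    unfolding shorten_law_def by (rule emeasure_distr[OF r measurable_sets[OF Tl E(1)]])
  also have "?r -` (hitting_time l y -` E \<inter> space (path_space l)) \<inter> space P = hitting_time b y -` E \<inter> space P"
  proof -
    have "hitting_time l y (?r \<omega>) \<in> E \<longleftrightarrow> hitting_time b y \<omega> \<in> E" for \<omega>
      unfolding hitting_time_shorten[OF l(2)] using E(2) by auto
    then show ?thesis using measurable_space[OF r] by auto
  qed
  also have "emeasure P (hitting_time b y -` E \<inter> space P) = emeasure (distr P borel (hitting_time b y)) E"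
    by (rule emeasure_distr[OF Tb E(1), symmetric])
  also have "\<dots> = emeasure (hitting_law P b y l) E"
    unfolding hitting_law_def by (rule emeasure_restrict_space[symmetric]) (use E in auto)
  finally show "emeasure (hitting_law (shorten_law l P) l y l) E = emeasure (hitting_law P b y l) E" .
qed

section \<open>Relation between the hitting laws of the two processes\<close>

context pi_transform_processes
begin

text \<open>H is positive, so the relation can be inverted; the second form lets the two laws
  exchange their roles.\<close>

lemma density_relation_emeasure:
  assumes t: "0 \<le> t" "t < l" and A: "A \<in> sets (path_filtration l t)"
  shows "emeasure Q A = (\<integral>\<^sup>+ \<omega>. indicator A \<omega> * ennreal (H t (\<omega> t) / H 0 x) \<partial>P')"
    and "emeasure P' A = (\<integral>\<^sup>+ \<omega>. indicator A \<omega> * ennreal (H 0 x / H t (\<omega> t)) \<partial>Q)"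
proof -
  let ?F = "path_filtration l t"
  define h where "h \<omega> = ennreal (H t (\<omega> t) / H 0 x)" for \<omega>
  define h' where "h' \<omega> = ennreal (H 0 x / H t (\<omega> t))" for \<omega>
  note sP = subalgebra_P'[OF t(2)] and sQ = subalgebra_Q[OF t(2)]
  have Hm: "(\<lambda>\<omega>. H t (\<omega> t)) \<in> borel_measurable ?F" by (rule H_coordinate_measurable) (use t in auto)
  have hF: "h \<in> borel_measurable ?F" "h' \<in> borel_measurable ?F"
    unfolding h_def h'_def using Hm by (auto intro!: measurable_compose[OF _ measurable_ennreal] borel_measurable_divide)
  have rel: "restr_to_subalg Q ?F = density (restr_to_subalg P' ?F) h"
    unfolding h_def by (rule density_relation[OF t])
  have hR: "h \<in> borel_measurable (restr_to_subalg P' ?F)" "h' \<in> borel_measurable (restr_to_subalg P' ?F)"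
    by (rule measurable_in_subalg[OF sP hF(1)], rule measurable_in_subalg[OF sP hF(2)])
  have AR: "A \<in> sets (restr_to_subalg P' ?F)" using A unfolding sets_restr_to_subalg[OF sP] .
  have iA: "(indicator A :: _ \<Rightarrow> ennreal) \<in> borel_measurable ?F" using A by (rule borel_measurable_indicator)
  have "emeasure Q A = emeasure (density (restr_to_subalg P' ?F) h) A"
    unfolding rel[symmetric] by (rule emeasure_restr_to_subalg[OF sQ A, symmetric])
  also have "\<dots> = (\<integral>\<^sup>+ \<omega>. h \<omega> * indicator A \<omega> \<partial>restr_to_subalg P' ?F)" by (rule emeasure_density[OF hR(1) AR])
  also have "\<dots> = (\<integral>\<^sup>+ \<omega>. h \<omega> * indicator A \<omega> \<partial>P')"
    by (rule nn_integral_subalgebra2[OF sP]) (intro borel_measurable_times_ennreal hF iA)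
  finally show "emeasure Q A = (\<integral>\<^sup>+ \<omega>. indicator A \<omega> * ennreal (H t (\<omega> t) / H 0 x) \<partial>P')"
    by (simp only: h_def mult.commute)
  have hh: "h \<omega> * h' \<omega> = 1" for \<omega>
    using H_pos[OF t, of "\<omega> t"] H_pos[of 0 x] ell_bounds(1) by (simp add: h_def h'_def ennreal_mult'[symmetric])
  have "(\<integral>\<^sup>+ \<omega>. indicator A \<omega> * h' \<omega> \<partial>Q) = (\<integral>\<^sup>+ \<omega>. indicator A \<omega> * h' \<omega> \<partial>restr_to_subalg Q ?F)"
    by (rule nn_integral_subalgebra2[OF sQ, symmetric]) (intro borel_measurable_times_ennreal hF iA)
  also have "\<dots> = (\<integral>\<^sup>+ \<omega>. h \<omega> * (indicator A \<omega> * h' \<omega>) \<partial>restr_to_subalg P' ?F)"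
    unfolding rel using hR AR by (intro nn_integral_density borel_measurable_times_ennreal borel_measurable_indicator)
  also have "\<dots> = (\<integral>\<^sup>+ \<omega>. indicator A \<omega> \<partial>restr_to_subalg P' ?F)"
    by (simp only: mult.left_commute[of "h _"] hh mult_1_right)
  also have "\<dots> = emeasure P' A"
    unfolding nn_integral_indicator[OF AR] by (rule emeasure_restr_to_subalg[OF sP A])
  finally show "emeasure P' A = (\<integral>\<^sup>+ \<omega>. indicator A \<omega> * ennreal (H 0 x / H t (\<omega> t)) \<partial>Q)"
    by (simp only: h'_def)
qed

lemma H_continuous: "continuous_on ({0..<l} \<times> UNIV) (\<lambda>(t, z). H t z)"
proof -
  have p: "continuous_on {0..<l} \<phi>" by (rule continuous_on_subset[OF phi_cont]) (use ell_bounds in auto)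
  have q: "continuous_on {0..<l} \<psi>"
    by (rule continuous_on_half_open_interval) (use psi_ac abs_cont_imp_continuous in blast)
  have c: "continuous_on ({0..<l} \<times> UNIV) (\<lambda>z. \<phi> (fst z))" "continuous_on ({0..<l} \<times> UNIV) (\<lambda>z. \<psi> (fst z))"
    by (rule continuous_on_compose2[OF p continuous_on_fst[OF continuous_on_id]] continuous_on_compose2[OF q continuous_on_fst[OF continuous_on_id]]; auto)+
  have nz: "\<psi> (fst z) \<noteq> 0" "\<phi> (fst z) \<noteq> 0" if "z \<in> {0..<l} \<times> UNIV" for z :: "real \<times> real"
    using psi_nonzero[of "fst z"] phi_nonzero[of "fst z"] that ell_bounds by auto
  show ?thesis unfolding H_fun_def case_prod_beta
    using nz by (intro continuous_intros c) auto
qed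

lemma H_factor: "H t z = H t 0 * exp (\<beta> / 2 * (z\<^sup>2 / (\<phi> t * \<psi> t)))"
  by (simp add: H_fun_def)

lemma H_exponent_sign:
  assumes t: "0 \<le> t" "t < l"
  shows "\<alpha> * \<beta> \<le> 0 \<Longrightarrow> \<beta> / 2 * (z\<^sup>2 / (\<phi> t * \<psi> t)) \<le> 0"
    and "0 \<le> \<alpha> * \<beta> \<Longrightarrow> 0 \<le> \<beta> / 2 * (z\<^sup>2 / (\<phi> t * \<psi> t))"
proof -
  define A where "A = \<alpha> + \<beta> * tau \<phi> t"
  have A: "0 < \<alpha> * A" unfolding A_def by (rule ell_sign[OF t])
  have p: "0 < \<phi> t" using phi_pos[of t] t ell_bounds by auto
  have nz: "\<alpha> \<noteq> 0" "A \<noteq> 0" using A by auto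
  \<comment> \<open>Expanding by \<alpha> isolates \<alpha> \<beta>: the remaining denominator
    contains \<alpha> (\<alpha> + \<beta> tau), which is positive before l.\<close>
  have "\<beta> / 2 * (z\<^sup>2 / (\<phi> t * \<psi> t)) = (\<alpha> * \<beta>) * (z\<^sup>2 / (2 * (\<phi> t)\<^sup>2 * (\<alpha> * A)))"
    unfolding Pi_trans_def A_def[symmetric] using p nz by (simp add: field_simps power2_eq_square)
  moreover have "0 \<le> z\<^sup>2 / (2 * (\<phi> t)\<^sup>2 * (\<alpha> * A))" 
    by (rule divide_nonneg_pos[OF zero_le_power2 mult_pos_pos[OF _ A]]) (use p in simp)
  ultimately show "\<alpha> * \<beta> \<le> 0 \<Longrightarrow> \<beta> / 2 * (z\<^sup>2 / (\<phi> t * \<psi> t)) \<le> 0"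
    "0 \<le> \<alpha> * \<beta> \<Longrightarrow> 0 \<le> \<beta> / 2 * (z\<^sup>2 / (\<phi> t * \<psi> t))"
    by (simp_all only: mult_nonpos_nonneg mult_nonneg_nonneg)
qed

text \<open>At z = 0 compactness of [0,t] bounds H from above and away from 0; the exponential
  factor is at most 1 or at least 1 according to the sign of \<alpha> \<beta>.\<close>

lemma H_bounded:
  assumes t: "0 \<le> t" "t < l"
  shows "\<alpha> * \<beta> \<le> 0 \<Longrightarrow> \<exists>C. \<forall>s\<in>{0..t}. \<forall>z. H s z / H 0 x \<le> C"
    and "0 \<le> \<alpha> * \<beta> \<Longrightarrow> \<exists>C. \<forall>s\<in>{0..t}. \<forall>z. H 0 x / H s z \<le> C"
proof -
  have st: "0 \<le> s" "s < l" if "s \<in> {0..t}" for s using that t by auto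
  have H0: "0 < H 0 x" using H_pos[of 0 x] ell_bounds by simp
  have c: "continuous_on {0..t} (\<lambda>s. (\<lambda>(t, z). H t z) (s, 0))"
    by (rule continuous_on_compose2[OF H_continuous]) (use t in \<open>auto intro!: continuous_intros\<close>)
  then have c: "continuous_on {0..t} (\<lambda>s. H s 0)" by simp
  have ne: "{0..t} \<noteq> {}" using t by simp
  obtain p where p: "\<forall>s\<in>{0..t}. H s 0 \<le> H p 0"
    using continuous_attains_sup[OF compact_Icc ne c] by blast
  obtain q where q: "q \<in> {0..t}" "\<forall>s\<in>{0..t}. H q 0 \<le> H s 0"
    using continuous_attains_inf[OF compact_Icc ne c] by blast
  {
    assume ab: "\<alpha> * \<beta> \<le> 0"
    have "H s z / H 0 x \<le> H p 0 / H 0 x" if s: "s \<in> {0..t}" for s z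
    proof (rule divide_right_mono)
      have "H s z \<le> H s 0 * 1" unfolding H_factor[of s z]
        using H_exponent_sign(1)[OF st[OF s] ab, of z] H_pos[OF st[OF s], of 0] by (intro mult_left_mono) (auto simp: less_imp_le)
      then show "H s z \<le> H p 0" using p s by fastforce
    qed (use H0 in simp)
    then show "\<exists>C. \<forall>s\<in>{0..t}. \<forall>z. H s z / H 0 x \<le> C" by blast
  }
  {
    assume ab: "0 \<le> \<alpha> * \<beta>"
    have "H 0 x / H s z \<le> H 0 x / H q 0" if s: "s \<in> {0..t}" for s z
    proof (rule divide_left_mono)
      have "H s 0 * 1 \<le> H s z" unfolding H_factor[of s z]
        using H_exponent_sign(2)[OF st[OF s] ab, of z] H_pos[OF st[OF s], of 0] by (intro mult_left_mono) (auto simp: less_imp_le)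
      then show "H q 0 \<le> H s z" using q(2) s by fastforce
      show "0 < H s z * H q 0" using H_pos[OF st[OF s]] H_pos[OF st[OF q(1)]] by simp
    qed (use H0 in simp)
    then show "\<exists>C. \<forall>s\<in>{0..t}. \<forall>z. H 0 x / H s z \<le> C" by blast
  }
qed

text \<open>For \<alpha> \<beta> \<le> 0 the density H / H 0 is bounded and the general result
  applies directly. Otherwise only its reciprocal is bounded: the law of the hitting time of X is
  expressed through that of Y, and multiplying by the reciprocal density inverts the
  formula.\<close>

theorem hitting_law_relation:
  "hitting_law Q l y l = density (hitting_law P b y l) (\<lambda>t. ennreal (H (real_of_ereal t) y / H 0 x))"
proof -
  have H0: "0 < H 0 x" using H_pos[of 0 x] ell_bounds by simp
  have fin: "finite_measure P'" "finite_measure Q"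
    using prob_space.finite_measure prob_P' prob_Q by auto
  have Hnz: "H (fst z) (snd z) \<noteq> 0" if "z \<in> {0..<l} \<times> UNIV" for z :: "real \<times> real"
    using H_pos[of "fst z" "snd z"] that by auto
  have cH: "continuous_on ({0..<l} \<times> UNIV) (\<lambda>z. H (fst z) (snd z))"
    using H_continuous by (simp add: case_prod_beta)
  have c1: "continuous_on ({0..<l} \<times> UNIV) (\<lambda>(t, z). H t z / H 0 x)"
    unfolding case_prod_beta using H0 by (intro continuous_intros cH) auto
  have c2: "continuous_on ({0..<l} \<times> UNIV) (\<lambda>(t, z). H 0 x / H t z)"
    unfolding case_prod_beta using Hnz by (intro continuous_intros cH) auto
  have "hitting_law Q l y l = density (hitting_law P' l y l) (\<lambda>t. ennreal (H (real_of_ereal t) y / H 0 x))"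
  proof (cases "\<alpha> * \<beta> \<le> 0")
    case True
    show ?thesis
      by (rule hitting_law_density(2)[OF ell_bounds(1) sets_laws(2,3) fin density_relation_emeasure(1) c1 H_bounded(1)[OF _ _ True]])
  next
    case False
    then have ab: "0 \<le> \<alpha> * \<beta>" by simp
    let ?L = "hitting_law Q l y l" and ?\<Omega> = "{0..<ereal l}"
    define k where "k t = ennreal (H 0 x / H (real_of_ereal t) y)" for t
    define k' where "k' t = ennreal (H (real_of_ereal t) y / H 0 x)" for t
    note swap = hitting_law_density[OF ell_bounds(1) sets_laws(3,2) fin(2,1) density_relation_emeasure(2) c2 H_bounded(2)[OF _ _ ab]]
    have L: "hitting_law P' l y l = density ?L k" unfolding k_def by (rule swap(2))
    have sets_L: "sets ?L = sets (restrict_space borel ?\<Omega>)"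
      unfolding hitting_law_def by (rule sets_restrict_space_cong) simp
    have km: "k \<in> borel_measurable ?L"
      unfolding measurable_cong_sets[OF sets_L refl] k_def by (rule swap(1))
    have kk: "k t * k' t = 1" if "t \<in> space ?L" for t
    proof -
      have "0 \<le> t" "t < ereal l" using that by (auto simp: hitting_law_def space_restrict_space)
      then have "0 \<le> real_of_ereal t" "real_of_ereal t < l" by (cases t; auto)+
      from H_pos[OF this, of y] show ?thesis using H0 by (simp add: k_def k'_def ennreal_mult'[symmetric])
    qed
    \<comment> \<open>The exchanged application gives measurability of k; that of k' follows since
      k' is its inverse on the space of the hitting law.\<close>
    have k'm: "k' \<in> borel_measurable ?L"
    proof -
      have "(\<lambda>t. inverse (k t)) \<in> borel_measurable ?L" using km by measurable
      moreover have "k' t = inverse (k t)" if "t \<in> space ?L" for t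
      proof -
        have "0 \<le> t" "t < ereal l" using that by (auto simp: hitting_law_def space_restrict_space)
        then have "0 \<le> real_of_ereal t" "real_of_ereal t < l" by (cases t; auto)+
        from H_pos[OF this, of y] show ?thesis using H0 by (simp add: k_def k'_def inverse_ennreal)
      qed
      ultimately show ?thesis by (simp cong: measurable_cong)
    qed
    have "density (density ?L k) k' = density ?L (\<lambda>t. k t * k' t)" by (rule density_density_eq[OF km k'm])
    also have "\<dots> = density ?L (\<lambda>_. 1)" using km k'm kk by (intro density_cong) auto
    also have "\<dots> = ?L" by (rule density_1)
    finally show ?thesis unfolding L k'_def[symmetric] by simp
  qed
  then show ?thesis using hitting_law_shorten[OF ell_bounds sets_laws(1)] by simp
qed

end

theorem lemma3p2:
  fixes \<alpha> \<beta> a b :: real and \<phi> :: "real \<Rightarrow> real"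
    and M :: "'w measure" and B :: "real \<Rightarrow> 'w \<Rightarrow> real" and X :: "real \<Rightarrow> real \<Rightarrow> 'w \<Rightarrow> real"
    and N :: "'v measure" and W :: "real \<Rightarrow> 'v \<Rightarrow> real" and Y :: "real \<Rightarrow> real \<Rightarrow> 'v \<Rightarrow> real"
  defines "\<l> \<equiv> ell \<alpha> \<beta> b a \<phi>"
    and "H \<equiv> H_fun \<alpha> \<beta> \<phi>"
    and "P \<equiv> \<lambda>x. path_law M b (X x)"
    and "Q \<equiv> \<lambda>x. path_law N (ell \<alpha> \<beta> b a \<phi>) (Y x)"
  assumes alpha: "\<alpha> \<noteq> 0"
    and phi: "\<phi> \<in> class_A b a" "locally_absolutely_continuous b \<phi>" "\<phi> 0 = 1"
    and P_process: "brownian_motion M B" "\<And>x. strong_solution M B \<phi> b x (X x)"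
    and Q_process: "brownian_motion N W" "\<And>x. strong_solution N W (Pi_trans \<alpha> \<beta> \<phi>) \<l> x (Y x)"
  shows "(\<forall>x. martingale (P x) (path_filtration b) \<l> (\<lambda>t \<omega>. H t (\<omega> t))) \<and>
    (\<forall>x. \<forall>t\<in>{0..<\<l>}.
       restr_to_subalg (Q x) (path_filtration \<l> t) =
       density (restr_to_subalg (shorten_law \<l> (P x)) (path_filtration \<l> t))
         (\<lambda>\<omega>. ennreal (H t (\<omega> t) / H 0 x))) \<and>
    (\<forall>x y.
       hitting_law (Q x) \<l> y \<l> =
       density (hitting_law (P x) b y \<l>) (\<lambda>t. ennreal (H (real_of_ereal t) y / H 0 x)))"
proof -
  \<comment> \<open>The locale fixes one starting point, so it is instantiated for every x
    separately.\<close>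
  have "pi_transform_processes \<alpha> \<beta> a b \<phi> M B (X x) N W (Y x) x" for x
    using assms(5-) unfolding \<l>_def by unfold_locales auto
  then show ?thesis
    unfolding \<l>_def H_def P_def Q_def
    using pi_transform_processes.H_martingale pi_transform_processes.density_relation
      pi_transform_processes.hitting_law_relation
    by (intro conjI allI ballI) (fastforce, fastforce, fastforce)
qed

end
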